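(* Let $n\ge 3$, let $d_1,\ldots,d_n\ge 2$ be integers, and let $f_j\in S_{d_j}$ ($j=1,\ldots,n$) be homogeneous polynomials in $S=\mathbb{C}[x_1,\ldots,x_n]$ such that $J(\mathbf{f})=(f_1,\ldots,f_n)$ is a $0$-dimensional complete intersection. Put $T=\sum_{j=1}^n d_j-n$ and $M(\mathbf{f})=S/J(\mathbf{f})$. Assume that $J(\mathbf{f})$ satisfies the following two conditions, which are equivalent to each other: (1) the projective hypersurface in $\mathbb{P}^{n-1}$ defined by $A_{\mathbf{f}}(y_1,\ldots,y_n)=0$ is smooth, where $A_{\mathbf{f}}$ is the associated form of $\mathbf{f}$; (2) $\mathbb{P}(J(\mathbf{f})_{T-1})\cap \mathcal{V}^{T-1}_n=\emptyset$, the intersection being taken in $\mathbb{P}(S_{T-1})$. Then the Strong Lefschetz Property holds for $M(\mathbf{f})$ in degree $k=1$, i.e. for a generic linear form $\ell\in S_1$ the multiplication map $$\ell^{T-2}: M(\mathbf{f})_1\to M(\mathbf{f})_{T-1}$$ is an isomorphism. In particular, the Strong Lefschetz Property in degree $k=1$ holds for $M(\mathbf{f})$ for any generic $0$-dimensional homogeneous complete intersection $\mathbf{f}$ (of any given multidegree $(d_1,\ldots,d_n)$ with all $d_j\ge2$).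
   Context: $S=\mathbb{C}[x_1,\ldots,x_n]$ has the standard grading, and $S_m$, $J_m$, $M_m$ denote degree $m$ homogeneous components. The ideal $J(\mathbf{f})=(f_1,\ldots,f_n)$, with $\mathbf{f}=(f_1,\ldots,f_n)$, is a $0$-dimensional complete intersection if $f_1,\ldots,f_n$ have only the origin of $\mathbb{C}^n$ as common zero. Then $M(\mathbf{f})=S/J(\mathbf{f})$ is a graded Artinian Gorenstein algebra with socle degree $T=\sum_{j=1}^n d_j-n$. Associated form: let $\mathrm{Jac}(\mathbf{f})=\det(\partial f_i/\partial x_j)$, whose class spans the socle $\mathrm{Soc}(M(\mathbf{f}))=M(\mathbf{f})_T$, and let $\omega:\mathrm{Soc}(M(\mathbf{f}))\to\mathbb{C}$ be the linear isomorphism with $\omega(\overline{\mathrm{Jac}(\mathbf{f})})=1$. The associated form $A_{\mathbf{f}}\in \mathbb{C}[y_1,\ldots,y_n]$ is the homogeneous polynomial of degree $T$ defined by $A_{\mathbf{f}}(y_1,\ldots,y_n)=\omega\big((y_1\overline{x_1}+\cdots+y_n\overline{x_n})^T\big)$, where $\overline{x_i}\in M(\mathbf{f})$ is the class of $x_i$. Veronese variety: $\mathcal{V}^m_n\subset\mathbb{P}(S_m)$ is the image of the map $\mathbb{P}(S_1)\to\mathbb{P}(S_m)$, $\ell\mapsto \ell^m$. "Generic" means: for all elements of some non-empty Zariski open subset of the relevant parameter space ($S_1$ for linear forms; $S_{d_1}\times\cdots\times S_{d_n}$ for complete intersections of multidegree $(d_1,\ldots,d_n)$). *)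

theory Defs
  imports
    "HOL-Library.Poly_Mapping"
    "HOL-Analysis.Determinants"
    "HOL-Algebra.QuotRing"
begin

text \<open>
  Polynomials over \<open>\<complex>\<close> in variables indexed by a type \<open>'v\<close> are finitely supported maps from
  exponent vectors to coefficients. The type class instances of \<^theory>\<open>HOL-Library.Poly_Mapping\<close>
  make this type a commutative ring. For \<open>'v = 'n\<close> finite it is \<open>\<complex>[x\<^sub>1,\<dots>,x\<^sub>n]\<close> with
  \<open>n = CARD('n)\<close>; points of \<open>\<complex>\<^sup>n\<close> are functions \<open>'n \<Rightarrow> complex\<close>, and an \<open>n\<close>-tuple of polynomials
  is a function on \<open>'n\<close>.
\<close>

type_synonym 'v cpoly = "('v \<Rightarrow>\<^sub>0 nat) \<Rightarrow>\<^sub>0 complex"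

abbreviation coeff_at :: "'v cpoly \<Rightarrow> ('v \<Rightarrow>\<^sub>0 nat) \<Rightarrow> complex" where
  "coeff_at \<equiv> Poly_Mapping.lookup"

definition const_poly :: "complex \<Rightarrow> 'v cpoly" where
  "const_poly c = Poly_Mapping.single 0 c"

definition var_poly :: "'v \<Rightarrow> 'v cpoly" where
  "var_poly i = Poly_Mapping.single (Poly_Mapping.single i 1) 1"

definition eval_poly :: "('v \<Rightarrow> complex) \<Rightarrow> 'v cpoly \<Rightarrow> complex" where
  "eval_poly x p = (\<Sum>t\<in>Poly_Mapping.keys p. coeff_at p t *
     (\<Prod>v\<in>Poly_Mapping.keys t. x v ^ Poly_Mapping.lookup t v))"

definition partial_deriv :: "'v \<Rightarrow> 'v cpoly \<Rightarrow> 'v cpoly" where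
  "partial_deriv i p = (\<Sum>t\<in>Poly_Mapping.keys p.
     Poly_Mapping.single (t - Poly_Mapping.single i 1)
       (of_nat (Poly_Mapping.lookup t i) * coeff_at p t))"

definition monom_degree :: "('v \<Rightarrow>\<^sub>0 nat) \<Rightarrow> nat" where
  "monom_degree t = (\<Sum>v\<in>Poly_Mapping.keys t. Poly_Mapping.lookup t v)"

text \<open>The graded piece \<open>S\<^sub>m\<close>; it contains 0.\<close>

definition forms :: "nat \<Rightarrow> 'v cpoly set" where
  "forms m = {p. \<forall>t\<in>Poly_Mapping.keys p. monom_degree t = m}"

definition poly_ring :: "'v cpoly ring" where
  "poly_ring = \<lparr>carrier = UNIV, monoid.mult = (*), one = 1, ring.zero = 0, add = (+)\<rparr>"

definition ideal_J :: "('n::finite \<Rightarrow> 'n cpoly) \<Rightarrow> 'n cpoly set" where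
  "ideal_J f = Idl\<^bsub>poly_ring\<^esub> (range f)"

definition complete_intersection :: "('n::finite \<Rightarrow> 'n cpoly) \<Rightarrow> bool" where
  "complete_intersection f \<longleftrightarrow> {z. \<forall>j. eval_poly z (f j) = 0} = {\<lambda>_. 0}"

definition alg_M :: "('n::finite \<Rightarrow> 'n cpoly) \<Rightarrow> 'n cpoly set ring" where
  "alg_M f = poly_ring Quot (ideal_J f)"

definition cls :: "('n::finite \<Rightarrow> 'n cpoly) \<Rightarrow> 'n cpoly \<Rightarrow> 'n cpoly set" where
  "cls f p = ideal_J f +>\<^bsub>poly_ring\<^esub> p"

definition graded_M :: "('n::finite \<Rightarrow> 'n cpoly) \<Rightarrow> nat \<Rightarrow> 'n cpoly set set" where
  "graded_M f m = cls f ` forms m"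

text \<open>Subtraction on \<^typ>\<open>nat\<close> does not truncate here when all \<open>d j \<ge> 1\<close>.\<close>

definition socle_degree :: "('n::finite \<Rightarrow> nat) \<Rightarrow> nat" where
  "socle_degree d = (\<Sum>j\<in>UNIV. d j) - CARD('n)"

text \<open>The socle is the annihilator of the maximal ideal generated by the \<open>x\<^sub>i\<close>, that is, of the
  classes of the polynomials with constant term 0.\<close>

definition socle :: "('n::finite \<Rightarrow> 'n cpoly) \<Rightarrow> 'n cpoly set set" where
  "socle f = {u \<in> carrier (alg_M f).
     \<forall>g. coeff_at g 0 = 0 \<longrightarrow> cls f g \<otimes>\<^bsub>alg_M f\<^esub> u = \<zero>\<^bsub>alg_M f\<^esub>}"

definition Jac :: "('n::finite \<Rightarrow> 'n cpoly) \<Rightarrow> 'n cpoly" where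
  "Jac f = det (\<chi> i j. partial_deriv j (f i))"

definition is_socle_iso :: "('n::finite \<Rightarrow> 'n cpoly) \<Rightarrow> ('n cpoly set \<Rightarrow> complex) \<Rightarrow> bool" where
  "is_socle_iso f w \<longleftrightarrow>
     (\<forall>u\<in>socle f. \<forall>v\<in>socle f. w (u \<oplus>\<^bsub>alg_M f\<^esub> v) = w u + w v) \<and>
     (\<forall>c. \<forall>u\<in>socle f. w (cls f (const_poly c) \<otimes>\<^bsub>alg_M f\<^esub> u) = c * w u) \<and>
     bij_betw w (socle f) UNIV \<and>
     w (cls f (Jac f)) = 1"

text \<open>For a homogeneous complete intersection the socle is the line spanned by the class of the
  Jacobian, so the choice below is unique on the socle; values outside it are irrelevant.\<close>

definition omega :: "('n::finite \<Rightarrow> 'n cpoly) \<Rightarrow> 'n cpoly set \<Rightarrow> complex" where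
  "omega f = (SOME w. is_socle_iso f w)"

definition assoc_form :: "('n::finite \<Rightarrow> nat) \<Rightarrow> ('n \<Rightarrow> 'n cpoly) \<Rightarrow> 'n cpoly" where
  "assoc_form d f = (THE A. A \<in> forms (socle_degree d) \<and>
     (\<forall>y. eval_poly y A =
        omega f ((\<Oplus>\<^bsub>alg_M f\<^esub>i\<in>UNIV. cls f (const_poly (y i)) \<otimes>\<^bsub>alg_M f\<^esub> cls f (var_poly i))
                   [^]\<^bsub>alg_M f\<^esub> socle_degree d)))"

text \<open>Smoothness of the hypersurface \<open>A = 0\<close> in \<open>\<P>\<^sup>n\<^sup>-\<^sup>1\<close> (as a scheme, so not of its reduction)
  for a form \<open>A\<close>, by the Jacobian criterion in homogeneous coordinates.\<close>

definition smooth_hypersurface :: "'n::finite cpoly \<Rightarrow> bool" where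
  "smooth_hypersurface A \<longleftrightarrow>
     (\<forall>y. y \<noteq> (\<lambda>_. 0) \<and> eval_poly y A = 0 \<longrightarrow> (\<exists>i. eval_poly y (partial_deriv i A) \<noteq> 0))"

definition proj_point :: "'v cpoly \<Rightarrow> 'v cpoly set" where
  "proj_point p = {const_poly c * p | c. c \<noteq> 0}"

definition proj_space :: "'v cpoly set \<Rightarrow> 'v cpoly set set" where
  "proj_space V = proj_point ` (V - {0})"

definition veronese :: "nat \<Rightarrow> 'v cpoly set set" where
  "veronese m = (\<lambda>l. proj_point (l ^ m)) ` (forms 1 - {0})"

text \<open>
  \<open>U\<close> is Zariski open in the affine space \<open>V\<close>, where \<open>coord x\<close> is the family of coordinates of the
  point \<open>x\<close>: \<open>U\<close> is the complement in \<open>V\<close> of the zero set of a set of polynomials in the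
  coordinates. For \<open>V = S\<^sub>m\<close> the coordinates are the coefficients.
\<close>

definition zariski_open :: "('p \<Rightarrow> 'v \<Rightarrow> complex) \<Rightarrow> 'p set \<Rightarrow> 'p set \<Rightarrow> bool" where
  "zariski_open coord V U \<longleftrightarrow>
     (\<exists>P :: 'v cpoly set. U = {x \<in> V. \<exists>p\<in>P. eval_poly (coord x) p \<noteq> 0})"

definition generically :: "('p \<Rightarrow> 'v \<Rightarrow> complex) \<Rightarrow> 'p set \<Rightarrow> ('p \<Rightarrow> bool) \<Rightarrow> bool" where
  "generically coord V Q \<longleftrightarrow> (\<exists>U. zariski_open coord V U \<and> U \<noteq> {} \<and> (\<forall>x\<in>U. Q x))"

definition tuples :: "('n::finite \<Rightarrow> nat) \<Rightarrow> ('n \<Rightarrow> 'n cpoly) set" where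
  "tuples d = {f. \<forall>j. f j \<in> forms (d j)}"

definition tuple_coord :: "('n \<Rightarrow> 'n cpoly) \<Rightarrow> 'n \<times> ('n \<Rightarrow>\<^sub>0 nat) \<Rightarrow> complex" where
  "tuple_coord f = (\<lambda>(j, t). coeff_at (f j) t)"

text \<open>The multiplication map is \<open>\<complex>\<close>-linear, hence an isomorphism iff it is bijective between the
  graded pieces.\<close>

definition strong_lefschetz :: "('n::finite \<Rightarrow> nat) \<Rightarrow> ('n \<Rightarrow> 'n cpoly) \<Rightarrow> nat \<Rightarrow> bool" where
  "strong_lefschetz d f k \<longleftrightarrow>
     generically coeff_at (forms 1) (\<lambda>l.
       bij_betw (\<lambda>u. (cls f l [^]\<^bsub>alg_M f\<^esub> (socle_degree d - 2 * k)) \<otimes>\<^bsub>alg_M f\<^esub> u)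
         (graded_M f k) (graded_M f (socle_degree d - k)))"

end

theory Submission
  imports Defs "Jordan_Normal_Form.Determinant"
    "HOL-Computational_Algebra.Fundamental_Theorem_Algebra"
    "HOL-Analysis.Continuum_Not_Denumerable"
begin

text \<open>
  Write \<open>J\<close> for the ideal of the complete intersection \<open>f\<close>, \<open>T\<close> for its socle degree, and \<open>\<ell>\<close> for
  a linear form. Everything rests on one fact: modulo \<open>J\<close> the socle is the line spanned by the
  Jacobian. A polynomial outside \<open>J\<close> that is homogeneous of degree \<open>m\<close> then has a multiple of degree
  \<open>T\<close> outside \<open>J\<close>, and \<open>\<omega>\<close> gives a pairing of degrees \<open>m\<close> and \<open>T - m\<close> that is perfect
  (\<open>multiple_in_socle_degree\<close>).

  \<^emph>\<open>The socle.\<close> By the Nullstellensatz \<open>J\<close> contains the powers \<open>x\<^sub>i\<^sup>N\<close>, so \<open>x\<^sub>i\<^sup>N = \<Sum>j. C\<^sub>i\<^sub>j f\<^sub>j\<close> for a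
  matrix \<open>C\<close>. Wiebe's theorem (\<open>wiebe\<close>) says that \<open>det C \<cdot> p \<in> (x\<^sub>1\<^sup>N, \<dots>, x\<^sub>n\<^sup>N)\<close> forces \<open>p \<in> J\<close>; it
  holds because the powers \<open>x\<^sub>i\<^sup>N\<close> form a regular sequence, which for monomials can be read off the
  exponents. Hence multiplication by \<open>det C\<close> embeds the socle of \<open>S/J\<close> into that of
  \<open>S/(x\<^sub>1\<^sup>N, \<dots>, x\<^sub>n\<^sup>N)\<close>, which is spanned by one monomial. By Euler's identity the Jacobian matrix \<open>F\<close>
  expresses the \<open>d\<^sub>j f\<^sub>j\<close> through the variables, so \<open>C F\<close>, after scaling, expresses the \<open>x\<^sub>i\<^sup>N\<close>
  through the variables. Wiebe's theorem for \<open>C F\<close> and \<open>p = 1\<close> shows that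
  \<open>det C \<cdot> Jac f\<close> is not in \<open>(x\<^sub>1\<^sup>N, \<dots>, x\<^sub>n\<^sup>N)\<close>, hence \<open>Jac f \<notin> J\<close> (\<open>socle_spanned_by_det\<close>).

  \<^emph>\<open>Smoothness.\<close> The \<open>i\<close>-th partial derivative of the associated form at \<open>\<ell>\<close> is
  \<open>T \<omega>(x\<^sub>i \<ell>\<^sup>T\<^sup>-\<^sup>1)\<close>. By the perfect pairing of degrees \<open>1\<close> and \<open>T - 1\<close>, the singular points are exactly
  the \<open>\<ell>\<close> with \<open>\<ell>\<^sup>T\<^sup>-\<^sup>1 \<in> J\<close> (\<open>singular_point_iff\<close>).

  \<^emph>\<open>The Lefschetz property.\<close> The Hessian matrix of the associated form at \<open>\<ell>\<close> is
  \<open>T (T - 1) (\<omega>(x\<^sub>i x\<^sub>j \<ell>\<^sup>T\<^sup>-\<^sup>2))\<^sub>i\<^sub>j\<close>, which is the matrix of \<open>\<ell>\<^sup>T\<^sup>-\<^sup>2\<close> from degree \<open>1\<close> to degree \<open>T - 1\<close>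
  under the pairing. So one \<open>\<ell>\<close> with nonzero Hessian determinant suffices
  (\<open>strong_lefschetz_if_hess\<close>). If the associated form is smooth, then its partial derivatives are
  themselves a complete intersection, their Jacobian is the Hessian, and it is nonzero by the fact
  above (\<open>strong_lefschetz_if_smooth\<close>).

  \<^emph>\<open>The generic case.\<close> That \<open>J\<close> contains all forms of degree \<open>T + 1\<close>, and that
  \<open>\<ell>\<^sup>T\<^sup>-\<^sup>2 S\<^sub>1 + J\<close> contains those of degree \<open>T - 1\<close> for \<open>\<ell> = x\<^sub>1 + \<dots> + x\<^sub>n\<close>, are open conditions on \<open>f\<close>
  (\<open>spanning_mod_ideal_open\<close>). They imply the two claims and hold for \<open>f\<^sub>j = x\<^sub>j\<^bsup>d j\<^esup>\<close>, where the
  Hessian is explicit (\<open>fermat_hess\<close>).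
\<close>

abbreviation expo :: "'v \<Rightarrow> 'v \<Rightarrow>\<^sub>0 nat" where
  "expo i \<equiv> Poly_Mapping.single i 1"

(* Keeps "forms 1" and "expo i" from being rewritten to versions with "Suc 0". *)
declare One_nat_def [simp del]

section \<open>Evaluation of polynomials\<close>

lemma poly_eq_sum_monomials:
  "(p :: 'v cpoly) = (\<Sum>t\<in>Poly_Mapping.keys p. Poly_Mapping.single t (coeff_at p t))"
proof (rule poly_mapping_eqI)
  fix s
  have "coeff_at (\<Sum>t\<in>Poly_Mapping.keys p. Poly_Mapping.single t (coeff_at p t)) s
      = (\<Sum>t\<in>Poly_Mapping.keys p. if t = s then coeff_at p t else 0)"
    by (simp add: lookup_sum lookup_single when_def)
  also have "\<dots> = coeff_at p s"
    by (simp add: sum.delta' in_keys_iff)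
  finally show "coeff_at p s = coeff_at (\<Sum>t\<in>Poly_Mapping.keys p. Poly_Mapping.single t (coeff_at p t)) s" ..
qed

lemma poly_induct [case_names monomial add]:
  fixes p :: "'v cpoly"
  assumes "\<And>t c. P (Poly_Mapping.single t c)" and "\<And>p q. P p \<Longrightarrow> P q \<Longrightarrow> P (p + q)"
  shows "P p"
proof -
  have "P (\<Sum>t\<in>A. Poly_Mapping.single t (coeff_at p t))" if "finite A" for A
    using that
  proof (induction A)
    case empty
    show ?case using assms(1)[of 0 0] by simp
  next
    case (insert x A)
    then show ?case by (simp add: assms)
  qed
  then show ?thesis by (subst poly_eq_sum_monomials) simp
qed

definition monom_eval :: "('v \<Rightarrow> complex) \<Rightarrow> ('v \<Rightarrow>\<^sub>0 nat) \<Rightarrow> complex" where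
  "monom_eval x t = (\<Prod>v\<in>Poly_Mapping.keys t. x v ^ Poly_Mapping.lookup t v)"

lemma monom_eval_superset:
  assumes "finite A" "Poly_Mapping.keys t \<subseteq> A"
  shows "monom_eval x t = (\<Prod>v\<in>A. x v ^ Poly_Mapping.lookup t v)"
  unfolding monom_eval_def using assms by (intro prod.mono_neutral_left) (auto simp: in_keys_iff)

lemma monom_eval_zero [simp]: "monom_eval x 0 = 1"
  by (simp add: monom_eval_def)

lemma monom_eval_single [simp]: "monom_eval x (Poly_Mapping.single i k) = x i ^ k"
  by (simp add: monom_eval_def)

lemma monom_eval_add: "monom_eval x (s + t) = monom_eval x s * monom_eval x t"
proof -
  let ?A = "Poly_Mapping.keys s \<union> Poly_Mapping.keys t"
  have "Poly_Mapping.keys (s + t) \<subseteq> ?A" by (rule keys_add)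
  then show ?thesis
    by (simp add: monom_eval_superset[of ?A] lookup_add power_add prod.distrib)
qed

lemma eval_poly_single [simp]: "eval_poly x (Poly_Mapping.single t c) = c * monom_eval x t"
  by (simp add: eval_poly_def monom_eval_def)

lemma eval_poly_zero [simp]: "eval_poly x 0 = 0"
  by (simp add: eval_poly_def)

lemma eval_poly_add [simp]: "eval_poly x (p + q) = eval_poly x p + eval_poly x q"
  unfolding eval_poly_def
  by (rule setsum_keys_plus_distrib) (simp_all add: algebra_simps)

lemma eval_poly_mult [simp]: "eval_poly x (p * q) = eval_poly x p * eval_poly x q"
proof (induction p rule: poly_induct)
  case (monomial t c)
  show ?case
    by (induction q rule: poly_induct) (simp_all add: mult_single monom_eval_add algebra_simps)
qed (simp add: algebra_simps)

lemma eval_poly_one [simp]: "eval_poly x 1 = 1"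
  using eval_poly_single[of x 0 1] by simp

lemma eval_poly_uminus [simp]: "eval_poly x (- p) = - eval_poly x p"
  using eval_poly_add[of x p "- p"] by (simp add: add_eq_0_iff)

lemma eval_poly_diff [simp]: "eval_poly x (p - q) = eval_poly x p - eval_poly x q"
  using eval_poly_add[of x p "- q"] by simp

lemma eval_poly_sum [simp]: "eval_poly x (\<Sum>i\<in>A. p i) = (\<Sum>i\<in>A. eval_poly x (p i))"
  by (induction A rule: infinite_finite_induct) simp_all

lemma eval_poly_prod [simp]: "eval_poly x (\<Prod>i\<in>A. p i) = (\<Prod>i\<in>A. eval_poly x (p i))"
  by (induction A rule: infinite_finite_induct) simp_all

lemma eval_poly_power [simp]: "eval_poly x (p ^ k) = eval_poly x p ^ k"
  by (induction k) simp_all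

lemma eval_const_poly [simp]: "eval_poly x (const_poly c) = c"
  by (simp add: const_poly_def)

lemma eval_var_poly [simp]: "eval_poly x (var_poly i) = x i"
  by (simp add: var_poly_def)

lemma const_poly_0 [simp]: "const_poly 0 = 0"
  and const_poly_1 [simp]: "const_poly 1 = 1"
  by (simp_all add: const_poly_def)

lemma const_poly_add: "const_poly (a + b) = const_poly a + const_poly b"
  and const_poly_mult: "const_poly (a * b) = const_poly a * const_poly b"
  and const_poly_uminus: "const_poly (- a) = - const_poly a"
  and const_poly_diff: "const_poly (a - b) = const_poly a - const_poly b"
  by (simp_all add: const_poly_def single_add mult_single single_uminus single_diff)

lemma const_poly_mult_single:
  "const_poly c * Poly_Mapping.single t b = Poly_Mapping.single t (c * b)"
  by (simp add: const_poly_def mult_single)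

lemma coeff_const_mult [simp]: "coeff_at (const_poly c * p) t = c * coeff_at p t"
  by (induction p rule: poly_induct)
    (simp_all add: const_poly_mult_single lookup_single when_def lookup_add algebra_simps)

lemma const_poly_inverse: "c \<noteq> 0 \<Longrightarrow> const_poly (inverse c) * (const_poly c * p) = p"
  by (simp add: mult.assoc[symmetric] flip: const_poly_mult)

lemma coeff_single_mult_add:
  "coeff_at (Poly_Mapping.single s c * p) (s + t) = c * coeff_at p t"
  by (induction p rule: poly_induct)
    (simp_all add: mult_single lookup_single when_def lookup_add distrib_left)

lemma coeff_single_mult_eq_0:
  assumes "\<nexists>u. t = s + u"
  shows "coeff_at (Poly_Mapping.single s c * p) t = 0"
  using assms
  by (induction p rule: poly_induct)
    (auto simp: mult_single lookup_single when_def lookup_add distrib_left)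

text \<open>Over an infinite field the polynomial is determined by its values: eliminate one variable
  at a time, reading the polynomial as a univariate one in that variable.\<close>

lemma eval_poly_eq_0_imp_zero_on:
  assumes "finite V" "\<And>t. t \<in> Poly_Mapping.keys p \<Longrightarrow> Poly_Mapping.keys t \<subseteq> V" "\<And>y. eval_poly y p = 0"
  shows "(p :: 'v cpoly) = 0"
  using assms
proof (induction V arbitrary: p rule: finite_induct)
  case empty
  then have "Poly_Mapping.keys p \<subseteq> {0}" by auto
  then have "p = Poly_Mapping.single 0 (coeff_at p 0)"
    by (intro poly_mapping_eqI) (auto simp: lookup_single when_def in_keys_iff)
  then show ?case using empty.prems(2) by (metis eval_poly_single monom_eval_zero mult.right_neutral single_zero)
next
  case (insert v V)
  define D where "D = Max (insert 0 ((\<lambda>t. Poly_Mapping.lookup t v) ` Poly_Mapping.keys p))"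
  have D: "Poly_Mapping.lookup t v \<le> D" if "t \<in> Poly_Mapping.keys p" for t
    unfolding D_def using that by (intro Max_ge) auto
  define E where "E k = {t \<in> Poly_Mapping.keys p. Poly_Mapping.lookup t v = k}" for k
  define q where "q k = (\<Sum>t\<in>E k. Poly_Mapping.single (t - Poly_Mapping.single v k) (coeff_at p t))" for k
  have fE: "finite (E k)" for k by (simp add: E_def)
  have split: "t = Poly_Mapping.single v k + (t - Poly_Mapping.single v k)" if "t \<in> E k" for t k
    using that by (intro poly_mapping_eqI) (auto simp: E_def lookup_add lookup_minus lookup_single when_def)
  have keq: "Poly_Mapping.keys t \<subseteq> V" if "t \<in> Poly_Mapping.keys (q k)" for t k
  proof -
    have "t \<in> (\<Union>s\<in>E k. Poly_Mapping.keys (Poly_Mapping.single (s - Poly_Mapping.single v k) (coeff_at p s)))"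
      using that unfolding q_def by (rule subsetD[OF keys_sum])
    then obtain s where s: "s \<in> E k" "t = s - Poly_Mapping.single v k" by (auto split: if_splits)
    then have "Poly_Mapping.keys s \<subseteq> insert v V" "Poly_Mapping.lookup s v = k"
      using insert.prems(1) by (auto simp: E_def)
    then show ?thesis using s(2)
      by (auto simp: subset_iff in_keys_iff lookup_minus lookup_single when_def split: if_splits)
  qed
  have ev: "eval_poly y p = (\<Sum>k\<le>D. eval_poly y (q k) * y v ^ k)" for y
  proof -
    have "eval_poly y p = (\<Sum>t\<in>Poly_Mapping.keys p. coeff_at p t * monom_eval y t)"
      by (simp add: eval_poly_def monom_eval_def)
    also have "Poly_Mapping.keys p = (\<Union>k\<in>{..D}. E k)" using D by (auto simp: E_def)
    also have "(\<Sum>t\<in>(\<Union>k\<in>{..D}. E k). coeff_at p t * monom_eval y t)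
        = (\<Sum>k\<le>D. \<Sum>t\<in>E k. coeff_at p t * monom_eval y t)"
      by (rule sum.UNION_disjoint) (use fE in \<open>auto simp: E_def\<close>)
    also have "\<dots> = (\<Sum>k\<le>D. eval_poly y (q k) * y v ^ k)"
    proof (rule sum.cong[OF refl])
      fix k
      have "(\<Sum>t\<in>E k. coeff_at p t * monom_eval y t)
          = (\<Sum>t\<in>E k. coeff_at p t * monom_eval y (t - Poly_Mapping.single v k) * y v ^ k)"
        by (rule sum.cong[OF refl]) (metis split monom_eval_add monom_eval_single mult.commute mult.left_commute)
      also have "\<dots> = eval_poly y (q k) * y v ^ k" by (simp add: q_def sum_distrib_right)
      finally show "(\<Sum>t\<in>E k. coeff_at p t * monom_eval y t) = eval_poly y (q k) * y v ^ k" .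
    qed
    finally show ?thesis .
  qed
  have indep: "eval_poly (y(v := z)) (q k) = eval_poly y (q k)" for y z k
    unfolding eval_poly_def
  proof (intro sum.cong[OF refl] arg_cong2[of _ _ _ _ "(*)"] prod.cong refl)
    fix t u assume "t \<in> Poly_Mapping.keys (q k)" "u \<in> Poly_Mapping.keys t"
    then have "u \<noteq> v" using keq insert.hyps by auto
    then show "(y(v := z)) u ^ Poly_Mapping.lookup t u = y u ^ Poly_Mapping.lookup t u" by simp
  qed
  have "q k = 0" if "k \<le> D" for k
  proof (rule insert.IH)
    fix y
    have "\<forall>z. (\<Sum>k\<le>D. eval_poly y (q k) * z ^ k) = 0"
      using ev[of "y(v := _)"] insert.prems(2) by (simp add: indep)
    then show "eval_poly y (q k) = 0" using that by (simp add: polyfun_eq_0)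
  qed (rule keq)
  have "coeff_at p t = 0" for t
  proof (cases "t \<in> Poly_Mapping.keys p")
    case True
    define k where "k = Poly_Mapping.lookup t v"
    have tE: "t \<in> E k" "k \<le> D" using True D by (auto simp: E_def k_def)
    have "coeff_at (q k) (t - Poly_Mapping.single v k)
        = (\<Sum>s\<in>E k. if s = t then coeff_at p s else 0)"
      unfolding q_def lookup_sum
    proof (rule sum.cong[OF refl])
      fix s assume "s \<in> E k"
      then have "s - Poly_Mapping.single v k = t - Poly_Mapping.single v k \<longleftrightarrow> s = t"
        using split tE(1) by metis
      then show "coeff_at (Poly_Mapping.single (s - Poly_Mapping.single v k) (coeff_at p s)) (t - Poly_Mapping.single v k)
          = (if s = t then coeff_at p s else 0)"
        by (auto simp: lookup_single when_def)
    qed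
    also have "\<dots> = coeff_at p t" using tE fE by simp
    finally show ?thesis using \<open>\<And>k. k \<le> D \<Longrightarrow> q k = 0\<close> tE(2) by simp
  qed (simp add: in_keys_iff)
  then show ?case by (intro poly_mapping_eqI) simp
qed

lemma eval_poly_eq_0_imp_zero: "(\<And>y. eval_poly y p = 0) \<Longrightarrow> p = 0" for p :: "'n::finite cpoly"
  by (rule eval_poly_eq_0_imp_zero_on[of UNIV]) auto

section \<open>Homogeneous polynomials\<close>

lemma monom_degree_superset:
  assumes "finite A" "Poly_Mapping.keys t \<subseteq> A"
  shows "monom_degree t = (\<Sum>v\<in>A. Poly_Mapping.lookup t v)"
  unfolding monom_degree_def using assms by (intro sum.mono_neutral_left) (auto simp: in_keys_iff)

lemma monom_degree_UNIV: "monom_degree (t :: 'n::finite \<Rightarrow>\<^sub>0 nat) = (\<Sum>v\<in>UNIV. Poly_Mapping.lookup t v)"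
  by (rule monom_degree_superset) auto

lemma monom_degree_add: "monom_degree (s + t) = monom_degree s + monom_degree t"
proof -
  let ?A = "Poly_Mapping.keys s \<union> Poly_Mapping.keys t"
  have "Poly_Mapping.keys (s + t) \<subseteq> ?A" by (rule keys_add)
  then show ?thesis
    by (simp add: monom_degree_superset[of ?A] lookup_add sum.distrib)
qed

lemma monom_degree_zero [simp]: "monom_degree 0 = 0"
  and monom_degree_single [simp]: "monom_degree (Poly_Mapping.single i k) = k"
  by (simp_all add: monom_degree_def)

lemma forms_iff: "p \<in> forms m \<longleftrightarrow> (\<forall>t. coeff_at p t \<noteq> 0 \<longrightarrow> monom_degree t = m)"
  by (auto simp: forms_def in_keys_iff)

lemma forms_0 [simp]: "0 \<in> forms m"
  by (simp add: forms_iff)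

lemma forms_single [simp]: "monom_degree t = m \<Longrightarrow> Poly_Mapping.single t c \<in> forms m"
  by (auto simp: forms_iff lookup_single when_def)

lemma forms_add: "p \<in> forms m \<Longrightarrow> q \<in> forms m \<Longrightarrow> p + q \<in> forms m"
  by (auto simp: forms_iff lookup_add) (metis add_0)

lemma forms_uminus: "p \<in> forms m \<Longrightarrow> - p \<in> forms m"
  by (auto simp: forms_iff)

lemma forms_diff: "p \<in> forms m \<Longrightarrow> q \<in> forms m \<Longrightarrow> p - q \<in> forms m"
  using forms_add[of p m "- q"] forms_uminus[of q m] by simp

lemma forms_sum: "(\<And>i. i \<in> A \<Longrightarrow> p i \<in> forms m) \<Longrightarrow> (\<Sum>i\<in>A. p i) \<in> forms m"
  by (induction A rule: infinite_finite_induct) (auto intro: forms_add)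

lemma forms_mult: "p \<in> forms m \<Longrightarrow> q \<in> forms k \<Longrightarrow> p * q \<in> forms (m + k)"
  unfolding forms_def using keys_mult[of p q] by (fastforce simp: monom_degree_add)

lemma forms_one: "1 \<in> forms 0"
  by (simp add: forms_def)

lemma forms_const [simp]: "const_poly c \<in> forms 0"
  by (simp add: const_poly_def)

lemma forms_const_mult: "p \<in> forms m \<Longrightarrow> const_poly c * p \<in> forms m"
  using forms_mult[of "const_poly c" 0 p m] by simp

lemma forms_var [simp]: "var_poly i \<in> forms 1"
  by (simp add: var_poly_def)

lemma forms_power: "p \<in> forms m \<Longrightarrow> p ^ k \<in> forms (k * m)"
  by (induction k) (auto simp: forms_one intro: forms_mult)

lemma forms_prod: "(\<And>i. i \<in> A \<Longrightarrow> p i \<in> forms (m i)) \<Longrightarrow> (\<Prod>i\<in>A. p i) \<in> forms (\<Sum>i\<in>A. m i)"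
  by (induction A rule: infinite_finite_induct) (auto simp: forms_one intro: forms_mult)

lemma forms_monomials_induct [consumes 1, case_names zero monomial add]:
  assumes "p \<in> forms m" "P 0" "\<And>t c. monom_degree t = m \<Longrightarrow> P (Poly_Mapping.single t c)"
    and "\<And>p q. P p \<Longrightarrow> P q \<Longrightarrow> P (p + q)"
  shows "P p"
proof -
  have "P (\<Sum>t\<in>A. Poly_Mapping.single t (coeff_at p t))" if "finite A" "A \<subseteq> Poly_Mapping.keys p" for A
    using that
  proof (induction A)
    case (insert x A)
    then have "P (Poly_Mapping.single x (coeff_at p x))" using assms(1,3) by (auto simp: forms_def)
    with insert show ?case by (simp add: assms(4))
  qed (simp add: assms(2))
  then show ?thesis by (subst poly_eq_sum_monomials) simp
qed

definition hom_component :: "nat \<Rightarrow> 'v cpoly \<Rightarrow> 'v cpoly" where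
  "hom_component m p = (\<Sum>t\<in>{t\<in>Poly_Mapping.keys p. monom_degree t = m}. Poly_Mapping.single t (coeff_at p t))"

lemma coeff_hom_component: "coeff_at (hom_component m p) t = (if monom_degree t = m then coeff_at p t else 0)"
proof -
  have "coeff_at (hom_component m p) t
      = (\<Sum>s\<in>{t\<in>Poly_Mapping.keys p. monom_degree t = m}. if s = t then coeff_at p s else 0)"
    by (simp add: hom_component_def lookup_sum lookup_single when_def)
  then show ?thesis by (simp add: sum.delta' in_keys_iff)
qed

lemma hom_component_forms [simp]: "hom_component m p \<in> forms m"
  by (simp add: forms_iff coeff_hom_component)

lemma hom_component_add: "hom_component m (p + q) = hom_component m p + hom_component m q"
  by (intro poly_mapping_eqI) (simp add: coeff_hom_component lookup_add)

lemma hom_component_diff: "hom_component m (p - q) = hom_component m p - hom_component m q"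
  by (intro poly_mapping_eqI) (simp add: coeff_hom_component lookup_minus)

lemma hom_component_0 [simp]: "hom_component m 0 = 0"
  by (intro poly_mapping_eqI) (simp add: coeff_hom_component)

lemma hom_component_sum: "hom_component m (\<Sum>i\<in>A. p i) = (\<Sum>i\<in>A. hom_component m (p i))"
  by (induction A rule: infinite_finite_induct) (simp_all add: hom_component_add)

lemma hom_component_of_form: "p \<in> forms k \<Longrightarrow> hom_component m p = (if m = k then p else 0)"
  by (intro poly_mapping_eqI) (auto simp: coeff_hom_component forms_iff)

lemma hom_component_mult_form:
  assumes "q \<in> forms e"
  shows "hom_component m (p * q) = (if e \<le> m then hom_component (m - e) p * q else 0)"
proof (induction p rule: poly_induct)
  case (monomial t c)
  have "Poly_Mapping.single t c * q \<in> forms (monom_degree t + e)"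
    using assms by (auto intro: forms_mult)
  then have "hom_component m (Poly_Mapping.single t c * q)
      = (if m = monom_degree t + e then Poly_Mapping.single t c * q else 0)"
    by (rule hom_component_of_form)
  moreover have "hom_component (m - e) (Poly_Mapping.single t c)
      = (if m - e = monom_degree t then Poly_Mapping.single t c else 0)"
    by (rule hom_component_of_form) simp
  ultimately show ?case by auto
qed (simp add: hom_component_add distrib_right)

lemma finite_monomials: "finite {t :: 'n::finite \<Rightarrow>\<^sub>0 nat. monom_degree t \<le> m}"
proof -
  have "Poly_Mapping.lookup ` {t :: 'n \<Rightarrow>\<^sub>0 nat. monom_degree t \<le> m} \<subseteq> UNIV \<rightarrow>\<^sub>E {..m}"
  proof (clarsimp simp: monom_degree_UNIV PiE_iff)
    fix t :: "'n \<Rightarrow>\<^sub>0 nat" and i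
    assume "(\<Sum>v\<in>UNIV. Poly_Mapping.lookup t v) \<le> m"
    then show "Poly_Mapping.lookup t i \<le> m"
      using member_le_sum[of i UNIV "Poly_Mapping.lookup t"] by simp
  qed
  moreover have "finite (UNIV \<rightarrow>\<^sub>E {..m} :: ('n \<Rightarrow> nat) set)" by (intro finite_PiE) auto
  ultimately have "finite (Poly_Mapping.lookup ` {t :: 'n \<Rightarrow>\<^sub>0 nat. monom_degree t \<le> m})"
    by (rule finite_subset)
  then show ?thesis
    by (rule finite_imageD) (simp add: inj_on_def lookup_inject)
qed

definition lin_form :: "('n::finite \<Rightarrow> complex) \<Rightarrow> 'n cpoly" where
  "lin_form y = (\<Sum>i\<in>UNIV. const_poly (y i) * var_poly i)"

lemma monom_degree_1_iff: "monom_degree (t :: 'n::finite \<Rightarrow>\<^sub>0 nat) = 1 \<longleftrightarrow> (\<exists>i. t = expo i)"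
proof
  assume t: "monom_degree t = 1"
  then obtain i where i: "Poly_Mapping.lookup t i \<noteq> 0"
    by (metis monom_degree_zero poly_mapping_eqI lookup_zero zero_neq_one)
  have rest: "v \<in> UNIV - {i} \<Longrightarrow> Poly_Mapping.lookup t v \<le> (\<Sum>v\<in>UNIV - {i}. Poly_Mapping.lookup t v)" for v
    by (rule member_le_sum) auto
  have "monom_degree t = Poly_Mapping.lookup t i + (\<Sum>v\<in>UNIV - {i}. Poly_Mapping.lookup t v)"
    unfolding monom_degree_UNIV by (simp add: sum.remove)
  with t i have "Poly_Mapping.lookup t i = 1" "(\<Sum>v\<in>UNIV - {i}. Poly_Mapping.lookup t v) = 0"
    by linarith+
  moreover from this rest have "v \<noteq> i \<Longrightarrow> Poly_Mapping.lookup t v = 0" for v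
    by simp
  ultimately  have "t = expo i" by (intro poly_mapping_eqI) (auto simp: lookup_single when_def)
  then show "\<exists>i. t = expo i" ..
qed auto

lemma lin_form_forms [simp]: "lin_form y \<in> forms 1"
  unfolding lin_form_def by (intro forms_sum forms_const_mult) simp

lemma coeff_lin_form [simp]: "coeff_at (lin_form y) (expo i) = y i"
proof -
  have "coeff_at (lin_form y) (expo i) = (\<Sum>j\<in>UNIV. if j = i then y j else 0)"
    unfolding lin_form_def lookup_sum
    by (rule sum.cong) (auto simp: var_poly_def lookup_single when_def dest: arg_cong[where f = Poly_Mapping.keys])
  then show ?thesis by simp
qed

lemma lin_form_coeffs: "l \<in> forms 1 \<Longrightarrow> l = lin_form (\<lambda>i. coeff_at l (expo i))"
proof (rule poly_mapping_eqI)
  fix t assume l: "l \<in> forms 1"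
  show "coeff_at l t = coeff_at (lin_form (\<lambda>i. coeff_at l (expo i))) t"
  proof (cases "monom_degree t = 1")
    case True
    then obtain i where "t = expo i" by (auto simp: monom_degree_1_iff)
    then show ?thesis by simp
  next
    case False
    then show ?thesis using l lin_form_forms[of "\<lambda>i. coeff_at l (expo i)"] unfolding forms_iff by metis
  qed
qed

lemma lin_form_eq_0_iff: "lin_form y = 0 \<longleftrightarrow> y = (\<lambda>_. 0)"
proof
  assume "lin_form y = 0"
  then show "y = (\<lambda>_. 0)" by (metis coeff_lin_form lookup_zero)
qed (simp add: lin_form_def)

section \<open>Partial derivatives\<close>

lemma partial_deriv_single:
  "partial_deriv k (Poly_Mapping.single t c) = Poly_Mapping.single (t - expo k) (of_nat (Poly_Mapping.lookup t k) * c)"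
  by (simp add: partial_deriv_def)

lemma partial_deriv_add: "partial_deriv k (p + q) = partial_deriv k p + partial_deriv k q"
  unfolding partial_deriv_def
  by (rule setsum_keys_plus_distrib) (simp_all add: single_add algebra_simps)

lemma partial_deriv_0 [simp]: "partial_deriv k 0 = 0"
  by (simp add: partial_deriv_def)

lemma partial_deriv_sum: "partial_deriv k (\<Sum>i\<in>A. p i) = (\<Sum>i\<in>A. partial_deriv k (p i))"
  by (induction A rule: infinite_finite_induct) (simp_all add: partial_deriv_add)

lemma partial_deriv_const_mult:
  "partial_deriv k (const_poly c * p) = const_poly c * partial_deriv k p"
  by (induction p rule: poly_induct)
    (simp_all add: const_poly_mult_single partial_deriv_single partial_deriv_add algebra_simps)

lemma expo_add_minus: "Poly_Mapping.lookup t k \<noteq> 0 \<Longrightarrow> expo k + (t - expo k) = t"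
  by (rule poly_mapping_eqI) (auto simp: lookup_add lookup_minus lookup_single when_def)

lemma partial_deriv_var_mult:
  "partial_deriv k (var_poly i * p) = (if i = k then p else 0) + var_poly i * partial_deriv k p"
proof (induction p rule: poly_induct)
  case (monomial t c)
  show ?case
  proof (cases "Poly_Mapping.lookup t k = 0")
    case True
    then show ?thesis
      by (auto simp: var_poly_def mult_single partial_deriv_single lookup_add lookup_single when_def)
  next
    case False
    then have "expo i + t - expo k = expo i + (t - expo k)"
      using expo_add_minus[OF False] by (metis add_diff_cancel_left' add.left_commute)
    then show ?thesis using expo_add_minus[OF False]
      by (auto simp: var_poly_def mult_single partial_deriv_single lookup_add lookup_single when_def
          single_add algebra_simps)
  qed
qed (auto simp: partial_deriv_add algebra_simps)

lemma forms_partial_deriv: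
  assumes "p \<in> forms m"
  shows "partial_deriv k p \<in> forms (m - 1)"
  using assms
proof (induction rule: forms_monomials_induct)
  case (monomial t c)
  show ?case
  proof (cases "Poly_Mapping.lookup t k = 0")
    case False
    have "monom_degree t = 1 + monom_degree (t - expo k)"
      using expo_add_minus[OF False] by (metis monom_degree_add monom_degree_single)
    then show ?thesis using monomial by (simp add: partial_deriv_single)
  qed (simp add: partial_deriv_single)
qed (auto simp: partial_deriv_add forms_add)

lemma euler_identity:
  assumes "p \<in> forms m"
  shows "(\<Sum>k\<in>UNIV. var_poly k * partial_deriv k p) = const_poly (of_nat m) * (p :: 'n::finite cpoly)"
  using assms
proof (induction rule: forms_monomials_induct)
  case (monomial t c)
  have "(\<Sum>k\<in>UNIV. var_poly k * partial_deriv k (Poly_Mapping.single t c))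
      = (\<Sum>k\<in>UNIV. Poly_Mapping.single t (of_nat (Poly_Mapping.lookup t k) * c))"
  proof (rule sum.cong[OF refl])
    fix k
    show "var_poly k * partial_deriv k (Poly_Mapping.single t c)
        = Poly_Mapping.single t (of_nat (Poly_Mapping.lookup t k) * c)"
      by (cases "Poly_Mapping.lookup t k = 0")
        (simp_all add: var_poly_def partial_deriv_single mult_single expo_add_minus)
  qed
  also have "\<dots> = Poly_Mapping.single t (\<Sum>k\<in>UNIV. of_nat (Poly_Mapping.lookup t k) * c)"
    by (rule poly_mapping_eqI) (simp add: lookup_sum lookup_single when_def)
  also have "(\<Sum>k\<in>UNIV. of_nat (Poly_Mapping.lookup t k) * c) = of_nat m * c"
    using monomial by (simp add: monom_degree_UNIV flip: sum_distrib_right of_nat_sum)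
  finally show ?case by (simp add: const_poly_mult_single)
qed (simp_all add: partial_deriv_add sum.distrib distrib_left)

section \<open>The ideal generated by a family of polynomials\<close>

lemma poly_ring_simps [simp]:
  "carrier poly_ring = UNIV" "mult poly_ring = (*)" "one poly_ring = 1"
  "zero poly_ring = 0" "add poly_ring = (+)"
  by (simp_all add: poly_ring_def)

lemma cring_poly_ring: "cring (poly_ring :: 'v cpoly ring)"
proof (rule cringI)
  show "abelian_group (poly_ring :: 'v cpoly ring)"
  proof (rule abelian_groupI)
    fix x :: "'v cpoly"
    show "\<exists>y\<in>carrier poly_ring. y \<oplus>\<^bsub>poly_ring\<^esub> x = \<zero>\<^bsub>poly_ring\<^esub>"
      by (rule bexI[of _ "- x"]) simp_all
  qed (simp_all add: algebra_simps)
  show "Group.comm_monoid (poly_ring :: 'v cpoly ring)"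
    by (rule Group.comm_monoidI) (simp_all add: algebra_simps)
qed (simp add: algebra_simps)

lemma ring_poly_ring: "Ring.ring poly_ring"
  by (rule cring.axioms(1)[OF cring_poly_ring])

definition ideal_set :: "'v cpoly set \<Rightarrow> bool" where
  "ideal_set I \<longleftrightarrow> 0 \<in> I \<and> (\<forall>p\<in>I. \<forall>q\<in>I. p + q \<in> I) \<and> (\<forall>p\<in>I. \<forall>q. q * p \<in> I)"

lemma ideal_set_0: "ideal_set I \<Longrightarrow> 0 \<in> I"
  and ideal_set_add: "ideal_set I \<Longrightarrow> p \<in> I \<Longrightarrow> q \<in> I \<Longrightarrow> p + q \<in> I"
  and ideal_set_mult: "ideal_set I \<Longrightarrow> p \<in> I \<Longrightarrow> q * p \<in> I"
  and ideal_set_mult': "ideal_set I \<Longrightarrow> p \<in> I \<Longrightarrow> p * q \<in> I"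
  by (auto simp: ideal_set_def mult.commute)

lemma ideal_set_uminus: "ideal_set I \<Longrightarrow> p \<in> I \<Longrightarrow> - p \<in> I"
  using ideal_set_mult[of I p "- 1"] by simp

lemma ideal_set_diff: "ideal_set I \<Longrightarrow> p \<in> I \<Longrightarrow> q \<in> I \<Longrightarrow> p - q \<in> I"
  using ideal_set_add[of I p "- q"] ideal_set_uminus[of I q] by simp

lemma ideal_set_sum: "ideal_set I \<Longrightarrow> (\<And>i. i \<in> A \<Longrightarrow> p i \<in> I) \<Longrightarrow> (\<Sum>i\<in>A. p i) \<in> I"
  by (induction A rule: infinite_finite_induct) (auto intro: ideal_set_0 ideal_set_add)

lemma ideal_set_const_mult_iff:
  assumes "ideal_set I" "c \<noteq> 0"
  shows "const_poly c * p \<in> I \<longleftrightarrow> p \<in> I"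
  using ideal_set_mult[OF assms(1)] const_poly_inverse[OF assms(2), of p] by metis

lemma ideal_set_cong:
  assumes "ideal_set I" "p - q \<in> I"
  shows "p \<in> I \<longleftrightarrow> q \<in> I"
  using ideal_set_add[OF assms(1,2), of q] ideal_set_diff[OF assms(1) _ assms(2), of p] by auto

text \<open>The elementary predicate is the ideal of the ring record, so that the definitions in terms of
  the record reduce to statements about sets of polynomials.\<close>

lemma ideal_set_iff_ideal: "ideal_set I \<longleftrightarrow> ideal I poly_ring"
proof
  assume I: "ideal_set I"
  have inv: "\<ominus>\<^bsub>poly_ring\<^esub> p = - p" for p :: "'a cpoly"
    by (rule abelian_group.minus_equality[OF ring.is_abelian_group[OF ring_poly_ring]]) simp_all
  have "subgroup I (add_monoid poly_ring)"
  proof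
    fix p assume "p \<in> I"
    then show "inv\<^bsub>add_monoid poly_ring\<^esub> p \<in> I"
      using ideal_set_uminus[OF I] inv[of p] by (simp only: a_inv_def)
  qed (use I in \<open>auto simp: ideal_set_def\<close>)
  then show "ideal I poly_ring"
    by (rule idealI[OF ring_poly_ring]) (auto intro: ideal_set_mult[OF I] ideal_set_mult'[OF I])
next
  assume "ideal I poly_ring"
  then interpret ideal I poly_ring .
  show "ideal_set I"
    using additive_subgroup.zero_closed[OF is_additive_subgroup]
      additive_subgroup.a_closed[OF is_additive_subgroup] I_l_closed
    by (auto simp: ideal_set_def)
qed

lemma mem_ideal_J: "p \<in> ideal_J f \<longleftrightarrow> (\<exists>g. p = (\<Sum>j\<in>UNIV. g j * f j))"
proof -
  let ?G = "{\<Sum>j\<in>UNIV. g j * f j | g. True}"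
  have G: "ideal_set ?G"
    unfolding ideal_set_def
  proof (intro conjI ballI allI)
    show "0 \<in> ?G" by (auto intro!: exI[of _ "\<lambda>_. 0"])
  next
    fix p q assume "p \<in> ?G" "q \<in> ?G"
    then obtain g h where "p = (\<Sum>j\<in>UNIV. g j * f j)" "q = (\<Sum>j\<in>UNIV. h j * f j)" by blast
    then show "p + q \<in> ?G"
      by (auto intro!: exI[of _ "\<lambda>j. g j + h j"] simp: sum.distrib distrib_right)
  next
    fix p q assume "p \<in> ?G"
    then obtain g where "p = (\<Sum>j\<in>UNIV. g j * f j)" by blast
    then show "q * p \<in> ?G"
      by (auto intro!: exI[of _ "\<lambda>j. q * g j"] simp: sum_distrib_left mult.assoc)
  qed
  have "range f \<subseteq> ?G"
  proof clarsimp
    fix i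
    have "f i = (\<Sum>j\<in>UNIV. (if j = i then 1 else 0) * f j)"
      by (simp add: if_distrib[of "\<lambda>x. x * _"] cong: if_cong)
    then show "\<exists>g. f i = (\<Sum>j\<in>UNIV. g j * f j)" by (intro exI[of _ "\<lambda>j. if j = i then 1 else 0"])
  qed
  with G have "ideal_J f \<subseteq> ?G"
    unfolding ideal_J_def genideal_def ideal_set_iff_ideal by auto
  moreover have "?G \<subseteq> I" if I: "ideal_set I" "range f \<subseteq> I" for I
    using I by (auto intro!: ideal_set_sum ideal_set_mult)
  then have "?G \<subseteq> ideal_J f"
    unfolding ideal_J_def genideal_def ideal_set_iff_ideal by blast
  ultimately show ?thesis by blast
qed

lemma ideal_J: "ideal_set (ideal_J f)"
  unfolding ideal_set_iff_ideal ideal_J_def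
  by (rule ring.genideal_ideal[OF ring_poly_ring]) simp

lemmas ideal_J_0 [simp] = ideal_set_0[OF ideal_J]
  and ideal_J_add = ideal_set_add[OF ideal_J]
  and ideal_J_diff = ideal_set_diff[OF ideal_J]
  and ideal_J_mult = ideal_set_mult[OF ideal_J]
  and ideal_J_sum = ideal_set_sum[OF ideal_J]
  and ideal_J_cong = ideal_set_cong[OF ideal_J]

lemma ideal_J_gen: "f j \<in> ideal_J f"
  unfolding ideal_J_def by (rule subsetD[OF ring.genideal_self[OF ring_poly_ring]]) auto

lemma ideal_J_least: "ideal_set I \<Longrightarrow> (\<And>j. f j \<in> I) \<Longrightarrow> ideal_J f \<subseteq> I"
  by (auto simp: mem_ideal_J intro!: ideal_set_sum ideal_set_mult)

section \<open>A homogeneous Nullstellensatz\<close>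

text \<open>Such an ideal is prime, and \<open>s\<close> lies in every strictly larger ideal up to a power; so it is
  a maximal ideal of the localization at \<open>s\<close>.\<close>

lemma exists_maximal_avoiding_powers:
  assumes J: "ideal_set J" "\<And>k. s ^ k \<notin> J"
  obtains P where "ideal_set P" "J \<subseteq> P" "\<And>k. s ^ k \<notin> P"
    "\<And>Q. ideal_set Q \<Longrightarrow> P \<subseteq> Q \<Longrightarrow> (\<And>k. s ^ k \<notin> Q) \<Longrightarrow> Q = P"
proof -
  define A where "A = {Q. ideal_set Q \<and> J \<subseteq> Q \<and> (\<forall>k. s ^ k \<notin> Q)}"
  have "\<exists>M\<in>A. \<forall>X\<in>A. M \<subseteq> X \<longrightarrow> X = M"
  proof (rule subset_Zorn_nonempty)
    show "A \<noteq> {}" using J by (auto simp: A_def)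
  next
    fix C assume C: "C \<noteq> {}" "subset.chain A C"
    then have CA: "C \<subseteq> A" and tot: "\<And>X Y. X \<in> C \<Longrightarrow> Y \<in> C \<Longrightarrow> X \<subseteq> Y \<or> Y \<subseteq> X"
      by (auto simp: subset_chain_def)
    have "ideal_set (\<Union>C)"
      unfolding ideal_set_def
    proof (intro conjI ballI allI)
      show "0 \<in> \<Union>C" using C(1) CA by (auto simp: A_def dest!: ideal_set_0)
    next
      fix p q assume "p \<in> \<Union>C" "q \<in> \<Union>C"
      then obtain X Y where "X \<in> C" "Y \<in> C" "p \<in> X" "q \<in> Y" by blast
      then obtain Z where "Z \<in> C" "p \<in> Z" "q \<in> Z" using tot by blast
      then show "p + q \<in> \<Union>C" using CA by (auto simp: A_def intro!: bexI[of _ Z] ideal_set_add)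
    next
      fix p q assume "p \<in> \<Union>C"
      then show "q * p \<in> \<Union>C" using CA by (auto simp: A_def intro: ideal_set_mult)
    qed
    then show "\<Union>C \<in> A" using C(1) CA by (auto simp: A_def)
  qed
  then show ?thesis using that by (auto simp: A_def)
qed

lemma exists_linear_relation:
  fixes u :: "'r \<Rightarrow> 'v cpoly"
  assumes "finite F" "finite B" "card B < card F" "\<And>r. r \<in> F \<Longrightarrow> Poly_Mapping.keys (u r) \<subseteq> B"
  obtains c where "\<exists>r\<in>F. c r \<noteq> 0" "(\<Sum>r\<in>F. const_poly (c r) * u r) = 0"
proof -
  interpret V: vector_space "\<lambda>c (p :: 'v cpoly). const_poly c * p"
    by unfold_locales (simp_all add: algebra_simps const_poly_add const_poly_mult)
  show ?thesis
  proof (cases "inj_on u F")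
    case False
    then obtain r s where rs: "r \<in> F" "s \<in> F" "r \<noteq> s" "u r = u s" by (auto simp: inj_on_def)
    define c where "c x = (if x = r then 1 else if x = s then - 1 else 0 :: complex)" for x
    have "(\<Sum>x\<in>F. const_poly (c x) * u x) = (\<Sum>x\<in>{r, s}. const_poly (c x) * u x)"
      by (rule sum.mono_neutral_right) (use rs assms(1) in \<open>auto simp: c_def\<close>)
    also have "\<dots> = 0" using rs by (simp add: c_def const_poly_uminus)
    finally have "(\<Sum>x\<in>F. const_poly (c x) * u x) = 0" .
    moreover have "\<exists>x\<in>F. c x \<noteq> 0" using rs by (auto simp: c_def)
    ultimately show ?thesis using that[of c] by blast
  next
    case True
    let ?M = "(\<lambda>t. Poly_Mapping.single t (1 :: complex)) ` B"
    have span: "u ` F \<subseteq> V.span ?M"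
    proof clarify
      fix r assume r: "r \<in> F"
      have "(\<Sum>t\<in>Poly_Mapping.keys (u r). const_poly (coeff_at (u r) t) * Poly_Mapping.single t 1) \<in> V.span ?M"
        using assms(4)[OF r] by (intro V.span_sum V.span_scale V.span_base) auto
      then show "u r \<in> V.span ?M"
        by (subst poly_eq_sum_monomials) (simp add: const_poly_mult_single)
    qed
    have "card ?M \<le> card B" using assms(2) by (rule card_image_le)
    then have "\<not> card (u ` F) \<le> card ?M" using True assms(3) by (simp add: card_image)
    then have "V.dependent (u ` F)"
      using V.independent_span_bound[of ?M "u ` F"] span assms(2) by blast
    then obtain c where c: "\<exists>v\<in>u ` F. c v \<noteq> 0" "(\<Sum>v\<in>u ` F. const_poly (c v) * v) = 0"
      using assms(1) by (auto simp: V.dependent_finite)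
    then show ?thesis using that[of "c \<circ> u"] True by (simp add: sum.reindex)
  qed
qed

lemma const_poly_prod: "const_poly (\<Prod>v\<in>A. z v) = (\<Prod>v\<in>A. const_poly (z v))"
  by (induction A rule: infinite_finite_induct) (simp_all add: const_poly_mult)

lemma const_poly_power: "const_poly (z ^ k) = const_poly z ^ k"
  by (induction k) (simp_all add: const_poly_mult)

text \<open>The binary form of degree \<open>D\<close> in \<open>a\<close> and \<open>b\<close> whose dehomogenization is \<open>g\<close>.\<close>

definition binary_form :: "'v cpoly \<Rightarrow> 'v cpoly \<Rightarrow> nat \<Rightarrow> complex poly \<Rightarrow> 'v cpoly" where
  "binary_form a b D g = (\<Sum>k\<le>D. const_poly (Polynomial.coeff g k) * a ^ k * b ^ (D - k))"

lemma binary_form_add: "binary_form a b D (g + h) = binary_form a b D g + binary_form a b D h"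
  and binary_form_smult: "binary_form a b D (Polynomial.smult c g) = const_poly c * binary_form a b D g"
  and binary_form_0 [simp]: "binary_form a b D 0 = 0"
  by (simp_all add: binary_form_def const_poly_add const_poly_mult algebra_simps sum.distrib sum_distrib_left)

lemma binary_form_sum: "binary_form a b D (\<Sum>i\<in>A. g i) = (\<Sum>i\<in>A. binary_form a b D (g i))"
  by (induction A rule: infinite_finite_induct) (simp_all add: binary_form_add)

lemma binary_form_linear_mult:
  assumes "Polynomial.degree g \<le> D"
  shows "binary_form a b (Suc D) ([:- r, 1:] * g) = (a - const_poly r * b) * binary_form a b D g"
proof -
  have "Polynomial.coeff g (Suc D) = 0" using assms by (intro coeff_eq_0) simp
  then have "binary_form a b (Suc D) g = b * binary_form a b D g"
    by (simp add: binary_form_def sum_distrib_left Suc_diff_le algebra_simps)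
  moreover have "binary_form a b (Suc D) (pCons 0 g) = a * binary_form a b D g"
    unfolding binary_form_def by (subst sum.atMost_Suc_shift) (simp add: sum_distrib_left algebra_simps)
  moreover have "[:- r, 1:] * g = Polynomial.smult (- r) g + pCons 0 g"
    by simp
  ultimately show ?thesis
    by (simp only: binary_form_add binary_form_smult) (simp add: const_poly_uminus algebra_simps)
qed

lemma binary_form_prod:
  assumes "finite A"
  shows "binary_form a b (card A) (\<Prod>r\<in>A. [:- c r, 1:]) = (\<Prod>r\<in>A. a - const_poly (c r) * b)"
  using assms
proof (induction A)
  case (insert x A)
  have "Polynomial.degree (\<Prod>r\<in>A. [:- c r, 1:]) \<le> (\<Sum>r\<in>A. Polynomial.degree [:- c r, 1:])"
    using degree_prod_sum_le[OF insert.hyps(1), of "\<lambda>r. [:- c r, 1:]"] by (simp add: o_def)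
  then show ?case using insert by (simp del: mult_pCons_left add: binary_form_linear_mult)
qed (simp add: binary_form_def)

text \<open>Over \<open>\<complex>\<close> a nonzero binary form splits into a power of \<open>b\<close> and linear factors \<open>a - c b\<close>, and
  the prime \<open>P\<close> contains no power of \<open>b\<close>.\<close>

lemma binary_form_prime_factor:
  assumes P: "ideal_set P" "\<And>p q. p * q \<in> P \<Longrightarrow> p \<in> P \<or> q \<in> P" "\<And>k. b ^ k \<notin> P"
  assumes "g \<noteq> 0" "Polynomial.degree g \<le> D" "binary_form a b D g \<in> P"
  shows "\<exists>c. a - const_poly c * b \<in> P"
  using assms(4-6)
proof (induction D arbitrary: g)
  case 0
  then obtain c where "g = [:c:]" "c \<noteq> 0" by (auto elim!: degree_eq_zeroE)
  then have "const_poly c * b ^ 0 \<in> P"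
    using 0 by (simp add: binary_form_def)
  then show ?case using P(3)[of 0] \<open>c \<noteq> 0\<close> ideal_set_const_mult_iff[OF P(1)] by blast
next
  case (Suc D)
  show ?case
  proof (cases "Polynomial.degree g = 0")
    case True
    then obtain c where c: "g = [:c:]" "c \<noteq> 0" using Suc.prems(1) by (auto elim!: degree_eq_zeroE)
    have "binary_form a b (Suc D) g = (\<Sum>k\<le>Suc D. if k = 0 then const_poly c * b ^ Suc D else 0)"
      unfolding binary_form_def c(1) by (rule sum.cong) (auto simp: coeff_pCons split: nat.split)
    then have "const_poly c * b ^ Suc D \<in> P" using Suc.prems(3) by simp
    then show ?thesis using P(3)[of "Suc D"] c(2) ideal_set_const_mult_iff[OF P(1)] by blast
  next
    case False
    then obtain z where "Polynomial.poly g z = 0"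
      using fundamental_theorem_of_algebra[of g] by (auto simp: constant_degree)
    then obtain h where h: "g = [:- z, 1:] * h" by (auto simp: poly_eq_0_iff_dvd elim: dvdE)
    then have "h \<noteq> 0" using Suc.prems(1) by auto
    then have deg: "Polynomial.degree h \<le> D"
      using Suc.prems(2) unfolding h by (subst (asm) degree_mult_eq) auto
    have "(a - const_poly z * b) * binary_form a b D h \<in> P"
      using Suc.prems(3) by (simp only: h binary_form_linear_mult[OF deg])
    then show ?thesis using P(2) Suc.IH[OF \<open>h \<noteq> 0\<close> deg] by blast
  qed
qed

lemma uncountable_fiber:
  fixes f :: "complex \<Rightarrow> nat \<times> nat"
  obtains y where "infinite {r. f r = y}"
proof (rule ccontr)
  assume "\<not> thesis"
  then have "finite {r. f r = y}" for y using that by blast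
  then have "countable (\<Union>y. {r. f r = y})" by (intro countable_UN) (auto intro: countable_finite)
  moreover have "(\<Union>y. {r. f r = y}) = UNIV" by auto
  ultimately show False using uncountable_UNIV_complex by simp
qed

text \<open>The residue field argument over an uncountable field, in the localization at \<open>s\<close>: if no
  \<open>a - c s\<close> lay in \<open>P\<close>, then uncountably many of them would be invertible, with inverses in a
  space of countable dimension. A linear relation between the inverses is, after clearing
  denominators, a binary form in \<open>a\<close> and \<open>s\<close> that lies in \<open>P\<close>, and such a form has linear factors.\<close>

lemma exists_residue:
  fixes P :: "'n::finite cpoly set"
  assumes P: "ideal_set P" "\<And>k. s ^ k \<notin> P" "\<And>p q. p * q \<in> P \<Longrightarrow> p \<in> P \<or> q \<in> P"
    and inv: "\<And>p. p \<notin> P \<Longrightarrow> \<exists>u N. s ^ N - u * p \<in> P"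
  shows "\<exists>c. a - const_poly c * s \<in> P"
proof (rule ccontr)
  assume no: "\<nexists>c. a - const_poly c * s \<in> P"
  define l where "l r = a - const_poly r * s" for r
  have "\<forall>r. \<exists>u N. s ^ N - u * l r \<in> P" using no inv unfolding l_def by blast
  then obtain u N where u: "\<And>r. s ^ N r - u r * l r \<in> P" by metis
  (* Sort the inverses u r by the exponent N r and by their degree: one of these countably many
     classes is infinite, and polynomials of bounded degree span a finite-dimensional space. *)
  define m where "m r = Max (insert 0 (monom_degree ` Poly_Mapping.keys (u r)))" for r
  have m: "Poly_Mapping.keys (u r) \<subseteq> {t. monom_degree t \<le> m r}" for r
    by (auto simp: m_def)
  obtain N0 m0 where inf: "infinite {r. (N r, m r) = (N0, m0)}"
    using uncountable_fiber[of "\<lambda>r. (N r, m r)"] by (metis surj_pair)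
  let ?B = "{t :: 'n \<Rightarrow>\<^sub>0 nat. monom_degree t \<le> m0}"
  obtain F where F: "F \<subseteq> {r. (N r, m r) = (N0, m0)}" "finite F" "card F = Suc (card ?B)"
    using infinite_arbitrarily_large[OF inf] by metis
  obtain c where c: "\<exists>r\<in>F. c r \<noteq> 0" "(\<Sum>r\<in>F. const_poly (c r) * u r) = 0"
  proof (rule exists_linear_relation[OF F(2) finite_monomials[of m0]])
    show "card ?B < card F" using F(3) by simp
    show "Poly_Mapping.keys (u r) \<subseteq> ?B" if "r \<in> F" for r using m[of r] that F(1) by auto
  qed
  (* s ^ N0 * G is the linear relation multiplied by the product of all l r, modulo P. *)
  define G where "G = (\<Sum>r\<in>F. const_poly (c r) * (\<Prod>r'\<in>F - {r}. l r'))"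
  have "s ^ N0 * G - (\<Sum>r\<in>F. const_poly (c r) * u r) * (\<Prod>r\<in>F. l r)
      = (\<Sum>r\<in>F. const_poly (c r) * (\<Prod>r'\<in>F - {r}. l r') * (s ^ N r - u r * l r))"
    unfolding G_def sum_distrib_left sum_distrib_right sum_subtractf[symmetric]
  proof (rule sum.cong[OF refl])
    fix r assume r: "r \<in> F"
    then have "(\<Prod>r\<in>F. l r) = l r * (\<Prod>r'\<in>F - {r}. l r')" "N r = N0"
      using F by (auto simp: prod.remove)
    then show "s ^ N0 * (const_poly (c r) * (\<Prod>r'\<in>F - {r}. l r')) - const_poly (c r) * u r * (\<Prod>r\<in>F. l r)
        = const_poly (c r) * (\<Prod>r'\<in>F - {r}. l r') * (s ^ N r - u r * l r)"
      by (simp add: algebra_simps)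
  qed
  also have "\<dots> \<in> P" by (intro ideal_set_sum[OF P(1)] ideal_set_mult[OF P(1)] u)
  finally have "G \<in> P" using c(2) P(2,3) by auto
  define g where "g = (\<Sum>r\<in>F. Polynomial.smult (c r) (\<Prod>r'\<in>F - {r}. [:- r', 1:]))"
  define D where "D = card ?B"
  have cardr: "card (F - {r}) = D" if "r \<in> F" for r using that F by (simp add: D_def)
  have Gg: "G = binary_form a s D g"
    unfolding G_def g_def binary_form_sum binary_form_smult
  proof (rule sum.cong[OF refl])
    fix r assume "r \<in> F"
    then show "const_poly (c r) * (\<Prod>r'\<in>F - {r}. l r')
        = const_poly (c r) * binary_form a s D (\<Prod>r'\<in>F - {r}. [:- r', 1:])"
      using binary_form_prod[of "F - {r}" a s "\<lambda>r. r"] F(2) cardr by (simp add: l_def)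
  qed
  have "Polynomial.degree g \<le> D"
    unfolding g_def
  proof (intro degree_sum_le F(2))
    fix r assume r: "r \<in> F"
    have "Polynomial.degree (\<Prod>r'\<in>F - {r}. [:- r', 1:]) \<le> (\<Sum>r'\<in>F - {r}. 1)"
      using degree_prod_sum_le[of "F - {r}" "\<lambda>r'. [:- r', 1:]"] F(2) by simp
    also have "\<dots> = D" using cardr[OF r] by simp
    finally show "Polynomial.degree (Polynomial.smult (c r) (\<Prod>r'\<in>F - {r}. [:- r', 1:])) \<le> D"
      by (rule order_trans[OF degree_smult_le])
  qed
  moreover have "g \<noteq> 0"
  proof -
    obtain r where r: "r \<in> F" "c r \<noteq> 0" using c(1) by blast
    (* At one of the nodes r all products but one vanish. *)
    have "Polynomial.poly g r = (\<Sum>x\<in>F. if x = r then c r * (\<Prod>r'\<in>F - {r}. r - r') else 0)"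
      unfolding g_def poly_sum
    proof (rule sum.cong[OF refl])
      fix x assume "x \<in> F"
      have "(\<Prod>r'\<in>F - {x}. r - r') = 0" if "x \<noteq> r"
        using that r(1) F(2) by (intro prod_zero) (auto intro!: bexI[of _ r])
      then show "Polynomial.poly (Polynomial.smult (c x) (\<Prod>r'\<in>F - {x}. [:- r', 1:])) r
          = (if x = r then c r * (\<Prod>r'\<in>F - {r}. r - r') else 0)"
        by (auto simp: poly_prod)
    qed
    also have "\<dots> = c r * (\<Prod>r'\<in>F - {r}. r - r')" using r F(2) by simp
    also have "\<dots> \<noteq> 0" using r F(2) by simp
    finally show ?thesis by auto
  qed
  ultimately have "\<exists>c. a - const_poly c * s \<in> P"
    using binary_form_prime_factor[OF P(1,3,2), of g D a] \<open>G \<in> P\<close> Gg by blast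
  with no show False by blast
qed

lemma monomial_eq_prod: "Poly_Mapping.single t 1 = (\<Prod>v\<in>UNIV. var_poly v ^ Poly_Mapping.lookup t v)"
  for t :: "'n::finite \<Rightarrow>\<^sub>0 nat"
proof -
  have pow: "var_poly v ^ k = Poly_Mapping.single (Poly_Mapping.single v k) 1" for v :: 'n and k
    by (induction k) (simp_all add: var_poly_def mult_single plus_1_eq_Suc flip: single_add)
  have "(\<Prod>v\<in>A. Poly_Mapping.single (e v) (1 :: complex)) = Poly_Mapping.single (\<Sum>v\<in>A. e v) 1"
    for A and e :: "'n \<Rightarrow> 'n \<Rightarrow>\<^sub>0 nat"
    by (induction A rule: infinite_finite_induct) (simp_all add: mult_single)
  moreover have "(\<Sum>v\<in>UNIV. Poly_Mapping.single v (Poly_Mapping.lookup t v)) = t"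
    by (rule poly_mapping_eqI) (simp add: lookup_sum lookup_single when_def)
  ultimately show ?thesis by (simp add: pow)
qed

lemma ideal_prod_cong:
  assumes "ideal_set P" "\<And>i. i \<in> A \<Longrightarrow> p i - q i \<in> P"
  shows "(\<Prod>i\<in>A. p i) - (\<Prod>i\<in>A. q i) \<in> P"
  using assms(2)
proof (induction A rule: infinite_finite_induct)
  case (insert x A)
  have "p x * (\<Prod>i\<in>A. p i) - q x * (\<Prod>i\<in>A. q i)
      = p x * ((\<Prod>i\<in>A. p i) - (\<Prod>i\<in>A. q i)) + (\<Prod>i\<in>A. q i) * (p x - q x)"
    by (simp add: algebra_simps)
  also have "\<dots> \<in> P" using insert by (intro ideal_set_add[OF assms(1)] ideal_set_mult[OF assms(1)]) auto
  finally show ?case using insert.hyps by simp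
qed (simp_all add: ideal_set_0[OF assms(1)])

text \<open>Modulo \<open>P\<close> the variables are multiples of \<open>s\<close>, so a form of degree \<open>m\<close> is its value at the
  residues times \<open>s\<^sup>m\<close>.\<close>

lemma form_cong_residues:
  fixes P :: "'n::finite cpoly set"
  assumes P: "ideal_set P" "\<And>j. var_poly j - const_poly (c j) * s \<in> P" and p: "p \<in> forms m"
  shows "p - const_poly (eval_poly c p) * s ^ m \<in> P"
  using p
proof (induction rule: forms_monomials_induct)
  case zero
  then show ?case by (simp add: ideal_set_0[OF P(1)])
next
  case (monomial t b)
  have pw: "var_poly v ^ k - (const_poly (c v) * s) ^ k \<in> P" for v k
    using ideal_prod_cong[OF P(1), of "{..<k}" "\<lambda>_. var_poly v" "\<lambda>_. const_poly (c v) * s"] P(2) by simp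
  have "(\<Prod>v\<in>UNIV. (const_poly (c v) * s) ^ Poly_Mapping.lookup t v) = const_poly (monom_eval c t) * s ^ m"
  proof -
    show ?thesis
      using monomial by (simp add: power_mult_distrib prod.distrib monom_eval_superset[of UNIV]
          monom_degree_UNIV const_poly_prod const_poly_power flip: power_sum)
  qed
  then have "Poly_Mapping.single t 1 - const_poly (monom_eval c t) * s ^ m \<in> P"
    using ideal_prod_cong[OF P(1), of UNIV "\<lambda>v. var_poly v ^ Poly_Mapping.lookup t v"
        "\<lambda>v. (const_poly (c v) * s) ^ Poly_Mapping.lookup t v"] pw by (simp add: monomial_eq_prod)
  then have "const_poly b * (Poly_Mapping.single t 1 - const_poly (monom_eval c t) * s ^ m) \<in> P"
    by (rule ideal_set_mult[OF P(1)])
  then show ?case by (simp add: right_diff_distrib const_poly_mult_single const_poly_mult mult.assoc)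
next
  case (add p q)
  then show ?case using ideal_set_add[OF P(1) add] by (simp add: const_poly_add algebra_simps)
qed

text \<open>If no power of \<open>x\<^sub>i\<close> were in the ideal, then an ideal \<open>P\<close> above it and maximal without powers of
  \<open>x\<^sub>i\<close> would have residues \<open>c\<^sub>j\<close> of \<open>x\<^sub>j / x\<^sub>i\<close> in \<open>\<complex>\<close>, and \<open>c\<close> would be a common zero with \<open>c\<^sub>i = 1\<close>.\<close>

theorem homogeneous_nullstellensatz:
  assumes f: "\<And>j. f j \<in> forms (d j)" and ci: "complete_intersection f"
  shows "\<exists>N. \<forall>i. var_poly i ^ N \<in> ideal_J f"
proof -
  have "\<exists>k. var_poly i ^ k \<in> ideal_J f" for i
  proof (rule ccontr)
    assume "\<nexists>k. var_poly i ^ k \<in> ideal_J f"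
    then obtain P where P: "ideal_set P" "ideal_J f \<subseteq> P" "\<And>k. var_poly i ^ k \<notin> P"
      and max: "\<And>Q. ideal_set Q \<Longrightarrow> P \<subseteq> Q \<Longrightarrow> (\<And>k. var_poly i ^ k \<notin> Q) \<Longrightarrow> Q = P"
      using exists_maximal_avoiding_powers[OF ideal_J] by metis
    have inv: "\<exists>u N. var_poly i ^ N - u * p \<in> P" if p: "p \<notin> P" for p
    proof -
      define Q where "Q = {q. \<exists>u. q - u * p \<in> P}"
      have "ideal_set Q"
        unfolding ideal_set_def Q_def
      proof (intro conjI ballI allI; clarsimp)
        show "\<exists>u. - (u * p) \<in> P" using ideal_set_0[OF P(1)] by (intro exI[of _ 0]) simp
      next
        fix a b u v assume "a - u * p \<in> P" "b - v * p \<in> P"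
        then show "\<exists>u. a + b - u * p \<in> P"
          using ideal_set_add[OF P(1)] by (intro exI[of _ "u + v"]) (force simp: algebra_simps)
      next
        fix a u q assume "a - u * p \<in> P"
        then show "\<exists>u. q * a - u * p \<in> P"
          using ideal_set_mult[OF P(1), of _ q] by (intro exI[of _ "q * u"]) (force simp: algebra_simps)
      qed
      moreover have "P \<subseteq> Q" by (auto simp: Q_def intro!: exI[of _ 0])
      moreover have "p \<in> Q" using ideal_set_0[OF P(1)] by (auto simp: Q_def intro!: exI[of _ 1])
      ultimately show ?thesis using max[of Q] p by (auto simp: Q_def)
    qed
    have prime: "p \<in> P \<or> q \<in> P" if pq: "p * q \<in> P" for p q
    proof (rule ccontr)
      assume "\<not> (p \<in> P \<or> q \<in> P)"
      then obtain u v N M where uv: "var_poly i ^ N - u * p \<in> P" "var_poly i ^ M - v * q \<in> P"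
        using inv by meson
      have "var_poly i ^ (N + M) = var_poly i ^ M * (var_poly i ^ N - u * p)
          + u * p * (var_poly i ^ M - v * q) + u * v * (p * q)"
        by (simp add: power_add algebra_simps)
      also have "\<dots> \<in> P"
        by (intro ideal_set_add[OF P(1)] ideal_set_mult[OF P(1)] uv pq)
      finally show False using P(3) by blast
    qed
    have "\<forall>j. \<exists>c. var_poly j - const_poly c * var_poly i \<in> P"
      using exists_residue[OF P(1,3) prime inv] by blast
    then obtain c where c: "\<And>j. var_poly j - const_poly (c j) * var_poly i \<in> P" by metis
    have "eval_poly c (f j) = 0" for j
    proof (rule ccontr)
      assume nz: "eval_poly c (f j) \<noteq> 0"
      have "f j - const_poly (eval_poly c (f j)) * var_poly i ^ d j \<in> P"
        by (rule form_cong_residues[OF P(1) c f])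
      then have "const_poly (eval_poly c (f j)) * var_poly i ^ d j \<in> P"
        using ideal_set_cong[OF P(1)] P(2) ideal_J_gen by blast
      then show False using P(3) nz ideal_set_const_mult_iff[OF P(1)] by blast
    qed
    then have "c = (\<lambda>_. 0)" using ci by (auto simp: complete_intersection_def)
    then show False using c[of i] P(3)[of 1] by simp
  qed
  then obtain k where k: "\<And>i. var_poly i ^ k i \<in> ideal_J f" by metis
  have "var_poly i ^ (\<Sum>i\<in>UNIV. k i) \<in> ideal_J f" for i
  proof -
    have "k i \<le> (\<Sum>i\<in>UNIV. k i)" by (rule member_le_sum) auto
    then have "var_poly i ^ (\<Sum>i\<in>UNIV. k i) = var_poly i ^ ((\<Sum>i\<in>UNIV. k i) - k i) * var_poly i ^ k i"
      by (simp flip: power_add)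
    then show ?thesis using ideal_J_mult[OF k] by simp
  qed
  then show ?thesis by blast
qed

section \<open>Monomial complete intersections\<close>

text \<open>The ideal generated by the \<open>N\<close>-th powers of the variables \<open>e 0, \<dots>, e (k - 1)\<close>, described by
  exponents so that regularity of the sequence of powers is immediate.\<close>

definition mono_ideal :: "(nat \<Rightarrow> 'v) \<Rightarrow> nat \<Rightarrow> nat \<Rightarrow> 'v cpoly set" where
  "mono_ideal e N k = {w. \<forall>t. coeff_at w t \<noteq> 0 \<longrightarrow> (\<exists>i<k. N \<le> Poly_Mapping.lookup t (e i))}"

lemma var_poly_power: "var_poly v ^ k = Poly_Mapping.single (Poly_Mapping.single v k) 1"
  by (induction k) (simp_all add: var_poly_def mult_single plus_1_eq_Suc flip: single_add)

lemma ideal_mono_ideal: "ideal_set (mono_ideal e N k)"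
  unfolding ideal_set_def
proof (intro conjI ballI allI)
  show "0 \<in> mono_ideal e N k" by (simp add: mono_ideal_def)
next
  fix p q assume "p \<in> mono_ideal e N k" "q \<in> mono_ideal e N k"
  then show "p + q \<in> mono_ideal e N k"
    by (auto simp: mono_ideal_def lookup_add) (metis add_0)
next
  fix p q :: "'a cpoly" assume p: "p \<in> mono_ideal e N k"
  show "q * p \<in> mono_ideal e N k"
    unfolding mono_ideal_def
  proof (clarsimp)
    fix t assume "coeff_at (q * p) t \<noteq> 0"
    then have "t \<in> Poly_Mapping.keys (q * p)" by (simp add: in_keys_iff)
    then obtain a b where "t = a + b" "b \<in> Poly_Mapping.keys p" using keys_mult[of q p] by blast
    then show "\<exists>i<k. N \<le> Poly_Mapping.lookup t (e i)"
      using p by (fastforce simp: mono_ideal_def in_keys_iff lookup_add intro: trans_le_add2)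
  qed
qed

lemmas mono_ideal_0 [simp] = ideal_set_0[OF ideal_mono_ideal]
  and mono_ideal_diff = ideal_set_diff[OF ideal_mono_ideal]
  and mono_ideal_mult = ideal_set_mult[OF ideal_mono_ideal]
  and mono_ideal_mult' = ideal_set_mult'[OF ideal_mono_ideal]
  and mono_ideal_sum = ideal_set_sum[OF ideal_mono_ideal]

lemma mono_ideal_gen: "i < k \<Longrightarrow> var_poly (e i) ^ N \<in> mono_ideal e N k"
  by (auto simp: mono_ideal_def var_poly_power lookup_single when_def)

lemma mono_ideal_trivial: "w \<in> mono_ideal e N 0 \<longleftrightarrow> w = 0"
  by (auto simp: mono_ideal_def intro: poly_mapping_eqI)

text \<open>The quotient in the division of a polynomial by the monomial with exponent \<open>s\<close>. It is additive,
  so that applying it to the values of an alternating tensor gives an alternating tensor.\<close>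

definition mono_div :: "('v \<Rightarrow>\<^sub>0 nat) \<Rightarrow> 'v cpoly \<Rightarrow> 'v cpoly" where
  "mono_div s = Poly_Mapping.map_key (\<lambda>t. s + t)"

lemma coeff_mono_div [simp]: "coeff_at (mono_div s w) t = coeff_at w (s + t)"
  unfolding mono_div_def by (subst map_key.rep_eq) (auto simp: inj_def)

lemma mono_div_uminus: "mono_div s (- w) = - mono_div s w"
  by (rule poly_mapping_eqI) simp

lemma mono_ideal_Suc_division:
  assumes "w \<in> mono_ideal e N (Suc k)"
  shows "w - var_poly (e k) ^ N * mono_div (Poly_Mapping.single (e k) N) w \<in> mono_ideal e N k"
  unfolding mono_ideal_def
proof clarify
  fix t
  let ?s = "Poly_Mapping.single (e k) N"
  assume nz: "coeff_at (w - var_poly (e k) ^ N * mono_div ?s w) t \<noteq> 0"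
  have "\<nexists>u. t = ?s + u"
  proof
    assume "\<exists>u. t = ?s + u"
    then obtain u where "t = ?s + u" ..
    then show False using nz by (simp add: lookup_minus var_poly_power coeff_single_mult_add)
  qed
  then have "coeff_at w t \<noteq> 0" using nz by (simp add: lookup_minus var_poly_power coeff_single_mult_eq_0)
  then obtain i where i: "i < Suc k" "N \<le> Poly_Mapping.lookup t (e i)"
    using assms by (auto simp: mono_ideal_def)
  have "i \<noteq> k"
  proof
    assume "i = k"
    then have "t = ?s + (t - ?s)"
      using i(2) by (intro poly_mapping_eqI) (auto simp: lookup_add lookup_minus lookup_single when_def)
    with \<open>\<nexists>u. t = ?s + u\<close> show False by blast
  qed
  then show "\<exists>i<k. N \<le> Poly_Mapping.lookup t (e i)" using i by (auto simp: less_Suc_eq)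
qed

text \<open>The powers form a regular sequence.\<close>

lemma mono_ideal_regular:
  assumes "var_poly (e k) ^ N * w \<in> mono_ideal e N k" "\<And>i. i < k \<Longrightarrow> e i \<noteq> e k"
  shows "w \<in> mono_ideal e N k"
  unfolding mono_ideal_def
proof clarify
  fix t
  let ?s = "Poly_Mapping.single (e k) N"
  assume "coeff_at w t \<noteq> 0"
  then have "coeff_at (var_poly (e k) ^ N * w) (?s + t) \<noteq> 0"
    by (simp add: var_poly_power coeff_single_mult_add)
  then obtain i where "i < k" "N \<le> Poly_Mapping.lookup (?s + t) (e i)"
    using assms(1) by (auto simp: mono_ideal_def)
  then show "\<exists>i<k. N \<le> Poly_Mapping.lookup t (e i)"
    using assms(2)[of i] by (auto simp: lookup_add lookup_single when_def)
qed

section \<open>Wiebe's theorem for monomial complete intersections\<close>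

text \<open>Elements of the exterior powers of \<open>S\<^sup>n\<close> are encoded as functions on index lists that
  alternate in adjacent arguments: then the Koszul differential is a contraction without signs.\<close>

definition alternating :: "(nat list \<Rightarrow> 'a::ab_group_add) \<Rightarrow> bool" where
  "alternating w \<longleftrightarrow> (\<forall>L1 i j L2. w (L1 @ i # j # L2) = - w (L1 @ j # i # L2))"

lemma alternatingD: "alternating w \<Longrightarrow> w (L1 @ i # j # L2) = - w (L1 @ j # i # L2)"
  unfolding alternating_def by blast

text \<open>The Koszul differential of the sequence \<open>a 0, \<dots>, a (n - 1)\<close>.\<close>

definition contract :: "nat \<Rightarrow> (nat \<Rightarrow> 'v cpoly) \<Rightarrow> (nat list \<Rightarrow> 'v cpoly) \<Rightarrow> nat list \<Rightarrow> 'v cpoly" where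
  "contract n a w L = (\<Sum>l<n. a l * w (l # L))"

lemma alternating_contract:
  assumes "alternating w"
  shows "alternating (contract n a w)"
  unfolding alternating_def contract_def
proof (intro allI)
  fix L1 i j L2
  have "w (l # L1 @ i # j # L2) = - w (l # L1 @ j # i # L2)" for l
    using alternatingD[OF assms, of "l # L1" i j L2] by simp
  then show "(\<Sum>l<n. a l * w (l # L1 @ i # j # L2)) = - (\<Sum>l<n. a l * w (l # L1 @ j # i # L2))"
    by (simp add: sum_negf)
qed

text \<open>Swapping the two contracted arguments changes the sign of the double sum.\<close>

lemma contract_contract:
  fixes w :: "nat list \<Rightarrow> 'v cpoly"
  assumes "alternating w"
  shows "contract n a (contract n a w) L = 0"
proof -
  let ?S = "contract n a (contract n a w) L"
  have "?S = (\<Sum>l<n. \<Sum>m<n. a l * a m * w (m # l # L))"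
    by (simp add: contract_def sum_distrib_left mult.assoc)
  also have "\<dots> = (\<Sum>m<n. \<Sum>l<n. a l * a m * w (m # l # L))" by (rule sum.swap)
  also have "\<dots> = (\<Sum>m<n. \<Sum>l<n. - (a m * a l * w (l # m # L)))"
  proof (intro sum.cong refl)
    fix l m
    have "w (m # l # L) = - w (l # m # L)" using alternatingD[OF assms, of "[]" m l L] by simp
    then show "a l * a m * w (m # l # L) = - (a m * a l * w (l # m # L))" by (simp add: mult.commute)
  qed
  also have "\<dots> = - ?S" by (simp add: contract_def sum_distrib_left sum_negf mult.assoc)
  finally have S: "?S = - ?S" .
  show ?thesis
  proof (rule poly_mapping_eqI)
    fix t
    have "coeff_at ?S t = - coeff_at ?S t"
      using arg_cong[OF S, of "\<lambda>p. coeff_at p t"] by (simp only: lookup_uminus)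
    moreover have "z = - z \<Longrightarrow> z = 0" for z :: complex
      by (simp add: eq_neg_iff_add_eq_0 flip: mult_2)
    ultimately show "coeff_at ?S t = coeff_at 0 t" by (metis lookup_zero)
  qed
qed

text \<open>The exterior product of the first \<open>k\<close> rows of \<open>C\<close>, in coordinates: its minors.\<close>

definition minors :: "(nat \<Rightarrow> nat \<Rightarrow> 'v cpoly) \<Rightarrow> nat \<Rightarrow> nat list \<Rightarrow> 'v cpoly" where
  "minors C k L = (if length L = k then Determinant.det (mat k k (\<lambda>(i, m). C i (L ! m))) else 0)"

lemma alternating_minors: "alternating (minors C k)"
  unfolding alternating_def
proof (intro allI)
  fix L1 i j L2
  show "minors C k (L1 @ i # j # L2) = - minors C k (L1 @ j # i # L2)"
  proof (cases "k = length L1 + 2 + length L2")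
    case True
    let ?l = "length L1" and ?A = "mat k k (\<lambda>(r, m). C r ((L1 @ j # i # L2) ! m))"
    have "mat k k (\<lambda>(r, m). C r ((L1 @ i # j # L2) ! m)) = mat_swapcols ?l (Suc ?l) ?A"
      by (rule eq_matI) (auto simp: nth_append nth_Cons True split: nat.splits)
    moreover have "Determinant.det (mat_swapcols ?l (Suc ?l) ?A) = - Determinant.det ?A"
      by (rule det_swapcols[of _ k]) (auto simp: True)
    ultimately show ?thesis by (simp add: minors_def True)
  qed (simp add: minors_def)
qed

lemma minors_Nil [simp]: "minors C 0 [] = 1"
  by (simp add: minors_def)

text \<open>The differential is a derivation, and it sends the \<open>i\<close>-th row to \<open>\<Sum>l. C i l * a l\<close>; so modulo the
  images of the first \<open>k\<close> rows it only sees the last one. In coordinates this is Laplace expansion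
  along the contracted column.\<close>

lemma contract_minors:
  assumes I: "ideal_set I" "\<And>i. i < k \<Longrightarrow> (\<Sum>l<n. C i l * a l) \<in> I"
  shows "contract n a (minors C (Suc k)) L - (- 1) ^ k * (\<Sum>l<n. C k l * a l) * minors C k L \<in> I"
proof (cases "length L = k")
  case True
  define M where "M i = (-1) ^ i * Determinant.det (mat k k (\<lambda>(i', m). C (if i' < i then i' else Suc i') (L ! m)))" for i
  have exp: "minors C (Suc k) (l # L) = (\<Sum>i<Suc k. C i l * M i)" for l
  proof -
    let ?A = "mat (Suc k) (Suc k) (\<lambda>(i, m). C i ((l # L) ! m))"
    have "minors C (Suc k) (l # L) = Determinant.det ?A" by (simp add: minors_def True)
    also have "\<dots> = (\<Sum>i<Suc k. ?A $$ (i, 0) * cofactor ?A i 0)"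
      by (rule laplace_expansion_column) auto
    also have "\<dots> = (\<Sum>i<Suc k. C i l * M i)"
    proof (rule sum.cong[OF refl])
      fix i assume "i \<in> {..<Suc k}"
      then have "mat_delete ?A i 0 = mat k k (\<lambda>(i', m). C (if i' < i then i' else Suc i') (L ! m))"
        by (intro eq_matI) (auto simp: mat_delete_def)
      then show "?A $$ (i, 0) * cofactor ?A i 0 = C i l * M i"
        using \<open>i \<in> {..<Suc k}\<close> by (simp add: cofactor_def M_def)
    qed
    finally show ?thesis .
  qed
  have "contract n a (minors C (Suc k)) L = (\<Sum>l<n. \<Sum>i<Suc k. M i * (C i l * a l))"
    unfolding contract_def exp by (simp only: sum_distrib_left) (simp add: mult_ac)
  also have "\<dots> = (\<Sum>i<Suc k. M i * (\<Sum>l<n. C i l * a l))"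
    by (subst sum.swap) (simp only: sum_distrib_left)
  also have "\<dots> = (\<Sum>i<k. M i * (\<Sum>l<n. C i l * a l)) + M k * (\<Sum>l<n. C k l * a l)" by simp
  also have "M k = (-1) ^ k * minors C k L"
  proof -
    have "mat k k (\<lambda>(i', m). C (if i' < k then i' else Suc i') (L ! m)) = mat k k (\<lambda>(i, m). C i (L ! m))"
      by (rule eq_matI) auto
    then show ?thesis by (simp add: M_def minors_def True)
  qed
  finally have "contract n a (minors C (Suc k)) L - (- 1) ^ k * (\<Sum>l<n. C k l * a l) * minors C k L
      = (\<Sum>i<k. M i * (\<Sum>l<n. C i l * a l))"
    by (simp add: mult_ac)
  also have "\<dots> \<in> I" by (rule ideal_set_sum[OF I(1)], rule ideal_set_mult[OF I(1)], rule I(2)) simp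
  finally show ?thesis .
next
  case False
  then show ?thesis by (simp add: contract_def minors_def ideal_set_0[OF I(1)])
qed

text \<open>The columns selected by \<open>L\<close> are \<open>C\<close> times a 0-1 matrix.\<close>

lemma minors_top:
  assumes "length L = n" "set L \<subseteq> {..<n}"
  shows "\<exists>s. minors C n L = Determinant.det (mat n n (\<lambda>(i, l). C i l)) * s"
proof -
  let ?P = "mat n n (\<lambda>(l, m). if l = L ! m then 1 else 0)"
  have "mat n n (\<lambda>(i, m). C i (L ! m)) = mat n n (\<lambda>(i, l). C i l) * ?P"
  proof (rule eq_matI)
    fix i m assume "i < dim_row (mat n n (\<lambda>(i, l). C i l) * ?P)" "m < dim_col (mat n n (\<lambda>(i, l). C i l) * ?P)"
    then have im: "i < n" "m < n" by simp_all
    then have "L ! m < n" using assms nth_mem by fastforce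
    have "(\<Sum>l = 0..<n. C i l * (if l = L ! m then 1 else 0)) = (\<Sum>l = 0..<n. if l = L ! m then C i l else 0)"
      by (rule sum.cong) auto
    also have "\<dots> = C i (L ! m)" using \<open>L ! m < n\<close> by simp
    finally show "mat n n (\<lambda>(i, m). C i (L ! m)) $$ (i, m) = (mat n n (\<lambda>(i, l). C i l) * ?P) $$ (i, m)"
      using im by (simp add: scalar_prod_def)
  qed simp_all
  then have "Determinant.det (mat n n (\<lambda>(i, m). C i (L ! m)))
      = Determinant.det (mat n n (\<lambda>(i, l). C i l)) * Determinant.det ?P"
    by (metis det_mult mat_carrier)
  then show ?thesis using assms(1) by (auto simp: minors_def)
qed

text \<open>The proof descends from the top exterior power, where \<open>p\<close> times the product of all rows vanishes
  modulo all powers, to the bottom one, where the claim is that \<open>p\<close> itself is a boundary. If \<open>p\<close> times the product of \<open>k + 1\<close> rows is a Koszul boundary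
  modulo the first \<open>k + 1\<close> powers, then apply the differential: it kills the boundary, it turns the
  product of \<open>k + 1\<close> rows, modulo the first \<open>k\<close> powers and up to sign, into the last of the \<open>k + 1\<close>
  powers times the product of \<open>k\<close> rows, and this power cancels because the powers form a regular
  sequence.\<close>

theorem wiebe:
  fixes e :: "nat \<Rightarrow> 'v"
  assumes inj: "inj_on e {..<n}"
    and C: "\<And>i. i < n \<Longrightarrow> (\<Sum>l<n. C i l * a l) = var_poly (e i) ^ N"
    and p: "Determinant.det (mat n n (\<lambda>(i, l). C i l)) * p \<in> mono_ideal e N n"
  shows "\<exists>g. p = (\<Sum>l<n. g l * a l)"
proof -
  have step: "\<exists>v. alternating v \<and> (\<forall>L. set L \<subseteq> {..<n} \<longrightarrow> p * minors C k L - contract n a v L \<in> mono_ideal e N k)"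
    if "k \<le> n" for k
    using that
  proof (induction k rule: inc_induct)
    case base
    have "p * minors C n L \<in> mono_ideal e N n" if L: "set L \<subseteq> {..<n}" for L
    proof (cases "length L = n")
      case True
      then obtain s where "minors C n L = Determinant.det (mat n n (\<lambda>(i, l). C i l)) * s"
        using minors_top L by blast
      then have "p * minors C n L = Determinant.det (mat n n (\<lambda>(i, l). C i l)) * p * s"
        by (simp add: mult_ac)
      then show ?thesis using mono_ideal_mult'[OF p] by simp
    qed (simp add: minors_def)
    then show ?case by (intro exI[of _ "\<lambda>_. 0"]) (simp add: alternating_def contract_def)
  next
    case (step k)
    then obtain v where v: "alternating v"
      "\<And>L. set L \<subseteq> {..<n} \<Longrightarrow> p * minors C (Suc k) L - contract n a v L \<in> mono_ideal e N (Suc k)"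
      by blast
    let ?b = "var_poly (e k) ^ N" and ?I = "mono_ideal e N k"
    define \<omega> where "\<omega> L = p * minors C (Suc k) L - contract n a v L" for L
    define w where "w L = mono_div (Poly_Mapping.single (e k) N) (\<omega> L)" for L
    have alt_\<omega>: "alternating \<omega>"
      unfolding alternating_def
    proof (intro allI)
      fix L1 i j L2
      show "\<omega> (L1 @ i # j # L2) = - \<omega> (L1 @ j # i # L2)"
        using alternatingD[OF alternating_minors, of C "Suc k" L1 i j L2]
          alternatingD[OF alternating_contract[OF v(1)], of n a L1 i j L2]
        by (simp add: \<omega>_def)
    qed
    have alt_w: "alternating w"
      unfolding alternating_def w_def by (metis alternatingD[OF alt_\<omega>] mono_div_uminus)
    have \<omega>w: "\<omega> L - ?b * w L \<in> ?I" if "set L \<subseteq> {..<n}" for L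
      unfolding w_def by (rule mono_ideal_Suc_division) (use v(2)[OF that] in \<open>simp add: \<omega>_def\<close>)
    have boundary: "(-1) ^ k * (p * minors C k L) - contract n a w L \<in> ?I" if L: "set L \<subseteq> {..<n}" for L
    proof (rule mono_ideal_regular[where N = N])
      have c\<omega>: "contract n a \<omega> L = p * contract n a (minors C (Suc k)) L"
      proof -
        have "contract n a \<omega> L = p * contract n a (minors C (Suc k)) L - contract n a (contract n a v) L"
          unfolding contract_def[of n a \<omega>] contract_def[of n a "minors C (Suc k)"] \<omega>_def
          by (simp add: contract_def[of n a "contract n a v"] right_diff_distrib sum_subtractf
              sum_distrib_left mult.left_commute)
        then show ?thesis by (simp add: contract_contract[OF v(1)])
      qed
      have 1: "contract n a \<omega> L - ?b * contract n a w L \<in> ?I"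
      proof -
        have "contract n a \<omega> L - ?b * contract n a w L = (\<Sum>l<n. a l * (\<omega> (l # L) - ?b * w (l # L)))"
          by (simp add: contract_def right_diff_distrib sum_subtractf sum_distrib_left mult.left_commute)
        also have "\<dots> \<in> ?I" by (intro mono_ideal_sum mono_ideal_mult \<omega>w) (use L in auto)
        finally show ?thesis .
      qed
      have 2: "p * (contract n a (minors C (Suc k)) L - (- 1) ^ k * (\<Sum>l<n. C k l * a l) * minors C k L) \<in> ?I"
      proof (rule mono_ideal_mult[OF contract_minors[OF ideal_mono_ideal]])
        fix i assume "i < k"
        then show "(\<Sum>l<n. C i l * a l) \<in> ?I" using step.hyps C[of i] by (simp add: mono_ideal_gen)
      qed
      have "?b * ((-1) ^ k * (p * minors C k L) - contract n a w L)
          = (contract n a \<omega> L - ?b * contract n a w L)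
            - p * (contract n a (minors C (Suc k)) L - (- 1) ^ k * (\<Sum>l<n. C k l * a l) * minors C k L)"
        using C[of k] step.hyps by (simp add: c\<omega> algebra_simps)
      also have "\<dots> \<in> ?I" by (rule mono_ideal_diff[OF 1 2])
      finally show "?b * ((-1) ^ k * (p * minors C k L) - contract n a w L) \<in> ?I" .
      show "e i \<noteq> e k" if "i < k" for i
        using inj_onD[OF inj, of i k] that step.hyps by auto
    qed
    have sq: "(-1 :: 'v cpoly) ^ k * ((-1) ^ k * x) = x" for x
      by (simp flip: mult.assoc power_mult_distrib)
    have "p * minors C k L - contract n a (\<lambda>L. (-1) ^ k * w L) L \<in> ?I" if L: "set L \<subseteq> {..<n}" for L
    proof -
      have "contract n a (\<lambda>L. (-1) ^ k * w L) L = (-1) ^ k * contract n a w L"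
        by (simp add: contract_def sum_distrib_left mult.left_commute)
      then have "p * minors C k L - contract n a (\<lambda>L. (-1) ^ k * w L) L
          = (-1) ^ k * ((-1) ^ k * (p * minors C k L) - contract n a w L)"
        by (simp only: right_diff_distrib sq)
      then show ?thesis using mono_ideal_mult[OF boundary[OF L]] by simp
    qed
    moreover have "alternating (\<lambda>L. (-1) ^ k * w L)"
      unfolding alternating_def by (metis alternatingD[OF alt_w] mult_minus_right)
    ultimately show ?case by blast
  qed
  obtain v where "\<forall>L. set L \<subseteq> {..<n} \<longrightarrow> p * minors C 0 L - contract n a v L \<in> mono_ideal e N 0"
    using step[of 0] by blast
  from this[rule_format, of "[]"] have "p = (\<Sum>l<n. a l * v [l])" by (simp add: mono_ideal_trivial contract_def)
  then show ?thesis by (intro exI[of _ "\<lambda>l. v [l]"]) (simp add: mult.commute)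
qed

section \<open>The Jacobian spans the socle\<close>

text \<open>Cramer's rule: multiply the system by the adjugate matrix.\<close>

lemma ideal_cramer:
  assumes I: "ideal_set I" and C: "\<And>i. i < n \<Longrightarrow> (\<Sum>l<n. C i l * a l) \<in> I" and l: "l < n"
  shows "Determinant.det (mat n n (\<lambda>(i, l). C i l)) * a l \<in> I"
proof -
  let ?C = "mat n n (\<lambda>(i, l). C i l)"
  let ?D = "Determinant.det ?C"
  have adj: "adj_mat ?C \<in> carrier_mat n n" "adj_mat ?C * ?C = ?D \<cdot>\<^sub>m 1\<^sub>m n"
    using adj_mat[of ?C n] by auto
  have entry: "(\<Sum>i<n. adj_mat ?C $$ (l, i) * C i m) = (if l = m then ?D else 0)" if "m < n" for m
  proof -
    have "(adj_mat ?C * ?C) $$ (l, m) = (\<Sum>i<n. adj_mat ?C $$ (l, i) * C i m)"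
      using adj(1) l that by (simp add: scalar_prod_def lessThan_atLeast0)
    moreover have "(adj_mat ?C * ?C) $$ (l, m) = (?D \<cdot>\<^sub>m 1\<^sub>m n) $$ (l, m)"
      by (simp only: adj(2))
    moreover have "(?D \<cdot>\<^sub>m 1\<^sub>m n) $$ (l, m) = (if l = m then ?D else 0)"
      using l that by simp
    ultimately show ?thesis by (simp only:)
  qed
  have "(\<Sum>i<n. adj_mat ?C $$ (l, i) * (\<Sum>m<n. C i m * a m))
      = (\<Sum>m<n. (\<Sum>i<n. adj_mat ?C $$ (l, i) * C i m) * a m)"
    by (simp only: sum_distrib_left sum_distrib_right, subst sum.swap) (simp add: mult.assoc)
  also have "\<dots> = (\<Sum>m<n. if m = l then ?D * a l else 0)"
    by (rule sum.cong) (auto simp: entry)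
  also have "\<dots> = ?D * a l" using l by simp
  finally have "?D * a l = (\<Sum>i<n. adj_mat ?C $$ (l, i) * (\<Sum>m<n. C i m * a m))" ..
  also have "\<dots> \<in> I"
    by (rule ideal_set_sum[OF I], rule ideal_set_mult[OF I], rule C) simp
  finally show ?thesis .
qed

text \<open>The Jacobian is a determinant indexed by the type of variables, whereas Wiebe's theorem needs
  submatrices, hence determinants indexed by natural numbers.\<close>

lemma det_finite_type_conv:
  fixes A :: "'a::comm_ring_1 ^ 'n ^ 'n"
  assumes bij: "bij_betw e {0..<n} (UNIV :: 'n::finite set)"
  shows "Determinants.det A = Determinant.det (mat n n (\<lambda>(i, j). A $ e i $ e j))"
proof -
  have inj: "inj_on e {0..<n}" using bij by (rule bij_betw_imp_inj_on)
  have mp: "(\<lambda>x. if x \<in> UNIV then e (p (inv_into {0..<n} e x)) else x) = map_permutation {0..<n} e p" for p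
    using bij by (auto simp: map_permutation_def restrict_id_def bij_betw_def fun_eq_iff)
  have "Determinants.det A = (\<Sum>p\<in>{p. p permutes (UNIV :: 'n set)}. of_int (sign p) * (\<Prod>i\<in>UNIV. A $ i $ p i))"
    by (simp add: Determinants.det_def)
  also have "\<dots> = (\<Sum>p\<in>{p. p permutes {0..<n}}. of_int (sign (map_permutation {0..<n} e p))
      * (\<Prod>i\<in>UNIV. A $ i $ map_permutation {0..<n} e p i))"
    using sum.reindex_bij_betw[OF bij_betw_permutations[OF bij], symmetric] unfolding mp by blast
  also have "\<dots> = (\<Sum>p\<in>{p. p permutes {0..<n}}. of_int (sign p) * (\<Prod>i = 0..<n. A $ e i $ e (p i)))"
  proof (rule sum.cong[OF refl])
    fix p assume "p \<in> {p. p permutes {0..<n}}"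
    then have "p permutes {0..<n}" by simp
    then have "sign (map_permutation {0..<n} e p) = sign p"
      using inj by (intro sign_map_permutation) auto
    moreover have "(\<Prod>i\<in>UNIV. A $ i $ map_permutation {0..<n} e p i)
        = (\<Prod>i = 0..<n. A $ e i $ map_permutation {0..<n} e p (e i))"
      by (rule prod.reindex_bij_betw[OF bij, symmetric])
    moreover have "\<dots> = (\<Prod>i = 0..<n. A $ e i $ e (p i))"
      by (intro prod.cong refl) (simp add: map_permutation_apply[OF inj])
    ultimately show "of_int (sign (map_permutation {0..<n} e p)) * (\<Prod>i\<in>UNIV. A $ i $ map_permutation {0..<n} e p i)
        = of_int (sign p) * (\<Prod>i = 0..<n. A $ e i $ e (p i))" by simp
  qed
  also have "\<dots> = Determinant.det (mat n n (\<lambda>(i, j). A $ e i $ e j))"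
  proof -
    have "p i < n" if "p permutes {0..<n}" "i < n" for p i
      using permutes_in_image[OF that(1), of i] that(2) by simp
    then show ?thesis
      unfolding Determinant.det_def
      by (auto intro!: sum.cong arg_cong2[of _ _ _ _ "(*)"] prod.cong)
  qed
  finally show ?thesis .
qed

text \<open>Let \<open>C\<close> express the powers \<open>x\<^sub>i\<^sup>N\<close> through \<open>f\<close>, and \<open>\<Delta> = det C\<close>. By Cramer's rule and Wiebe's
  theorem \<open>q\<close> is in the ideal of \<open>f\<close> if and only if \<open>\<Delta> q\<close> is in the ideal of the powers, and modulo
  the latter a socle element is determined by its coefficient at the monomial with all exponents
  \<open>N - 1\<close>.\<close>

theorem socle_spanned_by_det:
  fixes f :: "'n::finite \<Rightarrow> 'n cpoly" and F :: "'n \<Rightarrow> 'n \<Rightarrow> 'n cpoly"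
  assumes fF: "\<And>j. f j = (\<Sum>k\<in>UNIV. F j k * var_poly k)"
    and pow: "\<And>i. var_poly i ^ N \<in> ideal_J f"
  defines "D \<equiv> Determinants.det (\<chi> i j. F i j)"
  shows "D \<notin> ideal_J f"
    and "var_poly k * D \<in> ideal_J f"
    and "(\<And>k. var_poly k * p \<in> ideal_J f) \<Longrightarrow> \<exists>c. p - const_poly c * D \<in> ideal_J f"
proof -
  define n where "n = CARD('n)"
  obtain e :: "nat \<Rightarrow> 'n" where bij0: "bij_betw e {0..<n} UNIV"
    unfolding n_def using ex_bij_betw_nat_finite[of "UNIV :: 'n set"] by auto
  then have bij: "bij_betw e {..<n} UNIV" by (simp add: lessThan_atLeast0)
  then have inj: "inj_on e {..<n}" by (rule bij_betw_imp_inj_on)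
  have surj: "\<exists>i<n. e i = v" for v
  proof -
    have "v \<in> e ` {..<n}" using bij by (simp add: bij_betw_def)
    then show ?thesis by auto
  qed
  have re: "(\<Sum>v\<in>UNIV. h v) = (\<Sum>l<n. h (e l))" for h :: "'n \<Rightarrow> 'n cpoly"
    by (rule sum.reindex_bij_betw[OF bij, symmetric])
  let ?K = "mono_ideal e N n" and ?J = "ideal_J f"
  have "\<forall>i. \<exists>g. var_poly i ^ N = (\<Sum>j\<in>UNIV. g j * f j)" using pow by (simp add: mem_ideal_J)
  then obtain g where g: "\<And>i. var_poly i ^ N = (\<Sum>j\<in>UNIV. g i j * f j)" by metis
  let ?C = "mat n n (\<lambda>(i, l). g (e i) (e l))" and ?F = "mat n n (\<lambda>(i, l). F (e i) (e l))"
  define \<Delta> where "\<Delta> = Determinant.det ?C"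
  have D: "D = Determinant.det ?F"
    unfolding D_def by (subst det_finite_type_conv[OF bij0]) simp
  have Cf: "(\<Sum>l<n. g (e i) (e l) * f (e l)) = var_poly (e i) ^ N" for i
    by (simp add: g re)
  have Ff: "(\<Sum>l<n. F (e i) (e l) * var_poly (e l)) = f (e i)" for i
    by (simp add: fF re)
  have \<Delta>J: "\<Delta> * q \<in> ?K" if "q \<in> ?J" for q
  proof -
    have "\<Delta> * f (e l) \<in> ?K" if "l < n" for l
      unfolding \<Delta>_def
      by (rule ideal_cramer[OF ideal_mono_ideal _ that]) (simp add: Cf mono_ideal_gen)
    then have "\<Delta> * f j \<in> ?K" for j using surj[of j] by auto
    from mono_ideal_sum[OF mono_ideal_mult[OF this]]
    have "(\<Sum>j\<in>UNIV. h j * (\<Delta> * f j)) \<in> ?K" for h .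
    then show ?thesis using that by (auto simp: mem_ideal_J sum_distrib_left mult.left_commute)
  qed
  have Jiff: "q \<in> ?J" if "\<Delta> * q \<in> ?K" for q
  proof -
    have "\<exists>h. q = (\<Sum>l<n. h l * f (e l))"
      by (rule wiebe[OF inj, of "\<lambda>i l. g (e i) (e l)" "\<lambda>l. f (e l)" N]) (use that in \<open>auto simp: Cf \<Delta>_def\<close>)
    then show ?thesis by (auto intro!: ideal_J_sum ideal_J_mult ideal_J_gen)
  qed
  (* The product of the two matrices expresses the powers through the variables. *)
  have nz: "\<Delta> * D \<notin> ?K"
  proof
    assume "\<Delta> * D \<in> ?K"
    moreover have "mat n n (\<lambda>(i, l). \<Sum>m<n. g (e i) (e m) * F (e m) (e l)) = ?C * ?F"
      by (rule eq_matI) (auto simp: scalar_prod_def lessThan_atLeast0)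
    ultimately have "Determinant.det (mat n n (\<lambda>(i, l). \<Sum>m<n. g (e i) (e m) * F (e m) (e l))) * 1 \<in> ?K"
      by (simp add: \<Delta>_def D det_mult[of _ n])
    moreover have "(\<Sum>l<n. (\<Sum>m<n. g (e i) (e m) * F (e m) (e l)) * var_poly (e l)) = var_poly (e i) ^ N" for i
    proof -
      have "(\<Sum>l<n. (\<Sum>m<n. g (e i) (e m) * F (e m) (e l)) * var_poly (e l))
          = (\<Sum>m<n. g (e i) (e m) * (\<Sum>l<n. F (e m) (e l) * var_poly (e l)))"
        by (simp only: sum_distrib_left sum_distrib_right, subst sum.swap) (simp add: mult.assoc)
      then show ?thesis by (simp add: Ff Cf)
    qed
    ultimately have "\<exists>h. 1 = (\<Sum>l<n. h l * var_poly (e l))" by (intro wiebe[OF inj]) auto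
    then obtain h where h: "1 = (\<Sum>l<n. h l * var_poly (e l))" ..
    have "eval_poly (\<lambda>_. 0) (1 :: 'n cpoly) = 0" by (subst h) simp
    then show False by simp
  qed
  then show "D \<notin> ?J" using \<Delta>J by blast
  have xD: "var_poly k * D \<in> ?J" for k
  proof -
    obtain l where l: "l < n" "e l = k" using surj by blast
    have "Determinant.det ?F * var_poly (e l) \<in> ?J"
      by (rule ideal_cramer[OF ideal_J _ l(1)]) (simp add: Ff ideal_J_gen)
    then show ?thesis by (simp add: D l mult.commute)
  qed
  then show "var_poly k * D \<in> ?J" .
  define top where "top = (\<Sum>v\<in>UNIV. Poly_Mapping.single (v :: 'n) (N - 1))"
  have topv: "Poly_Mapping.lookup top v = N - 1" for v
    by (simp add: top_def lookup_sum lookup_single when_def)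
  have socK: "q \<in> ?K" if q: "\<And>k. var_poly k * q \<in> ?K" "coeff_at q top = 0" for q
    unfolding mono_ideal_def
  proof (clarify, rule ccontr)
    fix t assume t: "coeff_at q t \<noteq> 0" "\<nexists>i. i < n \<and> N \<le> Poly_Mapping.lookup t (e i)"
    then have less: "Poly_Mapping.lookup t v < N" for v using surj[of v] by (metis not_le)
    have "Poly_Mapping.lookup t v = N - 1" for v
    proof -
      have "coeff_at (var_poly v * q) (expo v + t) \<noteq> 0"
        using t(1) by (simp add: var_poly_def coeff_single_mult_add)
      then obtain i where "N \<le> Poly_Mapping.lookup (expo v + t) (e i)"
        using q(1)[of v] by (auto simp: mono_ideal_def)
      then show ?thesis using less[of "e i"] less[of v]
        by (auto simp: lookup_add lookup_single when_def split: if_splits)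
    qed
    then have "t = top" by (intro poly_mapping_eqI) (simp add: topv)
    with t(1) q(2) show False by simp
  qed
  assume p: "\<And>k. var_poly k * p \<in> ?J"
  have "var_poly k * (\<Delta> * D) \<in> ?K" for k using \<Delta>J[OF xD[of k]] by (simp add: mult.left_commute)
  then have cD: "coeff_at (\<Delta> * D) top \<noteq> 0" using socK nz by blast
  define c where "c = coeff_at (\<Delta> * p) top / coeff_at (\<Delta> * D) top"
  have "\<Delta> * (p - const_poly c * D) \<in> ?K"
  proof (rule socK)
    fix k
    have "var_poly k * (p - const_poly c * D) \<in> ?J"
      using ideal_J_diff[OF p[of k] ideal_J_mult[OF xD[of k], of "const_poly c"]]
      by (simp add: right_diff_distrib mult.left_commute)
    then show "var_poly k * (\<Delta> * (p - const_poly c * D)) \<in> ?K"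
      using \<Delta>J by (simp add: mult.left_commute[of "var_poly k"])
  next
    have "\<Delta> * (p - const_poly c * D) = \<Delta> * p - const_poly c * (\<Delta> * D)"
      by (simp add: right_diff_distrib mult.left_commute)
    then show "coeff_at (\<Delta> * (p - const_poly c * D)) top = 0"
      using cD by (simp add: lookup_minus c_def)
  qed
  then show "\<exists>c. p - const_poly c * D \<in> ?J" using Jiff by blast
qed

section \<open>The quotient algebra\<close>

lemma ideal_ideal_J: "ideal (ideal_J f) poly_ring"
  using ideal_J ideal_set_iff_ideal by blast

lemma cls_ring_hom: "ring_hom_ring poly_ring (alg_M f) (cls f)"
  unfolding alg_M_def cls_def by (rule ideal.rcos_ring_hom_ring[OF ideal_ideal_J])

lemma cls_eq_iff: "cls f p = cls f q \<longleftrightarrow> p - q \<in> ideal_J f"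
proof -
  have cls: "cls f r = {j + r | j. j \<in> ideal_J f}" for r
    by (auto simp: cls_def a_r_coset_def r_coset_def)
  show ?thesis
  proof
    assume "cls f p = cls f q"
    moreover have "p \<in> cls f p" by (auto simp: cls intro!: exI[of _ 0])
    ultimately show "p - q \<in> ideal_J f" by (auto simp: cls)
  next
    assume pq: "p - q \<in> ideal_J f"
    have "j + p = (j + (p - q)) + q" "j + q = (j - (p - q)) + p" for j by simp_all
    then show "cls f p = cls f q"
      unfolding cls using ideal_J_add[OF _ pq] ideal_J_diff[OF _ pq] by blast
  qed
qed

lemma carrier_alg_M: "carrier (alg_M f) = range (cls f)"
  unfolding alg_M_def cls_def[abs_def] by (auto simp: FactRing_simps A_RCOSETS_def RCOSETS_def a_r_coset_def)

lemma cls_mult: "cls f p \<otimes>\<^bsub>alg_M f\<^esub> cls f q = cls f (p * q)"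
  and cls_add: "cls f p \<oplus>\<^bsub>alg_M f\<^esub> cls f q = cls f (p + q)"
  and cls_zero: "\<zero>\<^bsub>alg_M f\<^esub> = cls f 0"
proof -
  interpret R: ring_hom_ring poly_ring "alg_M f" "cls f" by (rule cls_ring_hom)
  show "cls f p \<otimes>\<^bsub>alg_M f\<^esub> cls f q = cls f (p * q)" "cls f p \<oplus>\<^bsub>alg_M f\<^esub> cls f q = cls f (p + q)"
    "\<zero>\<^bsub>alg_M f\<^esub> = cls f 0"
    using R.hom_mult[of p q] R.hom_add[of p q] R.hom_zero by simp_all
qed

lemma cls_power: "cls f p [^]\<^bsub>alg_M f\<^esub> (k :: nat) = cls f (p ^ k)"
proof (induction k)
  case 0
  show ?case using ring_hom_one[OF ring_hom_ring.homh[OF cls_ring_hom, of f]] by simp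
next
  case (Suc k)
  then show ?case by (simp add: cls_mult mult.commute)
qed

lemma cls_sum: "finite A \<Longrightarrow> (\<Oplus>\<^bsub>alg_M f\<^esub>i\<in>A. cls f (p i)) = cls f (\<Sum>i\<in>A. p i)"
proof (induction A rule: finite_induct)
  case empty
  interpret R: ring_hom_ring poly_ring "alg_M f" "cls f" by (rule cls_ring_hom)
  show ?case by (simp add: cls_zero)
next
  case (insert x A)
  interpret R: ring_hom_ring poly_ring "alg_M f" "cls f" by (rule cls_ring_hom)
  show ?case using insert by (subst R.S.finsum_insert) (auto simp: cls_add carrier_alg_M)
qed

section \<open>Polar forms of linear functionals\<close>

text \<open>For \<open>\<phi>\<close> linear on the forms of degree \<open>m\<close> this is the form \<open>y \<mapsto> \<phi> ((\<Sum>i. y\<^sub>i x\<^sub>i)\<^sup>m)\<close>. The recursion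
  \<open>\<phi> (\<ell>\<^sup>m\<^sup>+\<^sup>1) = \<Sum>i. y\<^sub>i \<phi> (x\<^sub>i \<ell>\<^sup>m)\<close> allows it to be differentiated without multinomial coefficients.\<close>

primrec polar :: "nat \<Rightarrow> ('n::finite cpoly \<Rightarrow> complex) \<Rightarrow> 'n cpoly" where
  "polar 0 \<phi> = const_poly (\<phi> 1)"
| "polar (Suc m) \<phi> = (\<Sum>i\<in>UNIV. var_poly i * polar m (\<lambda>p. \<phi> (var_poly i * p)))"

definition linear_on_forms :: "nat \<Rightarrow> ('v cpoly \<Rightarrow> complex) \<Rightarrow> bool" where
  "linear_on_forms m \<phi> \<longleftrightarrow> (\<forall>p\<in>forms m. \<forall>q\<in>forms m. \<phi> (p + q) = \<phi> p + \<phi> q) \<and>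
     (\<forall>c. \<forall>p\<in>forms m. \<phi> (const_poly c * p) = c * \<phi> p)"

lemma linear_on_forms_add: "linear_on_forms m \<phi> \<Longrightarrow> p \<in> forms m \<Longrightarrow> q \<in> forms m \<Longrightarrow> \<phi> (p + q) = \<phi> p + \<phi> q"
  and linear_on_forms_scale: "linear_on_forms m \<phi> \<Longrightarrow> p \<in> forms m \<Longrightarrow> \<phi> (const_poly c * p) = c * \<phi> p"
  by (simp_all add: linear_on_forms_def)

lemma linear_on_forms_0: "linear_on_forms m \<phi> \<Longrightarrow> \<phi> 0 = 0"
  using linear_on_forms_scale[of m \<phi> 0 0] by simp

lemma linear_on_forms_diff:
  assumes "linear_on_forms m \<phi>" "p \<in> forms m" "q \<in> forms m"
  shows "\<phi> (p - q) = \<phi> p - \<phi> q"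
  using linear_on_forms_add[OF assms(1) forms_diff[OF assms(2,3)] assms(3)] by simp

lemma linear_on_forms_sum:
  assumes "linear_on_forms m \<phi>" "\<And>i. i \<in> A \<Longrightarrow> p i \<in> forms m"
  shows "\<phi> (\<Sum>i\<in>A. const_poly (c i) * p i) = (\<Sum>i\<in>A. c i * \<phi> (p i))"
  using assms(2)
proof (induction A rule: infinite_finite_induct)
  case (insert x A)
  then have "\<phi> (const_poly (c x) * p x + (\<Sum>i\<in>A. const_poly (c i) * p i))
      = \<phi> (const_poly (c x) * p x) + \<phi> (\<Sum>i\<in>A. const_poly (c i) * p i)"
    by (intro linear_on_forms_add[OF assms(1)] forms_sum forms_const_mult) auto
  then show ?case using insert by (simp add: linear_on_forms_scale[OF assms(1)])
qed (simp_all add: linear_on_forms_0[OF assms(1)])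

lemma linear_on_forms_mult:
  assumes "linear_on_forms (k + m) \<phi>" "q \<in> forms k"
  shows "linear_on_forms m (\<lambda>p. \<phi> (q * p))"
  unfolding linear_on_forms_def
  using linear_on_forms_add[OF assms(1) forms_mult[OF assms(2)] forms_mult[OF assms(2)]]
    linear_on_forms_scale[OF assms(1) forms_mult[OF assms(2)]]
  by (simp add: distrib_left mult.left_commute)

lemma polar_forms: "polar m \<phi> \<in> forms m"
proof (induction m arbitrary: \<phi>)
  case (Suc m)
  have "var_poly i * polar m (\<lambda>p. \<phi> (var_poly i * p)) \<in> forms (1 + m)" for i
    by (rule forms_mult[OF forms_var Suc])
  then show ?case by (simp add: forms_sum plus_1_eq_Suc)
qed simp

lemma eval_polar:
  assumes "linear_on_forms m \<phi>"
  shows "eval_poly y (polar m \<phi>) = \<phi> (lin_form y ^ m)"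
  using assms
proof (induction m arbitrary: \<phi>)
  case (Suc m)
  have pw: "lin_form y ^ m \<in> forms m" using forms_power[OF lin_form_forms, of y m] by simp
  have vf: "var_poly i * lin_form y ^ m \<in> forms (Suc m)" for i
    using forms_mult[OF forms_var pw] by (simp add: plus_1_eq_Suc)
  have "eval_poly y (polar (Suc m) \<phi>) = (\<Sum>i\<in>UNIV. y i * \<phi> (var_poly i * lin_form y ^ m))"
    using Suc.IH linear_on_forms_mult[of 1 m \<phi>, OF _ forms_var] Suc.prems by (simp add: plus_1_eq_Suc)
  also have "\<dots> = \<phi> (\<Sum>i\<in>UNIV. const_poly (y i) * (var_poly i * lin_form y ^ m))"
    by (rule linear_on_forms_sum[OF Suc.prems vf, symmetric])
  also have "(\<Sum>i\<in>UNIV. const_poly (y i) * (var_poly i * lin_form y ^ m)) = lin_form y ^ Suc m"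
    by (simp add: lin_form_def sum_distrib_right mult.assoc)
  finally show ?case .
qed simp

lemma partial_deriv_polar:
  "partial_deriv k (polar (Suc m) \<phi>) = const_poly (of_nat (Suc m)) * polar m (\<lambda>p. \<phi> (var_poly k * p))"
proof (induction m arbitrary: \<phi>)
  case 0
  have "partial_deriv k (const_poly c) = 0" for c
    by (simp add: const_poly_def partial_deriv_single)
  then show ?case
    by (simp add: partial_deriv_sum partial_deriv_var_mult if_distrib[of "\<lambda>x. x + _"] cong: if_cong)
next
  case (Suc m)
  have "partial_deriv k (polar (Suc (Suc m)) \<phi>)
      = polar (Suc m) (\<lambda>p. \<phi> (var_poly k * p))
        + (\<Sum>i\<in>UNIV. var_poly i * (const_poly (of_nat (Suc m)) * polar m (\<lambda>p. \<phi> (var_poly i * (var_poly k * p)))))"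
    by (subst polar.simps) (simp only: partial_deriv_sum partial_deriv_var_mult Suc sum.distrib, simp)
  also have "(\<Sum>i\<in>UNIV. var_poly i * (const_poly (of_nat (Suc m)) * polar m (\<lambda>p. \<phi> (var_poly i * (var_poly k * p)))))
      = const_poly (of_nat (Suc m)) * polar (Suc m) (\<lambda>p. \<phi> (var_poly k * p))"
    by (simp add: sum_distrib_left mult.left_commute)
  finally show ?case
    by (simp only: of_nat_Suc[of "Suc m"] const_poly_add distrib_right const_poly_1 mult_1_left)
qed

section \<open>Polynomial functions of coordinates\<close>

definition polyfun :: "('p \<Rightarrow> 'v \<Rightarrow> complex) \<Rightarrow> ('p \<Rightarrow> complex) \<Rightarrow> bool" where
  "polyfun coord F \<longleftrightarrow> (\<exists>p. \<forall>x. eval_poly (coord x) p = F x)"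

lemma polyfun_coord: "polyfun coord (\<lambda>x. coord x v)"
  unfolding polyfun_def by (rule exI[of _ "var_poly v"]) simp

lemma polyfun_const: "polyfun coord (\<lambda>_. c)"
  unfolding polyfun_def by (rule exI[of _ "const_poly c"]) simp

lemma polyfun_add:
  assumes "polyfun coord F" "polyfun coord G"
  shows "polyfun coord (\<lambda>x. F x + G x)"
proof -
  obtain p q where "\<forall>x. eval_poly (coord x) p = F x" "\<forall>x. eval_poly (coord x) q = G x"
    using assms by (auto simp: polyfun_def)
  then show ?thesis unfolding polyfun_def by (intro exI[of _ "p + q"]) simp
qed

lemma polyfun_mult:
  assumes "polyfun coord F" "polyfun coord G"
  shows "polyfun coord (\<lambda>x. F x * G x)"
proof -
  obtain p q where "\<forall>x. eval_poly (coord x) p = F x" "\<forall>x. eval_poly (coord x) q = G x"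
    using assms by (auto simp: polyfun_def)
  then show ?thesis unfolding polyfun_def by (intro exI[of _ "p * q"]) simp
qed

lemma polyfun_sum: "(\<And>i. i \<in> A \<Longrightarrow> polyfun coord (F i)) \<Longrightarrow> polyfun coord (\<lambda>x. \<Sum>i\<in>A. F i x)"
  by (induction A rule: infinite_finite_induct) (auto intro: polyfun_const polyfun_add)

lemma polyfun_prod: "(\<And>i. i \<in> A \<Longrightarrow> polyfun coord (F i)) \<Longrightarrow> polyfun coord (\<lambda>x. \<Prod>i\<in>A. F i x)"
  by (induction A rule: infinite_finite_induct) (auto intro: polyfun_const polyfun_mult)

lemma polyfun_power: "polyfun coord F \<Longrightarrow> polyfun coord (\<lambda>x. F x ^ k)"
  by (induction k) (auto intro: polyfun_const polyfun_mult)

lemma polyfun_eval_poly: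
  assumes "\<And>v. polyfun coord (\<lambda>x. c x v)"
  shows "polyfun coord (\<lambda>x. eval_poly (c x) p)"
  unfolding eval_poly_def
  by (intro polyfun_sum polyfun_mult polyfun_const polyfun_prod polyfun_power assms)

lemma generically_if_polyfun:
  assumes "polyfun coord F" "x0 \<in> V" "F x0 \<noteq> 0" "\<And>x. x \<in> V \<Longrightarrow> F x \<noteq> 0 \<Longrightarrow> Q x"
  shows "generically coord V Q"
proof -
  obtain p where p: "\<And>x. eval_poly (coord x) p = F x" using assms(1) by (auto simp: polyfun_def)
  let ?U = "{x \<in> V. \<exists>q\<in>{p}. eval_poly (coord x) q \<noteq> 0}"
  have "zariski_open coord V ?U" unfolding zariski_open_def by blast
  moreover have "?U \<noteq> {}" using assms(2,3) p by auto
  moreover have "\<forall>x\<in>?U. Q x" using assms(4) p by simp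
  ultimately show ?thesis unfolding generically_def by blast
qed

section \<open>Homogeneous complete intersections are Gorenstein\<close>

lemma hom_component_ideal_J:
  assumes f: "\<And>j. f j \<in> forms (d j)" and p: "p \<in> ideal_J f"
  shows "hom_component m p \<in> ideal_J f"
proof -
  obtain g where p: "p = (\<Sum>j\<in>UNIV. g j * f j)" using p by (auto simp: mem_ideal_J)
  have "hom_component m (g j * f j) \<in> ideal_J f" for j
    by (simp add: hom_component_mult_form[OF f] ideal_J_mult ideal_J_gen)
  then show ?thesis unfolding p hom_component_sum by (intro ideal_J_sum)
qed

lemma ideal_J_scale:
  assumes "\<And>j. c j \<noteq> 0"
  shows "ideal_J (\<lambda>j. const_poly (c j) * f j) = ideal_J f"
proof
  show "ideal_J (\<lambda>j. const_poly (c j) * f j) \<subseteq> ideal_J f"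
    by (intro ideal_J_least ideal_J) (simp add: ideal_J_mult ideal_J_gen)
  have "f j \<in> ideal_J (\<lambda>j. const_poly (c j) * f j)" for j
    using ideal_J_gen[of "\<lambda>j. const_poly (c j) * f j" j] ideal_set_const_mult_iff[OF ideal_J assms] by metis
  then show "ideal_J f \<subseteq> ideal_J (\<lambda>j. const_poly (c j) * f j)"
    by (intro ideal_J_least ideal_J)
qed

text \<open>By Euler's identity the Jacobian matrix turns the variables into the multiples \<open>d j\<close> of \<open>f j\<close>,
  which generate the same ideal.\<close>

theorem jacobian_spans_socle:
  fixes f :: "'n::finite \<Rightarrow> 'n cpoly"
  assumes f: "\<And>j. f j \<in> forms (d j)" and d: "\<And>j. 1 \<le> d j" and ci: "complete_intersection f"
  shows "Jac f \<notin> ideal_J f"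
    and "var_poly k * Jac f \<in> ideal_J f"
    and "(\<And>k. var_poly k * p \<in> ideal_J f) \<Longrightarrow> \<exists>c. p - const_poly c * Jac f \<in> ideal_J f"
proof -
  let ?g = "\<lambda>j. const_poly (of_nat (d j)) * f j"
  have J: "ideal_J ?g = ideal_J f"
  proof (rule ideal_J_scale)
    show "(of_nat (d j) :: complex) \<noteq> 0" for j using d[of j] by simp
  qed
  obtain N where N: "\<And>i. var_poly i ^ N \<in> ideal_J ?g"
    using homogeneous_nullstellensatz[OF f ci] by (auto simp: J)
  have E: "?g j = (\<Sum>k\<in>UNIV. partial_deriv k (f j) * var_poly k)" for j
    using euler_identity[OF f, of j] by (simp add: mult.commute)
  note S = socle_spanned_by_det[of ?g "\<lambda>j k. partial_deriv k (f j)" N, OF E N, unfolded J]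
  show "Jac f \<notin> ideal_J f" "var_poly k * Jac f \<in> ideal_J f"
    unfolding Jac_def by (rule S(1), rule S(2))
  show "\<exists>c. p - const_poly c * Jac f \<in> ideal_J f" if "\<And>k. var_poly k * p \<in> ideal_J f"
    unfolding Jac_def by (rule S(3)) (rule that)
qed

lemma forms_in_ideal:
  assumes I: "ideal_set I" and pow: "\<And>i :: 'n::finite. var_poly i ^ N \<in> I"
    and p: "p \<in> forms m" and m: "CARD('n) * N < m"
  shows "p \<in> I"
  using p
proof (induction rule: forms_monomials_induct)
  case (monomial t c)
  have "\<exists>i. N \<le> Poly_Mapping.lookup t i"
  proof (rule ccontr)
    assume "\<nexists>i. N \<le> Poly_Mapping.lookup t i"
    then have "Poly_Mapping.lookup t v \<le> N" for v by (meson nat_le_linear)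
    then have "monom_degree t \<le> CARD('n) * N"
      unfolding monom_degree_UNIV using sum_bounded_above[of UNIV "Poly_Mapping.lookup t" N] by simp
    then show False using monomial m by simp
  qed
  then obtain i where i: "N \<le> Poly_Mapping.lookup t i" ..
  let ?s = "Poly_Mapping.single i N"
  have "t = (t - ?s) + ?s"
    using i by (intro poly_mapping_eqI) (auto simp: lookup_add lookup_minus lookup_single when_def)
  then have "Poly_Mapping.single t c = Poly_Mapping.single (t - ?s) c * var_poly i ^ N"
    by (simp add: var_poly_power mult_single)
  then show ?case using ideal_set_mult[OF I pow] by simp
qed (auto intro: ideal_set_0[OF I] ideal_set_add[OF I])

lemma forms_eval_0: "p \<in> forms m \<Longrightarrow> 0 < m \<Longrightarrow> eval_poly (\<lambda>_. 0) p = 0"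
proof (induction rule: forms_monomials_induct)
  case (monomial t c)
  then have "t \<noteq> 0" by auto
  then obtain v where "v \<in> Poly_Mapping.keys t" by (metis ex_in_conv keys_eq_empty)
  then have "monom_eval (\<lambda>_. 0) t = 0"
    unfolding monom_eval_def by (intro prod_zero) (auto simp: in_keys_iff intro!: bexI[of _ v])
  then show ?case by simp
qed auto

lemma forms_1E:
  assumes "l \<in> forms 1"
  obtains y where "l = lin_form y"
  using lin_form_coeffs[OF assms] by blast

locale homogeneous_complete_intersection =
  fixes d :: "'n::finite \<Rightarrow> nat" and f :: "'n \<Rightarrow> 'n cpoly"
  assumes three_variables: "3 \<le> CARD('n)"
    and degree_ge_2: "\<And>j. 2 \<le> d j"
    and forms_f: "\<And>j. f j \<in> forms (d j)"
    and complete_intersection: "complete_intersection f"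
begin

abbreviation "J \<equiv> ideal_J f"
abbreviation "T \<equiv> socle_degree d"

lemma T_eq: "T = (\<Sum>j\<in>UNIV. d j - 1)"
proof -
  have "1 \<le> d j" for j using degree_ge_2[of j] by simp
  then show ?thesis unfolding socle_degree_def by (subst sum_subtractf_nat) auto
qed

lemma T_ge_3: "3 \<le> T"
proof -
  have "CARD('n) \<le> T"
  proof -
    have "1 \<le> d j - 1" for j using degree_ge_2[of j] by simp
    then show ?thesis unfolding T_eq using sum_mono[of UNIV "\<lambda>_. 1" "\<lambda>j. d j - 1"] by simp
  qed
  then show ?thesis using three_variables by simp
qed

lemmas jacobian = jacobian_spans_socle[OF forms_f order_trans[OF one_le_numeral degree_ge_2] complete_intersection]
lemmas hom_component_J = hom_component_ideal_J[OF forms_f]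

lemma Jac_forms: "Jac f \<in> forms T"
proof -
  have "of_int (sign p) * (\<Prod>i\<in>UNIV. (\<chi> i j. partial_deriv j (f i)) $ i $ p i) \<in> forms (0 + T)" for p
    unfolding T_eq
    by (intro forms_mult forms_prod) (auto simp: forms_partial_deriv[OF forms_f] simp flip: single_of_int)
  then show ?thesis unfolding Jac_def Determinants.det_def by (intro forms_sum) simp
qed

text \<open>A homogeneous multiple \<open>p g \<notin> J\<close> of largest degree represents a socle element, so it is a
  multiple of the Jacobian modulo \<open>J\<close> and has degree \<open>T\<close>.\<close>

lemma multiple_in_socle_degree:
  assumes p: "p \<in> forms m" "p \<notin> J"
  shows "m \<le> T \<and> (\<exists>g\<in>forms (T - m). p * g \<notin> J)"
proof -
  obtain N where N: "\<And>i. var_poly i ^ N \<in> J"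
    using homogeneous_nullstellensatz[OF forms_f complete_intersection] by auto
  define A where "A k \<longleftrightarrow> (\<exists>g\<in>forms k. p * g \<notin> J)" for k
  have "A 0" using p(2) by (auto simp: A_def intro!: bexI[of _ 1] forms_one)
  moreover have bound: "k \<le> CARD('n) * N" if "A k" for k
  proof (rule ccontr)
    assume k: "\<not> k \<le> CARD('n) * N"
    obtain g where g: "g \<in> forms k" "p * g \<notin> J" using \<open>A k\<close> by (auto simp: A_def)
    have "p * g \<in> J" by (rule forms_in_ideal[OF ideal_J N forms_mult[OF p(1) g(1)]]) (use k in simp)
    with g show False by blast
  qed
  ultimately obtain k where k: "A k" "\<And>k'. A k' \<Longrightarrow> k' \<le> k"
    by (metis GreatestI_nat Greatest_le_nat)
  then obtain g where g: "g \<in> forms k" "p * g \<notin> J" by (auto simp: A_def)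
  have "var_poly i * (p * g) \<in> J" for i
  proof (rule ccontr)
    assume "var_poly i * (p * g) \<notin> J"
    then have "A (1 + k)" using g(1) forms_mult[OF forms_var]
      by (auto simp: A_def mult.left_commute intro!: bexI[of _ "var_poly i * g"])
    then show False using k(2) by force
  qed
  then obtain c where c: "p * g - const_poly c * Jac f \<in> J" using jacobian(3) by blast
  have pg: "p * g \<in> forms (m + k)" by (rule forms_mult[OF p(1) g(1)])
  have "m + k = T"
  proof (rule ccontr)
    assume "m + k \<noteq> T"
    then have "hom_component (m + k) (p * g - const_poly c * Jac f) = p * g"
      by (simp add: hom_component_diff hom_component_of_form[OF pg] hom_component_of_form[OF forms_const_mult[OF Jac_forms]])
    then show False using hom_component_J[OF c, of "m + k"] g(2) by simp
  qed
  then have "m \<le> T" "T - m = k" by auto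
  then show ?thesis using g by auto
qed

lemma forms_above_T: "p \<in> forms m \<Longrightarrow> T < m \<Longrightarrow> p \<in> J"
  using multiple_in_socle_degree[of p m] by auto

text \<open>The pairing of degrees \<open>1\<close> and \<open>T - 1\<close> is nondegenerate on the side of degree \<open>T - 1\<close>.\<close>

lemma in_J_if_var_multiples:
  assumes "p \<in> forms (T - 1)" "\<And>i. var_poly i * p \<in> J"
  shows "p \<in> J"
proof (rule ccontr)
  assume "p \<notin> J"
  then obtain g where g: "g \<in> forms 1" "p * g \<notin> J"
    using multiple_in_socle_degree[OF assms(1)] T_ge_3 by auto
  have "p * lin_form y \<in> J" for y
  proof -
    have "(\<Sum>i\<in>UNIV. const_poly (y i) * (var_poly i * p)) \<in> J"
      by (rule ideal_J_sum, rule ideal_J_mult, rule assms(2))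
    then show ?thesis by (simp add: lin_form_def sum_distrib_left mult_ac)
  qed
  then show False using g forms_1E by metis
qed

lemma var_mult_top: "p \<in> forms T \<Longrightarrow> var_poly i * p \<in> J"
  using forms_above_T[OF forms_mult[OF forms_var]] by simp

section \<open>The socle functional and the associated form\<close>

lemma socle_eq: "socle f = range (\<lambda>c. cls f (const_poly c * Jac f))"
proof
  show "socle f \<subseteq> range (\<lambda>c. cls f (const_poly c * Jac f))"
  proof
    fix u assume u: "u \<in> socle f"
    then obtain p where p: "u = cls f p" by (auto simp: socle_def carrier_alg_M)
    have "var_poly k * p \<in> J" for k
    proof -
      have "coeff_at (var_poly k) 0 = 0"
        by (auto simp: var_poly_def lookup_single when_def dest: arg_cong[where f = Poly_Mapping.keys])
      then show ?thesis using u by (simp add: socle_def p cls_mult cls_zero cls_eq_iff)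
    qed
    then obtain c where "p - const_poly c * Jac f \<in> J" using jacobian(3) by blast
    then show "u \<in> range (\<lambda>c. cls f (const_poly c * Jac f))"
      unfolding p by (auto simp: cls_eq_iff intro!: image_eqI[of _ _ c])
  qed
  show "range (\<lambda>c. cls f (const_poly c * Jac f)) \<subseteq> socle f"
  proof clarify
    fix c
    have "g * (const_poly c * Jac f) \<in> J" if g: "coeff_at g 0 = 0" for g
    proof -
      have "Poly_Mapping.single t b * Jac f \<in> J" if t: "t \<in> Poly_Mapping.keys g" for t b
      proof -
        have "t \<noteq> 0" using t g by (auto simp: in_keys_iff)
        then obtain k where "Poly_Mapping.lookup t k \<noteq> 0"
          by (metis lookup_zero poly_mapping_eqI)
        then have "Poly_Mapping.single (expo k + (t - expo k)) b = Poly_Mapping.single t b"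
          by (simp only: expo_add_minus not_False_eq_True)
        then have "Poly_Mapping.single t b = Poly_Mapping.single (t - expo k) b * var_poly k"
          by (simp add: var_poly_def mult_single add.commute)
        then show ?thesis using ideal_J_mult[OF jacobian(2)] by (simp add: mult.assoc)
      qed
      then have "(\<Sum>t\<in>Poly_Mapping.keys g. Poly_Mapping.single t (coeff_at g t) * Jac f) \<in> J"
        by (intro ideal_J_sum)
      then have "g * Jac f \<in> J"
        by (subst poly_eq_sum_monomials) (simp add: sum_distrib_right)
      then have "const_poly c * (g * Jac f) \<in> J" by (rule ideal_J_mult)
      then show ?thesis by (simp add: mult.left_commute)
    qed
    then show "cls f (const_poly c * Jac f) \<in> socle f"
      by (auto simp: socle_def carrier_alg_M cls_mult cls_zero cls_eq_iff)
  qed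
qed

lemma cls_Jac_inj: "cls f (const_poly a * Jac f) = cls f (const_poly b * Jac f) \<longleftrightarrow> a = b"
proof
  assume "cls f (const_poly a * Jac f) = cls f (const_poly b * Jac f)"
  then have "const_poly (a - b) * Jac f \<in> J"
    by (simp add: cls_eq_iff const_poly_diff left_diff_distrib)
  then show "a = b" using jacobian(1) ideal_set_const_mult_iff[OF ideal_J, of "a - b"] by auto
qed simp

lemma is_socle_iso_omega: "is_socle_iso f (omega f)"
proof -
  define h where "h c = cls f (const_poly c * Jac f)" for c
  have inj: "inj h" by (rule injI) (simp add: h_def cls_Jac_inj)
  have soc: "socle f = range h" by (simp add: socle_eq h_def)
  have inv: "inv_into UNIV h (h c) = c" for c by (rule inv_f_f[OF inj])
  have "is_socle_iso f (inv_into UNIV h)"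
    unfolding is_socle_iso_def soc
  proof (intro conjI ballI allI; clarsimp?)
    fix a b
    have "h a \<oplus>\<^bsub>alg_M f\<^esub> h b = h (a + b)" by (simp add: h_def cls_add const_poly_add distrib_right)
    then show "inv_into UNIV h (h a \<oplus>\<^bsub>alg_M f\<^esub> h b) = inv_into UNIV h (h a) + inv_into UNIV h (h b)" by (simp add: inv)
  next
    fix c a
    have "cls f (const_poly c) \<otimes>\<^bsub>alg_M f\<^esub> h a = h (c * a)" by (simp add: h_def cls_mult const_poly_mult mult.assoc)
    then show "inv_into UNIV h (cls f (const_poly c) \<otimes>\<^bsub>alg_M f\<^esub> h a) = c * inv_into UNIV h (h a)" by (simp add: inv)
  next
    show "bij_betw (inv_into UNIV h) (range h) UNIV"
      by (rule bij_betw_inv_into) (simp add: bij_betw_def inj)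
  next
    have "cls f (Jac f) = h 1" by (simp add: h_def)
    then show "inv_into UNIV h (cls f (Jac f)) = 1" by (simp add: inv)
  qed
  then show ?thesis unfolding omega_def by (rule someI[of "is_socle_iso f"])
qed

text \<open>The functional \<open>omega f\<close>, read on representatives.\<close>

definition res :: "'n cpoly \<Rightarrow> complex" where
  "res p = omega f (cls f p)"

lemma res_cong: "p - q \<in> J \<Longrightarrow> res p = res q"
  by (simp add: res_def flip: cls_eq_iff)

lemma res_Jac: "res (const_poly c * Jac f) = c"
proof -
  have "cls f (Jac f) \<in> socle f" unfolding socle_eq by (rule image_eqI[of _ _ 1]) simp_all
  then have "omega f (cls f (const_poly c) \<otimes>\<^bsub>alg_M f\<^esub> cls f (Jac f)) = c * omega f (cls f (Jac f))"
    and "omega f (cls f (Jac f)) = 1"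
    using is_socle_iso_omega unfolding is_socle_iso_def by blast+
  then show ?thesis by (simp add: res_def cls_mult)
qed

lemma res_spec: "p \<in> forms T \<Longrightarrow> p - const_poly (res p) * Jac f \<in> J"
proof -
  assume "p \<in> forms T"
  then obtain c where c: "p - const_poly c * Jac f \<in> J" using jacobian(3) var_mult_top by blast
  then show ?thesis using res_cong[OF c] res_Jac by simp
qed

lemma res_eqI: "p - const_poly c * Jac f \<in> J \<Longrightarrow> res p = c"
  using res_cong res_Jac by metis

lemma res_eq_0_iff: "p \<in> forms T \<Longrightarrow> res p = 0 \<longleftrightarrow> p \<in> J"
  using res_spec[of p] res_eqI[of p 0] by auto

lemma linear_res: "linear_on_forms T res"
  unfolding linear_on_forms_def
proof (intro conjI ballI allI)
  fix p q :: "'n cpoly" assume "p \<in> forms T" "q \<in> forms T"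
  then have "(p - const_poly (res p) * Jac f) + (q - const_poly (res q) * Jac f) \<in> J"
    by (intro ideal_J_add res_spec)
  then show "res (p + q) = res p + res q"
    by (intro res_eqI) (simp add: const_poly_add algebra_simps)
next
  fix c and p :: "'n cpoly" assume "p \<in> forms T"
  then have "const_poly c * (p - const_poly (res p) * Jac f) \<in> J"
    by (intro ideal_J_mult res_spec)
  then show "res (const_poly c * p) = c * res p"
    by (intro res_eqI) (simp add: const_poly_mult algebra_simps)
qed

lemma lin_form_power_forms: "lin_form y ^ m \<in> forms m"
  using forms_power[OF lin_form_forms, of y m] by simp

text \<open>The definite description picks this form because a polynomial is determined by its values.\<close>

lemma assoc_form_eq_polar: "assoc_form d f = polar T res"
  unfolding assoc_form_def
proof (rule the_equality)
  have fin: "(\<Oplus>\<^bsub>alg_M f\<^esub>i\<in>UNIV. cls f (const_poly (y i)) \<otimes>\<^bsub>alg_M f\<^esub> cls f (var_poly i)) = cls f (lin_form y)" for y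
    by (simp add: cls_mult cls_sum lin_form_def)
  have ev: "eval_poly y (polar T res) = omega f ((\<Oplus>\<^bsub>alg_M f\<^esub>i\<in>UNIV. cls f (const_poly (y i))
      \<otimes>\<^bsub>alg_M f\<^esub> cls f (var_poly i)) [^]\<^bsub>alg_M f\<^esub> T)" for y
    unfolding fin by (simp add: eval_polar[OF linear_res] cls_power res_def)
  then show "polar T res \<in> forms T \<and> (\<forall>y. eval_poly y (polar T res) = omega f ((\<Oplus>\<^bsub>alg_M f\<^esub>i\<in>UNIV.
      cls f (const_poly (y i)) \<otimes>\<^bsub>alg_M f\<^esub> cls f (var_poly i)) [^]\<^bsub>alg_M f\<^esub> T))"
    by (simp add: polar_forms)
  fix A
  assume A: "A \<in> forms T \<and> (\<forall>y. eval_poly y A = omega f ((\<Oplus>\<^bsub>alg_M f\<^esub>i\<in>UNIV.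
      cls f (const_poly (y i)) \<otimes>\<^bsub>alg_M f\<^esub> cls f (var_poly i)) [^]\<^bsub>alg_M f\<^esub> T))"
  have "A - polar T res = 0"
    by (rule eval_poly_eq_0_imp_zero) (simp add: A ev)
  then show "A = polar T res" by simp
qed

lemma linear_res_var: "linear_on_forms (T - 1) (\<lambda>p. res (var_poly i * p))"
  using linear_on_forms_mult[OF _ forms_var, of "T - 1" res i] linear_res T_ge_3 by simp

lemma linear_res_var_var: "linear_on_forms (T - 2) (\<lambda>p. res (var_poly i * (var_poly j * p)))"
proof -
  have "1 + (T - 2) = T - 1" using T_ge_3 by simp
  then show ?thesis
    using linear_on_forms_mult[OF _ forms_var, of "T - 2" "\<lambda>p. res (var_poly i * p)" j] linear_res_var by simp
qed

lemma partial_deriv_assoc: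
  "partial_deriv i (assoc_form d f) = const_poly (of_nat T) * polar (T - 1) (\<lambda>p. res (var_poly i * p))"
proof -
  have "T = Suc (T - 1)" using T_ge_3 by simp
  then show ?thesis using partial_deriv_polar[of i "T - 1" res] by (simp add: assoc_form_eq_polar)
qed

lemma second_partial_deriv_assoc:
  "partial_deriv j (partial_deriv i (assoc_form d f))
    = const_poly (of_nat T * of_nat (T - 1)) * polar (T - 2) (\<lambda>p. res (var_poly i * (var_poly j * p)))"
proof -
  have "T - 1 = Suc (T - 2)" using T_ge_3 by simp
  then show ?thesis
    using partial_deriv_polar[of j "T - 2" "\<lambda>p. res (var_poly i * p)"]
    by (simp add: partial_deriv_assoc partial_deriv_const_mult const_poly_mult mult.assoc)
qed

section \<open>Smoothness of the associated form\<close>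

text \<open>The \<open>i\<close>-th partial derivative at \<open>y\<close> is \<open>T \<omega>(x\<^sub>i \<ell>\<^sup>T\<^sup>-\<^sup>1)\<close> for \<open>\<ell> = \<Sum>i. y\<^sub>i x\<^sub>i\<close>, and these values vanish
  only if \<open>\<ell>\<^sup>T\<^sup>-\<^sup>1\<close> is orthogonal to all linear forms.\<close>

lemma singular_point_iff:
  "(\<forall>i. eval_poly y (partial_deriv i (assoc_form d f)) = 0) \<longleftrightarrow> lin_form y ^ (T - 1) \<in> J"
proof -
  have "Suc (T - 1) = T" using T_ge_3 by simp
  then have vf: "var_poly i * lin_form y ^ (T - 1) \<in> forms T" for i
    using forms_mult[OF forms_var lin_form_power_forms, of i y "T - 1"] by (simp add: plus_1_eq_Suc)
  have "eval_poly y (partial_deriv i (assoc_form d f)) = of_nat T * res (var_poly i * lin_form y ^ (T - 1))" for i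
    by (simp add: partial_deriv_assoc eval_polar[OF linear_res_var])
  then have "(\<forall>i. eval_poly y (partial_deriv i (assoc_form d f)) = 0)
      \<longleftrightarrow> (\<forall>i. var_poly i * lin_form y ^ (T - 1) \<in> J)"
    using T_ge_3 by (simp add: res_eq_0_iff[OF vf])
  then show ?thesis using in_J_if_var_multiples[OF lin_form_power_forms] ideal_J_mult by blast
qed

lemma euler_assoc:
  "of_nat T * eval_poly y (assoc_form d f) = (\<Sum>i\<in>UNIV. y i * eval_poly y (partial_deriv i (assoc_form d f)))"
proof -
  have "assoc_form d f \<in> forms T" by (simp add: assoc_form_eq_polar polar_forms)
  from arg_cong[OF euler_identity[OF this], of "eval_poly y"] show ?thesis by simp
qed

lemma smooth_iff:
  "smooth_hypersurface (assoc_form d f) \<longleftrightarrow> (\<forall>y. y \<noteq> (\<lambda>_. 0) \<longrightarrow> lin_form y ^ (T - 1) \<notin> J)"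
proof -
  have "eval_poly y (assoc_form d f) = 0" if "\<forall>i. eval_poly y (partial_deriv i (assoc_form d f)) = 0" for y
    using euler_assoc[of y] that T_ge_3 by simp
  then show ?thesis unfolding smooth_hypersurface_def singular_point_iff[symmetric] by blast
qed

lemma power_lin_form_neq_0: "y \<noteq> (\<lambda>_. 0) \<Longrightarrow> lin_form y ^ m \<noteq> 0"
proof
  assume "y \<noteq> (\<lambda>_. 0)" and 0: "lin_form y ^ m = 0"
  have "eval_poly x (lin_form y) = 0" for x
    using arg_cong[OF 0, of "eval_poly x"] by simp
  then have "lin_form y = 0" by (rule eval_poly_eq_0_imp_zero)
  then show False using \<open>y \<noteq> (\<lambda>_. 0)\<close> by (simp add: lin_form_eq_0_iff)
qed

lemma veronese_disjoint_iff:
  "proj_space (J \<inter> forms (T - 1)) \<inter> veronese (T - 1) = {}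
    \<longleftrightarrow> (\<forall>y. y \<noteq> (\<lambda>_. 0) \<longrightarrow> lin_form y ^ (T - 1) \<notin> J)"
proof
  assume dis: "proj_space (J \<inter> forms (T - 1)) \<inter> veronese (T - 1) = {}"
  show "\<forall>y. y \<noteq> (\<lambda>_. 0) \<longrightarrow> lin_form y ^ (T - 1) \<notin> J"
  proof (intro allI impI notI)
    fix y :: "'n \<Rightarrow> complex" assume y: "y \<noteq> (\<lambda>_. 0)" "lin_form y ^ (T - 1) \<in> J"
    then have "proj_point (lin_form y ^ (T - 1)) \<in> proj_space (J \<inter> forms (T - 1))"
      unfolding proj_space_def using power_lin_form_neq_0[OF y(1)] lin_form_power_forms by blast
    moreover have "proj_point (lin_form y ^ (T - 1)) \<in> veronese (T - 1)"
      unfolding veronese_def using y(1) lin_form_forms by (auto simp: lin_form_eq_0_iff)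
    ultimately show False using dis by blast
  qed
next
  assume no: "\<forall>y. y \<noteq> (\<lambda>_. 0) \<longrightarrow> lin_form y ^ (T - 1) \<notin> J"
  show "proj_space (J \<inter> forms (T - 1)) \<inter> veronese (T - 1) = {}"
  proof (rule ccontr)
    assume "proj_space (J \<inter> forms (T - 1)) \<inter> veronese (T - 1) \<noteq> {}"
    then obtain p l where p: "p \<in> J" and l: "l \<in> forms 1" "l \<noteq> 0"
      and eq: "proj_point p = proj_point (l ^ (T - 1))"
      unfolding proj_space_def veronese_def by blast
    have "l ^ (T - 1) \<in> proj_point p"
      unfolding eq unfolding proj_point_def by (auto intro!: exI[of _ 1])
    then have "l ^ (T - 1) \<in> J" using ideal_J_mult[OF p] by (auto simp: proj_point_def)
    moreover obtain y where y: "l = lin_form y" using l(1) by (rule forms_1E)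
    ultimately show False using no l(2) by (auto simp: lin_form_eq_0_iff)
  qed
qed

section \<open>The Lefschetz property from a nonzero Hessian\<close>

text \<open>Up to the factor \<open>T (T - 1)\<close> this is the Hessian matrix of the associated form.\<close>

definition hess :: "('n \<Rightarrow> complex) \<Rightarrow> complex ^ 'n ^ 'n" where
  "hess y = (\<chi> i j. res (var_poly i * (var_poly j * lin_form y ^ (T - 2))))"

lemma hess_mult_vec:
  "(hess y *v v) $ i = res (var_poly i * (lin_form (\<lambda>j. v $ j) * lin_form y ^ (T - 2)))"
proof -
  have T: "1 + (1 + (T - 2)) = T" using T_ge_3 by simp
  have vf: "var_poly i * (var_poly j * lin_form y ^ (T - 2)) \<in> forms T" for j
    using forms_mult[OF forms_var forms_mult[OF forms_var lin_form_power_forms], of i j y "T - 2"] T by simp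
  have "(hess y *v v) $ i = (\<Sum>j\<in>UNIV. v $ j * res (var_poly i * (var_poly j * lin_form y ^ (T - 2))))"
    by (simp add: hess_def matrix_vector_mult_def mult.commute)
  also have "\<dots> = res (\<Sum>j\<in>UNIV. const_poly (v $ j) * (var_poly i * (var_poly j * lin_form y ^ (T - 2))))"
    by (rule linear_on_forms_sum[OF linear_res vf, symmetric])
  also have "(\<Sum>j\<in>UNIV. const_poly (v $ j) * (var_poly i * (var_poly j * lin_form y ^ (T - 2))))
      = var_poly i * (lin_form (\<lambda>j. v $ j) * lin_form y ^ (T - 2))"
    by (simp add: lin_form_def sum_distrib_left sum_distrib_right mult_ac)
  finally show ?thesis .
qed

text \<open>Under the pairing of degrees \<open>1\<close> and \<open>T - 1\<close> the matrix \<open>hess y\<close> represents the multiplication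
  map, so its kernel bounds that of the map, and solving \<open>hess y *v v = b\<close> for the vector \<open>b\<close> of
  values \<open>\<omega>(x\<^sub>i p)\<close> gives a preimage of \<open>p\<close>.\<close>

lemma bij_betw_if_hess:
  assumes "Determinants.det (hess y) \<noteq> 0"
  shows "bij_betw (\<lambda>u. (cls f (lin_form y) [^]\<^bsub>alg_M f\<^esub> (T - 2 * 1)) \<otimes>\<^bsub>alg_M f\<^esub> u)
    (graded_M f 1) (graded_M f (T - 1))"
proof -
  let ?l = "lin_form y ^ (T - 2)"
  have inv: "invertible (hess y)" using assms by (simp add: invertible_det_nz)
  have kf: "lin_form v * ?l \<in> forms (T - 1)" for v
  proof -
    have "1 + (T - 2) = T - 1" using T_ge_3 by simp
    then show ?thesis using forms_mult[OF lin_form_forms lin_form_power_forms, of v y "T - 2"] by simp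
  qed
  have vf: "p \<in> forms (T - 1) \<Longrightarrow> var_poly i * p \<in> forms T" for i p
    using forms_mult[OF forms_var, of p "T - 1" i] T_ge_3 by simp
  have inj: "v = w" if J: "?l * lin_form v - ?l * lin_form w \<in> J" for v w
  proof -
    have "hess y *v (\<chi> j. v j - w j) = 0"
    proof (simp only: Finite_Cartesian_Product.vec_eq_iff, intro allI)
      fix i
      have "lin_form (\<lambda>j. (\<chi> j. v j - w j) $ j) * ?l = ?l * lin_form v - ?l * lin_form w"
        by (simp add: lin_form_def const_poly_diff left_diff_distrib sum_subtractf mult.commute right_diff_distrib)
      then have "(hess y *v (\<chi> j. v j - w j)) $ i = res (var_poly i * (?l * lin_form v - ?l * lin_form w))"
        by (simp only: hess_mult_vec)
      moreover have "var_poly i * (?l * lin_form v - ?l * lin_form w) \<in> J" by (rule ideal_J_mult[OF J])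
      ultimately show "(hess y *v (\<chi> j. v j - w j)) $ i = 0 $ i"
        using res_eqI[of _ 0] by simp
    qed
    then have "(\<chi> j. v j - w j) = 0"
      using inv matrix_left_invertible_ker[of "hess y"] by (auto simp: invertible_def)
    then show ?thesis by (auto simp: Finite_Cartesian_Product.vec_eq_iff)
  qed
  have surj: "\<exists>v. p - ?l * lin_form v \<in> J" if p: "p \<in> forms (T - 1)" for p
  proof -
    obtain B where B: "hess y ** B = Finite_Cartesian_Product.mat 1" using inv by (auto simp: invertible_def)
    define v where "v = B *v (\<chi> i. res (var_poly i * p))"
    have Hv: "hess y *v v = (\<chi> i. res (var_poly i * p))"
      by (simp add: v_def matrix_vector_mul_assoc B)
    have "p - lin_form (\<lambda>j. v $ j) * ?l \<in> J"
    proof (rule in_J_if_var_multiples)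
      show "p - lin_form (\<lambda>j. v $ j) * ?l \<in> forms (T - 1)" by (rule forms_diff[OF p kf])
      fix i
      have "res (var_poly i * (lin_form (\<lambda>j. v $ j) * ?l)) = res (var_poly i * p)"
        using arg_cong[OF Hv, of "\<lambda>w. w $ i"] by (simp add: hess_mult_vec)
      then have "res (var_poly i * p - var_poly i * (lin_form (\<lambda>j. v $ j) * ?l)) = 0"
        by (simp add: linear_on_forms_diff[OF linear_res vf[OF p] vf[OF kf]])
      then show "var_poly i * (p - lin_form (\<lambda>j. v $ j) * ?l) \<in> J"
        using res_eq_0_iff[OF forms_diff[OF vf[OF p] vf[OF kf]]] by (simp add: right_diff_distrib)
    qed
    then show ?thesis by (auto simp: mult.commute)
  qed
  have map: "(cls f (lin_form y) [^]\<^bsub>alg_M f\<^esub> (T - 2 * 1)) \<otimes>\<^bsub>alg_M f\<^esub> cls f p = cls f (?l * p)" for p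
    by (simp add: cls_power cls_mult)
  have M1: "graded_M f 1 = range (\<lambda>v. cls f (lin_form v))"
  proof -
    have "forms 1 = range (lin_form :: ('n \<Rightarrow> complex) \<Rightarrow> _)"
      using lin_form_forms by (auto elim: forms_1E)
    then show ?thesis by (simp add: graded_M_def image_image)
  qed
  show ?thesis
    unfolding bij_betw_def
  proof
    show "inj_on (\<lambda>u. (cls f (lin_form y) [^]\<^bsub>alg_M f\<^esub> (T - 2 * 1)) \<otimes>\<^bsub>alg_M f\<^esub> u) (graded_M f 1)"
      unfolding M1
    proof (rule inj_onI)
      fix a b
      assume "a \<in> range (\<lambda>v. cls f (lin_form v))" "b \<in> range (\<lambda>v. cls f (lin_form v))"
      then obtain v w where ab: "a = cls f (lin_form v)" "b = cls f (lin_form w)" by blast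
      assume "(cls f (lin_form y) [^]\<^bsub>alg_M f\<^esub> (T - 2 * 1)) \<otimes>\<^bsub>alg_M f\<^esub> a
          = (cls f (lin_form y) [^]\<^bsub>alg_M f\<^esub> (T - 2 * 1)) \<otimes>\<^bsub>alg_M f\<^esub> b"
      then have "?l * lin_form v - ?l * lin_form w \<in> J" by (simp only: ab map cls_eq_iff)
      then show "a = b" using inj ab by blast
    qed
    show "(\<lambda>u. (cls f (lin_form y) [^]\<^bsub>alg_M f\<^esub> (T - 2 * 1)) \<otimes>\<^bsub>alg_M f\<^esub> u) ` graded_M f 1 = graded_M f (T - 1)"
      unfolding M1 image_image map
    proof
      show "range (\<lambda>v. cls f (?l * lin_form v)) \<subseteq> graded_M f (T - 1)"
        using kf by (auto simp: graded_M_def mult.commute)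
      show "graded_M f (T - 1) \<subseteq> range (\<lambda>v. cls f (?l * lin_form v))"
        unfolding graded_M_def
      proof clarify
        fix p :: "'n cpoly" assume "p \<in> forms (T - 1)"
        then obtain v where "p - ?l * lin_form v \<in> J" using surj by blast
        then have "cls f p = cls f (?l * lin_form v)" by (simp only: cls_eq_iff)
        then show "cls f p \<in> range (\<lambda>v. cls f (?l * lin_form v))" by blast
      qed
    qed
  qed
qed

lemma eval_det:
  "eval_poly y (Determinants.det M) = Determinants.det (\<chi> i j. eval_poly y (M $ i $ j))"
  for M :: "'v cpoly ^ 'k::finite ^ 'k"
proof -
  have "eval_poly y (of_int k) = of_int k" for k
    using eval_const_poly[of y "of_int k"] by (simp add: const_poly_def)
  then show ?thesis by (simp add: Determinants.det_def)
qed

text \<open>The determinant of \<open>hess y\<close> depends polynomially on \<open>y\<close>, so its nonvanishing is a Zariski open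
  condition on the linear form.\<close>

lemma eval_hess_polynomial:
  "eval_poly y (Determinants.det (\<chi> i j. polar (T - 2) (\<lambda>p. res (var_poly i * (var_poly j * p)))))
    = Determinants.det (hess y)"
  by (simp add: eval_det eval_polar[OF linear_res_var_var] hess_def)

lemma strong_lefschetz_if_hess:
  assumes "Determinants.det (hess y) \<noteq> 0"
  shows "strong_lefschetz d f 1"
  unfolding strong_lefschetz_def
proof (rule generically_if_polyfun)
  show "polyfun coeff_at (\<lambda>l. Determinants.det (hess (\<lambda>i. coeff_at l (expo i))))"
    unfolding eval_hess_polynomial[symmetric] by (intro polyfun_eval_poly polyfun_coord)
  show "lin_form y \<in> forms 1" by simp
  show "Determinants.det (hess (\<lambda>i. coeff_at (lin_form y) (expo i))) \<noteq> 0"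
    using assms by simp
  fix l :: "'n cpoly" assume "l \<in> forms 1" "Determinants.det (hess (\<lambda>i. coeff_at l (expo i))) \<noteq> 0"
  then show "bij_betw (\<lambda>u. (cls f l [^]\<^bsub>alg_M f\<^esub> (T - 2 * 1)) \<otimes>\<^bsub>alg_M f\<^esub> u)
      (graded_M f 1) (graded_M f (T - 1))"
    using bij_betw_if_hess lin_form_coeffs by metis
qed

text \<open>If the associated form is smooth, then its partial derivatives form a complete intersection, so
  their Jacobian, which is the Hessian of the associated form, is a socle generator and nonzero.\<close>

theorem strong_lefschetz_if_smooth:
  assumes smooth: "smooth_hypersurface (assoc_form d f)"
  shows "strong_lefschetz d f 1"
proof -
  define A where "A = assoc_form d f"
  have A: "A \<in> forms T" by (simp add: A_def assoc_form_eq_polar polar_forms)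
  define G where "G i = partial_deriv i A" for i
  have G: "G i \<in> forms (T - 1)" for i unfolding G_def by (rule forms_partial_deriv[OF A])
  have ci: "complete_intersection G"
  proof -
    have "y = (\<lambda>_. 0)" if "\<forall>i. eval_poly y (G i) = 0" for y
    proof (rule ccontr)
      assume "y \<noteq> (\<lambda>_. 0)"
      moreover have "eval_poly y A = 0" using euler_assoc[of y] that T_ge_3 by (simp add: A_def G_def)
      ultimately show False using smooth that by (auto simp: smooth_hypersurface_def A_def G_def)
    qed
    moreover have "eval_poly (\<lambda>_. 0) (G i) = 0" for i
      using forms_eval_0[OF G] T_ge_3 by simp
    ultimately show ?thesis by (auto simp: complete_intersection_def)
  qed
  have "Jac G \<notin> ideal_J G"
    using T_ge_3 by (intro jacobian_spans_socle(1)[OF G _ ci]) simp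
  then have "Jac G \<noteq> 0" by auto
  then obtain y where y: "eval_poly y (Jac G) \<noteq> 0" using eval_poly_eq_0_imp_zero by blast
  let ?c = "of_nat T * of_nat (T - 1) :: complex"
  have "eval_poly y (Jac G) = Determinants.det (\<chi> i. ?c *s hess y $ i)"
    unfolding Jac_def eval_det
    by (intro arg_cong[of _ _ Determinants.det] iffD2[OF Finite_Cartesian_Product.vec_eq_iff] allI)
      (simp add: G_def A_def second_partial_deriv_assoc eval_polar[OF linear_res_var_var] hess_def)
  also have "\<dots> = (\<Prod>i\<in>(UNIV :: 'n set). ?c) * Determinants.det (\<chi> i. hess y $ i)"
    by (rule Determinants.det_rows_mul)
  finally have "Determinants.det (hess y) \<noteq> 0" using y by auto
  then show ?thesis by (rule strong_lefschetz_if_hess)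
qed

end

context homogeneous_complete_intersection
begin

lemma det_hess_nonzero:
  assumes "\<And>v. (\<And>i. var_poly i * (lin_form v * lin_form y ^ (T - 2)) \<in> J) \<Longrightarrow> v = (\<lambda>_. 0)"
  shows "Determinants.det (hess y) \<noteq> 0"
proof -
  have T: "1 + (1 + (T - 2)) = T" using T_ge_3 by simp
  have vf: "var_poly i * (lin_form v * lin_form y ^ (T - 2)) \<in> forms T" for i v
    using forms_mult[OF forms_var forms_mult[OF lin_form_forms lin_form_power_forms], of i v y "T - 2"] T by simp
  have "x = 0" if "hess y *v x = 0" for x
  proof -
    have "res (var_poly i * (lin_form (\<lambda>j. x $ j) * lin_form y ^ (T - 2))) = 0" for i
      using that by (simp flip: hess_mult_vec)
    then have "(\<lambda>j. x $ j) = (\<lambda>_. 0)" by (intro assms) (simp add: res_eq_0_iff[OF vf])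
    then show ?thesis by (simp add: Finite_Cartesian_Product.vec_eq_iff fun_eq_iff)
  qed
  then have "invertible (hess y)"
    using matrix_left_invertible_ker[of "hess y"] by (auto simp: invertible_left_inverse)
  then show ?thesis by (simp add: invertible_det_nz)
qed

text \<open>All generators have degree at least 2.\<close>

lemma linear_form_in_J:
  assumes "lin_form v \<in> J"
  shows "v = (\<lambda>_. 0)"
proof -
  obtain g where g: "lin_form v = (\<Sum>j\<in>UNIV. g j * f j)" using assms by (auto simp: mem_ideal_J)
  have "hom_component 1 (g j * f j) = 0" for j
    using degree_ge_2[of j] by (simp add: hom_component_mult_form[OF forms_f])
  then have "hom_component 1 (lin_form v) = 0" unfolding g hom_component_sum by simp
  then show ?thesis by (simp add: hom_component_of_form[OF lin_form_forms] lin_form_eq_0_iff)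
qed

text \<open>By duality surjectivity implies injectivity: a linear form \<open>v\<close> that is killed by \<open>\<ell>\<^sup>T\<^sup>-\<^sup>2\<close> kills
  \<open>\<ell>\<^sup>T\<^sup>-\<^sup>2 S\<^sub>1\<close>, hence all forms of degree \<open>T - 1\<close>, and so is zero modulo \<open>J\<close>.\<close>

lemma strong_lefschetz_if_surjective:
  assumes surj: "\<And>p. p \<in> forms (T - 1) \<Longrightarrow> \<exists>u. p - lin_form u * lin_form y ^ (T - 2) \<in> J"
  shows "strong_lefschetz d f 1"
proof (rule strong_lefschetz_if_hess, rule det_hess_nonzero, rule linear_form_in_J, rule ccontr)
  fix v assume v: "\<And>i. var_poly i * (lin_form v * lin_form y ^ (T - 2)) \<in> J" and "lin_form v \<notin> J"
  then obtain g where g: "g \<in> forms (T - 1)" "lin_form v * g \<notin> J"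
    using multiple_in_socle_degree[OF lin_form_forms] by blast
  obtain u where u: "g - lin_form u * lin_form y ^ (T - 2) \<in> J" using surj[OF g(1)] by blast
  have "(\<Sum>i\<in>UNIV. const_poly (u i) * (var_poly i * (lin_form v * lin_form y ^ (T - 2)))) \<in> J"
    by (rule ideal_J_sum, rule ideal_J_mult, rule v)
  also have "(\<Sum>i\<in>UNIV. const_poly (u i) * (var_poly i * (lin_form v * lin_form y ^ (T - 2))))
      = lin_form v * (lin_form u * lin_form y ^ (T - 2))"
    by (simp add: lin_form_def[of u] sum_distrib_left sum_distrib_right mult_ac)
  finally have "lin_form v * (lin_form u * lin_form y ^ (T - 2)) \<in> J" .
  moreover have "lin_form v * g - lin_form v * (lin_form u * lin_form y ^ (T - 2)) \<in> J"
    using ideal_J_mult[OF u, of "lin_form v"] by (simp add: right_diff_distrib)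
  ultimately show False using g(2) ideal_J_cong by blast
qed

end

section \<open>Spanning modulo the ideal is an open condition\<close>

lemma coeff_mult_eq_sum:
  "coeff_at (g * p) s
    = (\<Sum>u\<in>Poly_Mapping.keys g. coeff_at g u * (if u + (s - u) = s then coeff_at p (s - u) else 0))"
proof -
  have *: "coeff_at (Poly_Mapping.single u c * p) s = c * (if u + (s - u) = s then coeff_at p (s - u) else 0)" for u c
  proof (cases "u + (s - u) = s")
    case True
    then show ?thesis using coeff_single_mult_add[of u c p "s - u"] by simp
  next
    case False
    then have "\<nexists>v. s = u + v" by auto
    then show ?thesis using False by (simp add: coeff_single_mult_eq_0)
  qed
  have "coeff_at (g * p) s = coeff_at ((\<Sum>u\<in>Poly_Mapping.keys g. Poly_Mapping.single u (coeff_at g u)) * p) s"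
    by (subst (1) poly_eq_sum_monomials) simp
  also have "\<dots> = (\<Sum>u\<in>Poly_Mapping.keys g. coeff_at g u * (if u + (s - u) = s then coeff_at p (s - u) else 0))"
    by (simp only: sum_distrib_right lookup_sum *)
  finally show ?thesis .
qed

lemma polyfun_coeff_mult: "polyfun tuple_coord (\<lambda>f. coeff_at (g * f j) s)"
proof -
  have "polyfun tuple_coord (\<lambda>f. coeff_at (f j) v)" for v
    using polyfun_coord[of tuple_coord "(j, v)"] by (simp add: tuple_coord_def)
  then have "polyfun tuple_coord (\<lambda>f. if u + (s - u) = s then coeff_at (f j) (s - u) else 0)" for u
    by (cases "u + (s - u) = s") (simp_all add: polyfun_const)
  then show ?thesis
    unfolding coeff_mult_eq_sum by (intro polyfun_sum polyfun_mult polyfun_const)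
qed

text \<open>Express each monomial at \<open>f0\<close> as an element of \<open>W\<close> plus a combination of the \<open>f0 j\<close>, and keep
  the coefficients of these combinations while \<open>f\<close> varies. The resulting square matrix in the
  monomial basis depends polynomially on \<open>f\<close>, is the identity at \<open>f0\<close>, and as long as it is
  invertible, its rows still span.\<close>

lemma spanning_mod_ideal_open:
  fixes f0 :: "'n::finite \<Rightarrow> 'n cpoly"
  assumes W: "0 \<in> W" "\<And>v w. v \<in> W \<Longrightarrow> w \<in> W \<Longrightarrow> v + w \<in> W" "\<And>c w. w \<in> W \<Longrightarrow> const_poly c * w \<in> W"
      "W \<subseteq> forms m"
    and span: "\<And>t. monom_degree t = m \<Longrightarrow> \<exists>w\<in>W. Poly_Mapping.single t 1 - w \<in> ideal_J f0"
  obtains F where "polyfun tuple_coord F" "F f0 \<noteq> 0"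
    "\<And>f p. f \<in> tuples d \<Longrightarrow> F f \<noteq> 0 \<Longrightarrow> p \<in> forms m \<Longrightarrow> \<exists>w\<in>W. p - w \<in> ideal_J f"
proof -
  let ?B = "{t :: 'n \<Rightarrow>\<^sub>0 nat. monom_degree t = m}"
  have "finite ?B" by (rule finite_subset[OF _ finite_monomials[of m]]) auto
  then obtain b where b: "bij_betw b {0..<card ?B} ?B" using ex_bij_betw_nat_finite by blast
  define k where "k = card ?B"
  have bk: "monom_degree (b r) = m" if "r < k" for r
    using bij_betwE[OF b] that by (simp add: k_def)
  have b_surj: "\<exists>r<k. b r = t" if "monom_degree t = m" for t
  proof -
    have "t \<in> b ` {0..<card ?B}" using bij_betw_imp_surj_on[OF b] that by simp
    then show ?thesis by (auto simp: k_def)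
  qed
  have b_inj: "b r = b s \<longleftrightarrow> r = s" if "r < k" "s < k" for r s
    using inj_on_eq_iff[OF bij_betw_imp_inj_on[OF b]] that by (simp add: k_def)
  have "\<exists>w g. monom_degree t = m \<longrightarrow> w \<in> W \<and> Poly_Mapping.single t 1 = w + (\<Sum>j\<in>UNIV. g j * f0 j)" for t
  proof (cases "monom_degree t = m")
    case True
    then obtain w where "w \<in> W" "Poly_Mapping.single t 1 - w \<in> ideal_J f0" using span by blast
    then obtain g where "w \<in> W" "Poly_Mapping.single t 1 - w = (\<Sum>j\<in>UNIV. g j * f0 j)"
      by (auto simp: mem_ideal_J)
    then show ?thesis by (intro exI[of _ w] exI[of _ g]) (simp add: algebra_simps)
  qed simp
  then obtain w g where w: "\<And>t. monom_degree t = m \<Longrightarrow> w t \<in> W"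
    and g: "\<And>t. monom_degree t = m \<Longrightarrow> Poly_Mapping.single t 1 = w t + (\<Sum>j\<in>UNIV. g t j * f0 j)"
    by metis
  define q where "q t f = w t + (\<Sum>j\<in>UNIV. g t j * f j)" for t and f :: "'n \<Rightarrow> 'n cpoly"
  define Q where "Q f = mat k k (\<lambda>(r, s). coeff_at (q (b r) f) (b s))" for f
  have Qc: "Q f \<in> carrier_mat k k" for f by (simp add: Q_def)
  have poly: "polyfun tuple_coord (\<lambda>f. Determinant.det (Q f))"
  proof -
    have ent: "polyfun tuple_coord (\<lambda>f. coeff_at (q t f) s)" for t s
      by (simp only: q_def lookup_add lookup_sum) (intro polyfun_add polyfun_const polyfun_sum polyfun_coeff_mult)
    have "Determinant.det (Q f) = (\<Sum>p\<in>{p. p permutes {0..<k}}. signof p * (\<Prod>r = 0..<k. coeff_at (q (b r) f) (b (p r))))" for f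
    proof -
      have "p r < k" if "p permutes {0..<k}" "r < k" for p r
        using permutes_in_image[OF that(1), of r] that(2) by simp
      then show ?thesis
        by (auto simp: Q_def Determinant.det_def intro!: sum.cong arg_cong2[of _ _ _ _ "(*)"] prod.cong)
    qed
    then show ?thesis by (simp only:) (intro polyfun_sum polyfun_mult polyfun_const polyfun_prod ent)
  qed
  have at_f0: "Determinant.det (Q f0) \<noteq> 0"
  proof -
    have "Q f0 = 1\<^sub>m k"
    proof (rule eq_matI)
      fix r s assume "r < dim_row (1\<^sub>m k :: complex mat)" "s < dim_col (1\<^sub>m k :: complex mat)"
      then have rs: "r < k" "s < k" by simp_all
      have "q (b r) f0 = Poly_Mapping.single (b r) 1" using g[OF bk[OF rs(1)]] by (simp add: q_def)
      then show "Q f0 $$ (r, s) = 1\<^sub>m k $$ (r, s)"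
        using rs b_inj[OF rs] by (simp add: Q_def lookup_single when_def)
    qed (simp_all add: Q_def)
    then show ?thesis by simp
  qed
  have "\<exists>w\<in>W. p - w \<in> ideal_J f"
    if f: "f \<in> tuples d" and nz: "Determinant.det (Q f) \<noteq> 0" and p: "p \<in> forms m" for f p
    using p
  proof (induction rule: forms_monomials_induct)
    case zero
    show ?case using W(1) by (intro bexI[of _ 0]) simp_all
  next
    case (add p q)
    then obtain v w where "v \<in> W" "w \<in> W" "p - v \<in> ideal_J f" "q - w \<in> ideal_J f" by blast
    then show ?case
      using ideal_J_add[of "p - v" f "q - w"] W(2)[of v w] by (intro bexI[of _ "v + w"]) (simp_all add: algebra_simps)
  next
    case (monomial t c)
    then obtain l where l: "l < k" "b l = t" using b_surj by blast
    (* The row of the inverse matrix that expresses the monomial t through the q (b r) f; these need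
       not be homogeneous, so this holds for the components of degree m. *)
    define a where "a r = adj_mat (Q f) $$ (l, r) / Determinant.det (Q f)" for r
    define u where "u = (\<Sum>r<k. const_poly (a r) * w (b r))"
    have "u \<in> W"
    proof -
      have "(\<Sum>r\<in>A. const_poly (a r) * w (b r)) \<in> W" if "A \<subseteq> {..<k}" for A
        using that by (induction A rule: infinite_finite_induct) (auto intro!: W(1-3) w bk)
      then show ?thesis unfolding u_def by blast
    qed
    have coeff: "coeff_at (\<Sum>r<k. const_poly (a r) * q (b r) f) (b s) = (if l = s then 1 else 0)" if s: "s < k" for s
    proof -
      have "(\<Sum>r<k. adj_mat (Q f) $$ (l, r) * coeff_at (q (b r) f) (b s)) = (adj_mat (Q f) * Q f) $$ (l, s)"
        using l(1) s adj_mat(1)[OF Qc, of f] by (simp add: Q_def scalar_prod_def lessThan_atLeast0)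
      also have "\<dots> = (if l = s then Determinant.det (Q f) else 0)"
        using l(1) s by (simp add: adj_mat(3)[OF Qc])
      finally have "(\<Sum>r<k. adj_mat (Q f) $$ (l, r) * coeff_at (q (b r) f) (b s)) = (if l = s then Determinant.det (Q f) else 0)" .
      then show ?thesis using nz by (simp add: lookup_sum a_def flip: sum_divide_distrib)
    qed
    have "hom_component m (\<Sum>r<k. const_poly (a r) * q (b r) f) = Poly_Mapping.single t 1"
    proof (rule poly_mapping_eqI)
      fix s
      show "coeff_at (hom_component m (\<Sum>r<k. const_poly (a r) * q (b r) f)) s = coeff_at (Poly_Mapping.single t 1) s"
      proof (cases "monom_degree s = m")
        case True
        then obtain r where "r < k" "b r = s" using b_surj by blast
        then show ?thesis using coeff[of r] True l b_inj[of l r] by (auto simp: coeff_hom_component lookup_single when_def)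
      next
        case False
        then show ?thesis using monomial by (auto simp: coeff_hom_component lookup_single when_def)
      qed
    qed
    moreover have "(\<Sum>r<k. const_poly (a r) * q (b r) f) = u + (\<Sum>r<k. const_poly (a r) * (\<Sum>j\<in>UNIV. g (b r) j * f j))"
      by (simp add: u_def q_def distrib_left sum.distrib)
    moreover have "hom_component m u = u" using \<open>u \<in> W\<close> W(4) by (auto intro: hom_component_of_form[THEN trans])
    ultimately have "Poly_Mapping.single t 1 = u + hom_component m (\<Sum>r<k. const_poly (a r) * (\<Sum>j\<in>UNIV. g (b r) j * f j))"
      by (simp add: hom_component_add)
    then have "Poly_Mapping.single t 1 - u = hom_component m (\<Sum>r<k. const_poly (a r) * (\<Sum>j\<in>UNIV. g (b r) j * f j))"
      by (simp only: add_diff_cancel_left')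
    also have "\<dots> \<in> ideal_J f"
      using f by (intro hom_component_ideal_J[of f d] ideal_J_sum ideal_J_mult ideal_J_gen) (simp add: tuples_def)
    finally have "const_poly c * (Poly_Mapping.single t 1 - u) \<in> ideal_J f" by (rule ideal_J_mult)
    then show ?case using W(3)[OF \<open>u \<in> W\<close>, of c]
      by (intro bexI[of _ "const_poly c * u"]) (simp_all add: right_diff_distrib const_poly_mult_single)
  qed
  then show ?thesis using that[OF poly at_f0] by blast
qed

section \<open>The Fermat complete intersection\<close>

definition fermat :: "('n \<Rightarrow> nat) \<Rightarrow> 'n \<Rightarrow> 'n cpoly" where
  "fermat d j = var_poly j ^ d j"

lemma fermat_forms: "fermat d j \<in> forms (d j)"
  using forms_power[OF forms_var, of j "d j"] by (simp add: fermat_def)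

lemma fermat_ideal_coeff:
  fixes d :: "'n::finite \<Rightarrow> nat"
  assumes "p \<in> ideal_J (fermat d)" "\<And>i. Poly_Mapping.lookup t i < d i"
  shows "coeff_at p t = 0"
proof -
  obtain g where g: "p = (\<Sum>j\<in>UNIV. g j * fermat d j)" using assms(1) by (auto simp: mem_ideal_J)
  have "coeff_at (fermat d j * g j) t = 0" for j
    unfolding fermat_def var_poly_power
  proof (rule coeff_single_mult_eq_0)
    show "\<nexists>u. t = Poly_Mapping.single j (d j) + u"
      using assms(2)[of j] by (auto simp: lookup_add)
  qed
  then show ?thesis by (simp add: g lookup_sum mult.commute)
qed

lemma coeff_var_mult:
  "coeff_at (var_poly i * p) t = (if Poly_Mapping.lookup t i = 0 then 0 else coeff_at p (t - expo i))"
proof (cases "Poly_Mapping.lookup t i = 0")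
  case True
  then have "\<nexists>u. t = expo i + u" by (auto simp: lookup_add)
  then show ?thesis using True by (simp add: var_poly_def coeff_single_mult_eq_0)
next
  case False
  then show ?thesis
    using coeff_single_mult_add[of "expo i" 1 p "t - expo i"] by (simp add: var_poly_def expo_add_minus)
qed

definition multi_fact :: "('n::finite \<Rightarrow>\<^sub>0 nat) \<Rightarrow> complex" where
  "multi_fact t = (\<Prod>v\<in>UNIV. fact (Poly_Mapping.lookup t v))"

text \<open>Multiplying the coefficient at \<open>t\<close> by \<open>t!\<close> turns multiplication by a variable into a shift with a
  factor linear in \<open>t\<close>, which can be iterated: this gives the multinomial coefficients of
  \<open>(\<Sum>i. x\<^sub>i)\<^sup>m\<close> and the entries of the Hessian of a monomial.\<close>

lemma coeff_var_mult_multi_fact: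
  "coeff_at (var_poly i * p) t * multi_fact t
    = of_nat (Poly_Mapping.lookup t i) * (coeff_at p (t - expo i) * multi_fact (t - expo i))"
proof (cases "Poly_Mapping.lookup t i = 0")
  case False
  have "multi_fact t = fact (Poly_Mapping.lookup t i) * (\<Prod>v\<in>UNIV - {i}. fact (Poly_Mapping.lookup t v))"
    unfolding multi_fact_def by (rule prod.remove) auto
  moreover have "multi_fact (t - expo i) = fact (Poly_Mapping.lookup t i - 1) * (\<Prod>v\<in>UNIV - {i}. fact (Poly_Mapping.lookup t v))"
    unfolding multi_fact_def by (subst prod.remove[of _ i]) (auto simp: lookup_minus lookup_single when_def intro!: prod.cong)
  moreover have "fact (Poly_Mapping.lookup t i) = of_nat (Poly_Mapping.lookup t i) * (fact (Poly_Mapping.lookup t i - 1) :: complex)"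
    using False by (intro fact_reduce) simp
  ultimately show ?thesis using False by (simp add: coeff_var_mult)
qed (simp add: coeff_var_mult)

lemma coeff_sum_vars_power:
  "monom_degree t = m \<Longrightarrow> coeff_at (lin_form (\<lambda>_. 1) ^ m) t * multi_fact t = fact m"
proof (induction m arbitrary: t)
  case 0
  then have "t = 0" by (intro poly_mapping_eqI) (simp add: monom_degree_UNIV)
  then show ?case by (simp add: multi_fact_def)
next
  case (Suc m)
  have "coeff_at (lin_form (\<lambda>_. 1) ^ Suc m) t * multi_fact t
      = (\<Sum>i\<in>UNIV. coeff_at (var_poly i * lin_form (\<lambda>_. 1) ^ m) t * multi_fact t)"
    by (simp add: lin_form_def sum_distrib_right lookup_sum)
  also have "\<dots> = (\<Sum>i\<in>UNIV. of_nat (Poly_Mapping.lookup t i) * fact m)"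
  proof (rule sum.cong[OF refl])
    fix i
    show "coeff_at (var_poly i * lin_form (\<lambda>_. 1) ^ m) t * multi_fact t = of_nat (Poly_Mapping.lookup t i) * fact m"
    proof (cases "Poly_Mapping.lookup t i = 0")
      case False
      then have "monom_degree t = 1 + monom_degree (t - expo i)"
        using expo_add_minus by (metis monom_degree_add monom_degree_single)
      then show ?thesis unfolding coeff_var_mult_multi_fact using Suc by simp
    qed (simp add: coeff_var_mult)
  qed
  also have "\<dots> = of_nat (Suc m) * fact m"
    using Suc.prems by (simp add: monom_degree_UNIV flip: sum_distrib_right of_nat_sum)
  finally show ?case by simp
qed

context
  fixes d :: "'n::finite \<Rightarrow> nat"
  assumes three_variables: "3 \<le> CARD('n)" and degree_ge_2: "\<And>j. 2 \<le> d j"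
begin

lemma fermat_complete_intersection: "homogeneous_complete_intersection d (fermat d)"
proof
  have "y = (\<lambda>_. 0)" if "\<forall>j. eval_poly y (fermat d j) = 0" for y
    using that by (auto simp: fermat_def)
  moreover have "eval_poly (\<lambda>_. 0) (fermat d j) = 0" for j
    using degree_ge_2[of j] by (simp add: fermat_def)
  ultimately show "complete_intersection (fermat d)" by (auto simp: complete_intersection_def)
qed (use three_variables degree_ge_2 fermat_forms in auto)

interpretation fermat: homogeneous_complete_intersection d "fermat d"
  by (rule fermat_complete_intersection)

lemma fermat_above_socle: "monom_degree t = fermat.T + 1 \<Longrightarrow> Poly_Mapping.single t 1 \<in> ideal_J (fermat d)"
  by (rule fermat.forms_above_T[of _ "fermat.T + 1"]) simp_all

text \<open>The associated form is proportional to the monomial with exponents \<open>a\<^sub>i = d\<^sub>i - 1\<close>, whose Hessian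
  matrix at \<open>\<ell> = \<Sum>i. x\<^sub>i\<close> is \<open>(a\<^sub>i a\<^sub>j - \<delta>\<^sub>i\<^sub>j a\<^sub>i)\<^sub>i\<^sub>j\<close>. A kernel vector \<open>v\<close> satisfies \<open>v\<^sub>i = \<Sum>j. a\<^sub>j v\<^sub>j\<close>
  for all \<open>i\<close>. So all \<open>v\<^sub>i\<close> are equal to some \<open>s\<close> with \<open>s = T s\<close>, and \<open>T \<noteq> 1\<close>.\<close>

lemma fermat_hess: "Determinants.det (fermat.hess (\<lambda>_. 1)) \<noteq> 0"
proof (rule fermat.det_hess_nonzero)
  let ?l = "lin_form (\<lambda>_ :: 'n. 1) ^ (fermat.T - 2)"
  fix v :: "'n \<Rightarrow> complex" assume v: "\<And>i. var_poly i * (lin_form v * ?l) \<in> fermat.J"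
  define a where "a = (\<Sum>v\<in>UNIV. Poly_Mapping.single (v :: 'n) (d v - 1))"
  have av: "Poly_Mapping.lookup a i = d i - 1" for i
    by (simp add: a_def lookup_sum lookup_single when_def)
  have dega: "monom_degree a = fermat.T" by (simp add: monom_degree_UNIV av fermat.T_eq)
  have a1: "1 \<le> Poly_Mapping.lookup a i" for i using degree_ge_2[of i] by (simp add: av)
  have entry: "coeff_at (var_poly i * (var_poly j * ?l)) a * multi_fact a
      = of_nat (Poly_Mapping.lookup a i) * (of_nat (Poly_Mapping.lookup a j) - (if i = j then 1 else 0)) * fact (fermat.T - 2)" for i j
  proof -
    have ai: "monom_degree (a - expo i) = fermat.T - 1"
      using expo_add_minus[of a i] a1[of i] dega monom_degree_add[of "expo i" "a - expo i"] by simp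
    have "Poly_Mapping.lookup (a - expo i) j = Poly_Mapping.lookup a j - (if i = j then 1 else 0)"
      by (simp add: lookup_minus lookup_single when_def)
    then have aij: "of_nat (Poly_Mapping.lookup (a - expo i) j) = of_nat (Poly_Mapping.lookup a j) - (if i = j then 1 else 0 :: complex)"
      using a1[of j] by (simp add: of_nat_diff)
    have "of_nat (Poly_Mapping.lookup (a - expo i) j) * (coeff_at ?l (a - expo i - expo j) * multi_fact (a - expo i - expo j))
        = of_nat (Poly_Mapping.lookup (a - expo i) j) * fact (fermat.T - 2)"
    proof (cases "Poly_Mapping.lookup (a - expo i) j = 0")
      case False
      then have "monom_degree (a - expo i - expo j) = fermat.T - 2"
        using expo_add_minus[OF False] ai monom_degree_add[of "expo j" "a - expo i - expo j"] by simp
      then show ?thesis by (simp add: coeff_sum_vars_power)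
    qed simp
    then show ?thesis by (simp only: coeff_var_mult_multi_fact aij mult.assoc)
  qed
  have vi: "v i = (\<Sum>j\<in>UNIV. of_nat (Poly_Mapping.lookup a j) * v j)" for i
  proof -
    have "coeff_at (var_poly i * (lin_form v * ?l)) a = 0"
      by (rule fermat_ideal_coeff[OF v]) (use degree_ge_2 in \<open>simp add: av less_le_trans[OF _ degree_ge_2]\<close>)
    moreover have "var_poly i * (lin_form v * ?l) = (\<Sum>j\<in>UNIV. const_poly (v j) * (var_poly i * (var_poly j * ?l)))"
      by (simp add: lin_form_def[of v] sum_distrib_left sum_distrib_right mult_ac)
    ultimately have "0 = (\<Sum>j\<in>UNIV. v j * coeff_at (var_poly i * (var_poly j * ?l)) a) * multi_fact a"
      by (simp add: lookup_sum)
    also have "\<dots> = (\<Sum>j\<in>UNIV. v j * (of_nat (Poly_Mapping.lookup a i) * (of_nat (Poly_Mapping.lookup a j) - (if i = j then 1 else 0)) * fact (fermat.T - 2)))"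
      by (simp only: sum_distrib_right mult.assoc[of "v _"] entry)
    also have "\<dots> = of_nat (Poly_Mapping.lookup a i) * fact (fermat.T - 2)
        * (\<Sum>j\<in>UNIV. of_nat (Poly_Mapping.lookup a j) * v j - (if i = j then v j else 0))"
      unfolding sum_distrib_left by (rule sum.cong) (auto simp: algebra_simps)
    also have "(\<Sum>j\<in>UNIV. of_nat (Poly_Mapping.lookup a j) * v j - (if i = j then v j else 0))
        = (\<Sum>j\<in>UNIV. of_nat (Poly_Mapping.lookup a j) * v j) - v i"
      by (simp add: sum_subtractf)
    finally show ?thesis using a1[of i] by auto
  qed
  define s where "s = (\<Sum>j\<in>UNIV. of_nat (Poly_Mapping.lookup a j) * v j)"
  have vs: "v i = s" for i unfolding s_def by (rule vi)
  have "s = of_nat fermat.T * s"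
    using dega by (subst s_def) (simp add: vs monom_degree_UNIV flip: sum_distrib_right of_nat_sum)
  then have "s = 0" using fermat.T_ge_3 by auto
  then show "v = (\<lambda>_. 0)" using vs by auto
qed

lemma fermat_lefschetz_surjective:
  assumes "p \<in> forms (fermat.T - 1)"
  shows "\<exists>v. p - lin_form v * lin_form (\<lambda>_. 1) ^ (fermat.T - 2) \<in> ideal_J (fermat d)"
proof -
  have "cls (fermat d) p \<in> graded_M (fermat d) (fermat.T - 1)" using assms by (simp add: graded_M_def)
  then obtain u where "u \<in> graded_M (fermat d) 1"
    "cls (fermat d) p = (cls (fermat d) (lin_form (\<lambda>_. 1)) [^]\<^bsub>alg_M (fermat d)\<^esub> (fermat.T - 2 * 1)) \<otimes>\<^bsub>alg_M (fermat d)\<^esub> u"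
    using fermat.bij_betw_if_hess[OF fermat_hess] unfolding bij_betw_def by blast
  then obtain l where l: "l \<in> forms 1"
    "cls (fermat d) p = cls (fermat d) (lin_form (\<lambda>_. 1) ^ (fermat.T - 2) * l)"
    by (auto simp: graded_M_def cls_power cls_mult)
  then obtain v where "l = lin_form v" by (auto elim: forms_1E)
  then show ?thesis using l(2) by (auto simp: cls_eq_iff mult.commute)
qed

text \<open>At a common zero of \<open>f\<close> the powers \<open>x\<^sub>i\<^sup>m\<close> vanish.\<close>

lemma complete_intersection_if_above_socle:
  assumes f: "f \<in> tuples d" and above: "\<And>p. p \<in> forms m \<Longrightarrow> p \<in> ideal_J f"
  shows "homogeneous_complete_intersection d f"
proof
  have "y i = 0" if y: "\<forall>j. eval_poly y (f j) = 0" for y i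
  proof -
    have "var_poly i ^ m \<in> ideal_J f" using above forms_power[OF forms_var, of i m] by simp
    then obtain g where "var_poly i ^ m = (\<Sum>j\<in>UNIV. g j * f j)" by (auto simp: mem_ideal_J)
    from arg_cong[OF this, of "eval_poly y"] show ?thesis using y by simp
  qed
  moreover have "eval_poly (\<lambda>_. 0) (f j) = 0" for j
    using f degree_ge_2[of j] by (intro forms_eval_0[of _ "d j"]) (auto simp: tuples_def)
  ultimately show "complete_intersection f" by (auto simp: complete_intersection_def fun_eq_iff)
qed (use three_variables degree_ge_2 f in \<open>auto simp: tuples_def\<close>)

text \<open>\<open>F\<close> controls that all forms of degree \<open>T + 1\<close> are in the ideal, which makes \<open>f\<close> a complete
  intersection; \<open>G\<close> controls the surjectivity of \<open>(\<Sum>i. x\<^sub>i)\<^sup>T\<^sup>-\<^sup>2\<close> onto degree \<open>T - 1\<close>.\<close>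

lemma generic_strong_lefschetz:
  "generically tuple_coord (tuples d) (\<lambda>f. complete_intersection f \<and> strong_lefschetz d f 1)"
proof -
  let ?T = "socle_degree d" and ?l = "lin_form (\<lambda>_ :: 'n. 1) ^ (socle_degree d - 2)"
  obtain F where F: "polyfun tuple_coord F" "F (fermat d) \<noteq> 0"
    "\<And>f p. f \<in> tuples d \<Longrightarrow> F f \<noteq> 0 \<Longrightarrow> p \<in> forms (?T + 1) \<Longrightarrow> \<exists>w\<in>{0}. p - w \<in> ideal_J f"
  proof (rule spanning_mod_ideal_open[of "{0}" "?T + 1" "fermat d" d])
    show "\<exists>w\<in>{0}. Poly_Mapping.single t 1 - w \<in> ideal_J (fermat d)" if "monom_degree t = ?T + 1" for t
      using fermat_above_socle[OF that] by simp
  qed auto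
  let ?W = "range (\<lambda>v :: 'n \<Rightarrow> complex. lin_form v * ?l)"
  obtain G where G: "polyfun tuple_coord G" "G (fermat d) \<noteq> 0"
    "\<And>f p. f \<in> tuples d \<Longrightarrow> G f \<noteq> 0 \<Longrightarrow> p \<in> forms (?T - 1) \<Longrightarrow> \<exists>w\<in>?W. p - w \<in> ideal_J f"
  proof (rule spanning_mod_ideal_open[of ?W "?T - 1" "fermat d" d])
    show "0 \<in> ?W" by (rule image_eqI[of _ _ "\<lambda>_. 0"]) (simp_all add: lin_form_def)
    show "v + w \<in> ?W" if vw: "v \<in> ?W" "w \<in> ?W" for v w
    proof -
      obtain x y where "v = lin_form x * ?l" "w = lin_form y * ?l" using vw by blast
      then have "v + w = lin_form (\<lambda>i. x i + y i) * ?l"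
        by (simp add: lin_form_def const_poly_add distrib_right sum.distrib)
      then show ?thesis by blast
    qed
    show "const_poly c * w \<in> ?W" if w: "w \<in> ?W" for c w
    proof -
      obtain x where "w = lin_form x * ?l" using w by blast
      then have "const_poly c * w = lin_form (\<lambda>i. c * x i) * ?l"
        by (simp add: lin_form_def const_poly_mult sum_distrib_left sum_distrib_right mult.assoc)
      then show ?thesis by blast
    qed
    show "?W \<subseteq> forms (?T - 1)"
    proof clarify
      fix v :: "'n \<Rightarrow> complex"
      have "1 + (?T - 2) = ?T - 1" using fermat.T_ge_3 by simp
      then show "lin_form v * ?l \<in> forms (?T - 1)"
        using forms_mult[OF lin_form_forms fermat.lin_form_power_forms, of v "\<lambda>_. 1" "?T - 2"] by simp
    qed
    show "\<exists>w\<in>?W. Poly_Mapping.single t 1 - w \<in> ideal_J (fermat d)" if "monom_degree t = ?T - 1" for t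
      using fermat_lefschetz_surjective[of "Poly_Mapping.single t 1"] that by auto
  qed auto
  show ?thesis
  proof (rule generically_if_polyfun[OF polyfun_mult[OF F(1) G(1)]])
    show "fermat d \<in> tuples d" by (simp add: tuples_def fermat_forms)
    show "F (fermat d) * G (fermat d) \<noteq> 0" using F(2) G(2) by simp
    fix f assume f: "f \<in> tuples d" and nz: "F f * G f \<noteq> 0"
    interpret homogeneous_complete_intersection d f
      using F(3)[OF f] nz by (intro complete_intersection_if_above_socle[OF f, of "?T + 1"]) auto
    have "strong_lefschetz d f 1"
    proof (rule strong_lefschetz_if_surjective)
      fix p :: "'n cpoly" assume "p \<in> forms (?T - 1)"
      then show "\<exists>u. p - lin_form u * lin_form (\<lambda>_. 1) ^ (?T - 2) \<in> ideal_J f"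
        using G(3)[OF f] nz by auto
    qed
    then show "complete_intersection f \<and> strong_lefschetz d f 1" using complete_intersection by blast
  qed
qed

end

section \<open>Smooth associated forms and the strong Lefschetz property\<close>

theorem theorem1p5:
  fixes d :: "'n::finite \<Rightarrow> nat"
  assumes "CARD('n) \<ge> 3"
    and "\<And>j. d j \<ge> 2"
  shows "(\<forall>f \<in> tuples d. complete_intersection f \<longrightarrow>
            (smooth_hypersurface (assoc_form d f) \<longleftrightarrow>
               proj_space (ideal_J f \<inter> forms (socle_degree d - 1)) \<inter>
                 veronese (socle_degree d - 1) = {}) \<and>
            (smooth_hypersurface (assoc_form d f) \<longrightarrow> strong_lefschetz d f 1)) \<and>
         generically tuple_coord (tuples d)
           (\<lambda>f. complete_intersection f \<and> strong_lefschetz d f 1)"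
proof (intro conjI ballI impI)
  fix f assume "f \<in> tuples d" "complete_intersection f"
  then interpret homogeneous_complete_intersection d f
    using assms by unfold_locales (auto simp: tuples_def)
  show "smooth_hypersurface (assoc_form d f) \<longleftrightarrow>
      proj_space (ideal_J f \<inter> forms (socle_degree d - 1)) \<inter> veronese (socle_degree d - 1) = {}"
    by (simp only: smooth_iff veronese_disjoint_iff)
  show "strong_lefschetz d f 1" if "smooth_hypersurface (assoc_form d f)"
    using that by (rule strong_lefschetz_if_smooth)
next
  show "generically tuple_coord (tuples d) (\<lambda>f. complete_intersection f \<and> strong_lefschetz d f 1)"
    by (rule generic_strong_lefschetz[OF assms])
qed

end
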